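(* Let $\mathbb{D}$ be a fibrant double category which has stable local colimits. Then the category of monads $\mathsf{Mnd}(\mathbb{D})$ is cocomplete.
   Context: A (pseudo) double category $\mathbb{D}$ consists of a category $\mathbb{D}_0$ (objects: 0-cells; morphisms: vertical 1-cells), a category $\mathbb{D}_1$ (objects: horizontal 1-cells; morphisms: 2-cells), and functors $\mathbf{1}\colon\mathbb{D}_0\to\mathbb{D}_1$, $X\mapsto 1_X$, $f\mapsto 1_f$ (units), $\mathfrak{s},\mathfrak{t}\colon\mathbb{D}_1\to\mathbb{D}_0$ (source, target), $\odot\colon\mathbb{D}_1\times_{\mathbb{D}_0}\mathbb{D}_1\to\mathbb{D}_1$ (horizontal composition; $M\odot N$ is defined when $\mathfrak{s}(M)=\mathfrak{t}(N)$), with $\mathfrak{s}(1_X)=\mathfrak{t}(1_X)=X$, $\mathfrak{s}(M\odot N)=\mathfrak{s}(N)$, $\mathfrak{t}(M\odot N)=\mathfrak{t}(M)$ (and likewise on morphisms), together with natural associativity and left/right unit isomorphisms for $\odot$ and $\mathbf{1}$ in $\mathbb{D}_1$ whose images under $\mathfrak{s}$ and $\mathfrak{t}$ are identities, satisfying the usual coherence conditions. A horizontal 1-cell $M$ with $\mathfrak{s}(M)=X$, $\mathfrak{t}(M)=Y$ is written $M\colon X\to Y$. A 2-cell $\alpha$ is globular if $\mathfrak{s}(\alpha)$ and $\mathfrak{t}(\alpha)$ are identities. $\mathbb{D}[X,Y]$ denotes the category of horizontal 1-cells $X\to Y$ and globular 2-cells. $\mathbb{D}$ is fibrant if $\langle\mathfrak{s},\mathfrak{t}\rangle\colon\mathbb{D}_1\to\mathbb{D}_0\times\mathbb{D}_0$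 is a (Grothendieck) fibration, equivalently an opfibration. For a small category $\mathcal{I}$, $\mathbb{D}$ has stable local $\mathcal{I}$-colimits if every $\mathbb{D}[X,Y]$ has $\mathcal{I}$-colimits and these are preserved by the functors $M\odot-\colon\mathbb{D}[Z,X]\to\mathbb{D}[Z,Y]$ and $-\odot M\colon\mathbb{D}[Y,Z]\to\mathbb{D}[X,Z]$ for every $M\colon X\to Y$ and every 0-cell $Z$; by convention the phrase also includes the assumption that $\mathbb{D}_0$ has $\mathcal{I}$-colimits. $\mathbb{D}$ has stable local colimits if this holds for every small $\mathcal{I}$. A monad in $\mathbb{D}$ is a horizontal endo-1-cell $A\colon X\to X$ with globular 2-cells $\mu\colon A\odot A\Rightarrow A$, $\eta\colon 1_X\Rightarrow A$ satisfying the usual associativity and unit laws. A monad morphism from $A\colon X\to X$ to $B\colon Y\to Y$ is a 2-cell $\alpha\colon A\Rightarrow B$ with $\mathfrak{s}(\alpha)=\mathfrak{t}(\alpha)=f\colon X\to Y$ such that $\mu_B(\alpha\odot\alpha)=\alpha\mu_A$ and $\alpha\eta_A=\eta_B 1_f$. These form the category $\mathsf{Mnd}(\mathbb{D})$. *)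

theory Defs
  imports Main
begin

section \<open>Categories, functors and colimits\<close>

text \<open>
  Categories have explicit carriers. The operations are total HOL functions, whose values matter
  only on the carriers; \<open>g \<cdot>\<^bsub>C\<^esub> f\<close> is ``\<open>g\<close> after \<open>f\<close>'' and is
  meaningful when \<open>Dom C g = Cod C f\<close>.
\<close>

record ('o, 'a) cat =
  Obj :: "'o set"
  Arr :: "'a set"
  Dom :: "'a \<Rightarrow> 'o"
  Cod :: "'a \<Rightarrow> 'o"
  Ident :: "'o \<Rightarrow> 'a"
  Comp :: "'a \<Rightarrow> 'a \<Rightarrow> 'a" (infixr "\<cdot>\<index>" 55)

definition hom :: "('o, 'a) cat \<Rightarrow> 'o \<Rightarrow> 'o \<Rightarrow> 'a set" where
  "hom C x y = {f \<in> Arr C. Dom C f = x \<and> Cod C f = y}"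

locale category =
  fixes C :: "('o, 'a) cat" (structure)
  assumes Dom_in: "f \<in> Arr C \<Longrightarrow> Dom C f \<in> Obj C"
    and Cod_in: "f \<in> Arr C \<Longrightarrow> Cod C f \<in> Obj C"
    and Ident_in: "x \<in> Obj C \<Longrightarrow> Ident C x \<in> hom C x x"
    and Comp_in: "\<lbrakk>f \<in> Arr C; g \<in> Arr C; Dom C g = Cod C f\<rbrakk>
      \<Longrightarrow> g \<cdot> f \<in> hom C (Dom C f) (Cod C g)"
    and Comp_Ident: "f \<in> Arr C \<Longrightarrow> f \<cdot> Ident C (Dom C f) = f"
    and Ident_Comp: "f \<in> Arr C \<Longrightarrow> Ident C (Cod C f) \<cdot> f = f"
    and Comp_assoc: "\<lbrakk>f \<in> Arr C; g \<in> Arr C; h \<in> Arr C; Dom C g = Cod C f; Dom C h = Cod C g\<rbrakk>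
      \<Longrightarrow> (h \<cdot> g) \<cdot> f = h \<cdot> (g \<cdot> f)"

definition is_iso :: "('o, 'a) cat \<Rightarrow> 'a \<Rightarrow> bool" where
  "is_iso C f \<longleftrightarrow> f \<in> Arr C \<and> (\<exists>g \<in> hom C (Cod C f) (Dom C f).
     g \<cdot>\<^bsub>C\<^esub> f = Ident C (Dom C f) \<and> f \<cdot>\<^bsub>C\<^esub> g = Ident C (Cod C f))"

record ('o, 'a, 'p, 'b) ftor =
  fobj :: "'o \<Rightarrow> 'p"
  farr :: "'a \<Rightarrow> 'b"

locale is_functor =
  fixes A :: "('o, 'a) cat" and B :: "('p, 'b) cat" and F :: "('o, 'a, 'p, 'b) ftor"
  assumes source_category: "category A"
    and target_category: "category B"
    and fobj_in: "x \<in> Obj A \<Longrightarrow> fobj F x \<in> Obj B"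
    and farr_in: "f \<in> Arr A \<Longrightarrow> farr F f \<in> hom B (fobj F (Dom A f)) (fobj F (Cod A f))"
    and farr_Ident: "x \<in> Obj A \<Longrightarrow> farr F (Ident A x) = Ident B (fobj F x)"
    and farr_Comp: "\<lbrakk>f \<in> Arr A; g \<in> Arr A; Dom A g = Cod A f\<rbrakk>
      \<Longrightarrow> farr F (g \<cdot>\<^bsub>A\<^esub> f) = farr F g \<cdot>\<^bsub>B\<^esub> farr F f"

definition ftor_comp :: "('p, 'b, 'q, 'c) ftor \<Rightarrow> ('o, 'a, 'p, 'b) ftor \<Rightarrow> ('o, 'a, 'q, 'c) ftor"
  where "ftor_comp G F = \<lparr>fobj = fobj G \<circ> fobj F, farr = farr G \<circ> farr F\<rparr>"

definition prod_cat :: "('o, 'a) cat \<Rightarrow> ('p, 'b) cat \<Rightarrow> ('o \<times> 'p, 'a \<times> 'b) cat" where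
  "prod_cat A B =
    \<lparr>Obj = Obj A \<times> Obj B,
     Arr = Arr A \<times> Arr B,
     Dom = (\<lambda>(f, g). (Dom A f, Dom B g)),
     Cod = (\<lambda>(f, g). (Cod A f, Cod B g)),
     Ident = (\<lambda>(x, y). (Ident A x, Ident B y)),
     Comp = (\<lambda>(f', g') (f, g). (f' \<cdot>\<^bsub>A\<^esub> f, g' \<cdot>\<^bsub>B\<^esub> g))\<rparr>"

definition pair_ftor :: "('o, 'a, 'p, 'b) ftor \<Rightarrow> ('o, 'a, 'q, 'c) ftor \<Rightarrow> ('o, 'a, 'p \<times> 'q, 'b \<times> 'c) ftor"
  where "pair_ftor F G = \<lparr>fobj = (\<lambda>x. (fobj F x, fobj G x)), farr = (\<lambda>f. (farr F f, farr G f))\<rparr>"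

text \<open>The strict pullback of two functors \<open>F : A \<rightarrow> C\<close> and \<open>G : B \<rightarrow> C\<close>.\<close>

definition pullback_cat ::
  "('o, 'a) cat \<Rightarrow> ('p, 'b) cat \<Rightarrow> ('o, 'a, 'q, 'c) ftor \<Rightarrow> ('p, 'b, 'q, 'c) ftor
    \<Rightarrow> ('o \<times> 'p, 'a \<times> 'b) cat" where
  "pullback_cat A B F G = (prod_cat A B)
    \<lparr>Obj := {(x, y). x \<in> Obj A \<and> y \<in> Obj B \<and> fobj F x = fobj G y},
     Arr := {(f, g). f \<in> Arr A \<and> g \<in> Arr B \<and> farr F f = farr G g}\<rparr>"

definition is_cartesian ::
  "('o, 'a) cat \<Rightarrow> ('p, 'b) cat \<Rightarrow> ('o, 'a, 'p, 'b) ftor \<Rightarrow> 'a \<Rightarrow> bool" where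
  "is_cartesian E B P \<phi> \<longleftrightarrow> \<phi> \<in> Arr E \<and>
    (\<forall>\<psi> \<in> Arr E. \<forall>u \<in> hom B (fobj P (Dom E \<psi>)) (fobj P (Dom E \<phi>)).
       Cod E \<psi> = Cod E \<phi> \<and> farr P \<phi> \<cdot>\<^bsub>B\<^esub> u = farr P \<psi> \<longrightarrow>
       (\<exists>!\<chi>. \<chi> \<in> hom E (Dom E \<psi>) (Dom E \<phi>) \<and> farr P \<chi> = u \<and> \<phi> \<cdot>\<^bsub>E\<^esub> \<chi> = \<psi>))"

definition is_fibration :: "('o, 'a) cat \<Rightarrow> ('p, 'b) cat \<Rightarrow> ('o, 'a, 'p, 'b) ftor \<Rightarrow> bool" where
  "is_fibration E B P \<longleftrightarrow> is_functor E B P \<and>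
    (\<forall>y \<in> Obj E. \<forall>f \<in> Arr B. Cod B f = fobj P y \<longrightarrow>
       (\<exists>\<phi>. is_cartesian E B P \<phi> \<and> Cod E \<phi> = y \<and> farr P \<phi> = f))"

definition is_cocone ::
  "('i, 'j) cat \<Rightarrow> ('o, 'a) cat \<Rightarrow> ('i, 'j, 'o, 'a) ftor \<Rightarrow> 'o \<Rightarrow> ('i \<Rightarrow> 'a) \<Rightarrow> bool" where
  "is_cocone I C F c \<kappa> \<longleftrightarrow> c \<in> Obj C \<and>
    (\<forall>i \<in> Obj I. \<kappa> i \<in> hom C (fobj F i) c) \<and>
    (\<forall>j \<in> Arr I. \<kappa> (Cod I j) \<cdot>\<^bsub>C\<^esub> farr F j = \<kappa> (Dom I j))"

definition is_colimit ::
  "('i, 'j) cat \<Rightarrow> ('o, 'a) cat \<Rightarrow> ('i, 'j, 'o, 'a) ftor \<Rightarrow> 'o \<Rightarrow> ('i \<Rightarrow> 'a) \<Rightarrow> bool" where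
  "is_colimit I C F c \<kappa> \<longleftrightarrow> is_cocone I C F c \<kappa> \<and>
    (\<forall>d \<mu>. is_cocone I C F d \<mu> \<longrightarrow>
       (\<exists>!h. h \<in> hom C c d \<and> (\<forall>i \<in> Obj I. h \<cdot>\<^bsub>C\<^esub> \<kappa> i = \<mu> i)))"

definition has_colimits :: "('i, 'j) cat \<Rightarrow> ('o, 'a) cat \<Rightarrow> bool" where
  "has_colimits I C \<longleftrightarrow>
    (\<forall>F :: ('i, 'j, 'o, 'a) ftor. is_functor I C F \<longrightarrow> (\<exists>c \<kappa>. is_colimit I C F c \<kappa>))"

definition preserves_colimits ::
  "('i, 'j) cat \<Rightarrow> ('o, 'a) cat \<Rightarrow> ('p, 'b) cat \<Rightarrow> ('o, 'a, 'p, 'b) ftor \<Rightarrow> bool" where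
  "preserves_colimits I C C' G \<longleftrightarrow>
    (\<forall>(F :: ('i, 'j, 'o, 'a) ftor) c \<kappa>. is_functor I C F \<and> is_colimit I C F c \<kappa> \<longrightarrow>
       is_colimit I C' (ftor_comp G F) (fobj G c) (farr G \<circ> \<kappa>))"

text \<open>
  HOL has no universe of sets, so ``small'' is relative to a type \<open>'i\<close>: a small category is one
  whose objects and arrows are drawn from \<open>'i\<close>. Up to isomorphism these are the categories with at
  most \<open>|'i|\<close> objects and arrows. Results are stated for an arbitrary infinite \<open>'i\<close>.
\<close>

type_synonym 'i small_cat = "('i, 'i) cat"

definition cocomplete :: "'i itself \<Rightarrow> ('o, 'a) cat \<Rightarrow> bool" where
  "cocomplete (_ :: 'i itself) C \<longleftrightarrow> category C \<and>
    (\<forall>I :: 'i small_cat. category I \<longrightarrow> has_colimits I C)"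


section \<open>Pseudo double categories\<close>

text \<open>
  \<open>hassoc D M N P : (M \<odot> N) \<odot> P \<rightarrow> M \<odot> (N \<odot> P)\<close>,
  \<open>lunit D M : 1 \<odot> M \<rightarrow> M\<close> and \<open>runit D M : M \<odot> 1 \<rightarrow> M\<close>
  are the components of the structure isomorphisms.
\<close>

record ('o, 'v, 'h, 'c) double_cat =
  D0 :: "('o, 'v) cat"
  D1 :: "('h, 'c) cat"
  unit_ftor :: "('o, 'v, 'h, 'c) ftor"
  src :: "('h, 'c, 'o, 'v) ftor"
  tgt :: "('h, 'c, 'o, 'v) ftor"
  hcomp :: "('h \<times> 'h, 'c \<times> 'c, 'h, 'c) ftor"
  hassoc :: "'h \<Rightarrow> 'h \<Rightarrow> 'h \<Rightarrow> 'c"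
  lunit :: "'h \<Rightarrow> 'c"
  runit :: "'h \<Rightarrow> 'c"

text \<open>
  Horizontal composition is written \<open>\<odot>\<close> on horizontal 1-cells and \<open>\<star>\<close> on 2-cells;
  \<open>hunit\<close> is the unit horizontal 1-cell of a 0-cell.
\<close>

definition hcomp_obj :: "('o, 'v, 'h, 'c) double_cat \<Rightarrow> 'h \<Rightarrow> 'h \<Rightarrow> 'h" (infixr "\<odot>\<index>" 70) where
  "M \<odot>\<^bsub>D\<^esub> N = fobj (hcomp D) (M, N)"

definition hcomp_arr :: "('o, 'v, 'h, 'c) double_cat \<Rightarrow> 'c \<Rightarrow> 'c \<Rightarrow> 'c" (infixr "\<star>\<index>" 70) where
  "\<alpha> \<star>\<^bsub>D\<^esub> \<beta> = farr (hcomp D) (\<alpha>, \<beta>)"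

abbreviation hunit :: "('o, 'v, 'h, 'c) double_cat \<Rightarrow> 'o \<Rightarrow> 'h" where
  "hunit D X \<equiv> fobj (unit_ftor D) X"

abbreviation id2 :: "('o, 'v, 'h, 'c) double_cat \<Rightarrow> 'h \<Rightarrow> 'c" where
  "id2 D M \<equiv> Ident (D1 D) M"

definition globular :: "('o, 'v, 'h, 'c) double_cat \<Rightarrow> 'c \<Rightarrow> bool" where
  "globular D \<alpha> \<longleftrightarrow> \<alpha> \<in> Arr (D1 D) \<and>
    farr (src D) \<alpha> \<in> Ident (D0 D) ` Obj (D0 D) \<and> farr (tgt D) \<alpha> \<in> Ident (D0 D) ` Obj (D0 D)"

locale double_category =
  fixes D :: "('o, 'v, 'h, 'c) double_cat" (structure)
  assumes category_D0: "category (D0 D)"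
    and category_D1: "category (D1 D)"
    and functor_unit: "is_functor (D0 D) (D1 D) (unit_ftor D)"
    and functor_src: "is_functor (D1 D) (D0 D) (src D)"
    and functor_tgt: "is_functor (D1 D) (D0 D) (tgt D)"
    and functor_hcomp:
      "is_functor (pullback_cat (D1 D) (D1 D) (src D) (tgt D)) (D1 D) (hcomp D)"
    and src_unit: "X \<in> Obj (D0 D) \<Longrightarrow> fobj (src D) (hunit D X) = X"
    and tgt_unit: "X \<in> Obj (D0 D) \<Longrightarrow> fobj (tgt D) (hunit D X) = X"
    and src_unit_arr: "f \<in> Arr (D0 D) \<Longrightarrow> farr (src D) (farr (unit_ftor D) f) = f"
    and tgt_unit_arr: "f \<in> Arr (D0 D) \<Longrightarrow> farr (tgt D) (farr (unit_ftor D) f) = f"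
    and src_hcomp: "\<lbrakk>M \<in> Obj (D1 D); N \<in> Obj (D1 D); fobj (src D) M = fobj (tgt D) N\<rbrakk>
      \<Longrightarrow> fobj (src D) (M \<odot> N) = fobj (src D) N"
    and tgt_hcomp: "\<lbrakk>M \<in> Obj (D1 D); N \<in> Obj (D1 D); fobj (src D) M = fobj (tgt D) N\<rbrakk>
      \<Longrightarrow> fobj (tgt D) (M \<odot> N) = fobj (tgt D) M"
    and src_hcomp_arr: "\<lbrakk>\<alpha> \<in> Arr (D1 D); \<beta> \<in> Arr (D1 D); farr (src D) \<alpha> = farr (tgt D) \<beta>\<rbrakk>
      \<Longrightarrow> farr (src D) (\<alpha> \<star> \<beta>) = farr (src D) \<beta>"
    and tgt_hcomp_arr: "\<lbrakk>\<alpha> \<in> Arr (D1 D); \<beta> \<in> Arr (D1 D); farr (src D) \<alpha> = farr (tgt D) \<beta>\<rbrakk>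
      \<Longrightarrow> farr (tgt D) (\<alpha> \<star> \<beta>) = farr (tgt D) \<alpha>"
    and hassoc_in: "\<lbrakk>M \<in> Obj (D1 D); N \<in> Obj (D1 D); P \<in> Obj (D1 D);
        fobj (src D) M = fobj (tgt D) N; fobj (src D) N = fobj (tgt D) P\<rbrakk>
      \<Longrightarrow> hassoc D M N P \<in> hom (D1 D) ((M \<odot> N) \<odot> P) (M \<odot> (N \<odot> P)) \<and>
          is_iso (D1 D) (hassoc D M N P) \<and> globular D (hassoc D M N P)"
    and lunit_in: "M \<in> Obj (D1 D)
      \<Longrightarrow> lunit D M \<in> hom (D1 D) (hunit D (fobj (tgt D) M) \<odot> M) M \<and>
          is_iso (D1 D) (lunit D M) \<and> globular D (lunit D M)"
    and runit_in: "M \<in> Obj (D1 D)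
      \<Longrightarrow> runit D M \<in> hom (D1 D) (M \<odot> hunit D (fobj (src D) M)) M \<and>
          is_iso (D1 D) (runit D M) \<and> globular D (runit D M)"
    and hassoc_natural: "\<lbrakk>\<alpha> \<in> hom (D1 D) M M'; \<beta> \<in> hom (D1 D) N N'; \<gamma> \<in> hom (D1 D) P P';
        farr (src D) \<alpha> = farr (tgt D) \<beta>; farr (src D) \<beta> = farr (tgt D) \<gamma>\<rbrakk>
      \<Longrightarrow> hassoc D M' N' P' \<cdot>\<^bsub>D1 D\<^esub> ((\<alpha> \<star> \<beta>) \<star> \<gamma>) = (\<alpha> \<star> (\<beta> \<star> \<gamma>)) \<cdot>\<^bsub>D1 D\<^esub> hassoc D M N P"
    and lunit_natural: "\<alpha> \<in> hom (D1 D) M M'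
      \<Longrightarrow> lunit D M' \<cdot>\<^bsub>D1 D\<^esub> (farr (unit_ftor D) (farr (tgt D) \<alpha>) \<star> \<alpha>) = \<alpha> \<cdot>\<^bsub>D1 D\<^esub> lunit D M"
    and runit_natural: "\<alpha> \<in> hom (D1 D) M M'
      \<Longrightarrow> runit D M' \<cdot>\<^bsub>D1 D\<^esub> (\<alpha> \<star> farr (unit_ftor D) (farr (src D) \<alpha>)) = \<alpha> \<cdot>\<^bsub>D1 D\<^esub> runit D M"
    and triangle: "\<lbrakk>M \<in> Obj (D1 D); N \<in> Obj (D1 D); fobj (src D) M = fobj (tgt D) N\<rbrakk>
      \<Longrightarrow> (id2 D M \<star> lunit D N) \<cdot>\<^bsub>D1 D\<^esub> hassoc D M (hunit D (fobj (src D) M)) N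
          = runit D M \<star> id2 D N"
    and pentagon: "\<lbrakk>M \<in> Obj (D1 D); N \<in> Obj (D1 D); P \<in> Obj (D1 D); Q \<in> Obj (D1 D);
        fobj (src D) M = fobj (tgt D) N; fobj (src D) N = fobj (tgt D) P;
        fobj (src D) P = fobj (tgt D) Q\<rbrakk>
      \<Longrightarrow> hassoc D M N (P \<odot> Q) \<cdot>\<^bsub>D1 D\<^esub> hassoc D (M \<odot> N) P Q
          = (id2 D M \<star> hassoc D N P Q) \<cdot>\<^bsub>D1 D\<^esub> hassoc D M (N \<odot> P) Q \<cdot>\<^bsub>D1 D\<^esub> (hassoc D M N P \<star> id2 D Q)"

definition fibrant :: "('o, 'v, 'h, 'c) double_cat \<Rightarrow> bool" where
  "fibrant D \<longleftrightarrow> is_fibration (D1 D) (prod_cat (D0 D) (D0 D)) (pair_ftor (src D) (tgt D))"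

definition local_cat :: "('o, 'v, 'h, 'c) double_cat \<Rightarrow> 'o \<Rightarrow> 'o \<Rightarrow> ('h, 'c) cat" where
  "local_cat D X Y = (D1 D)
    \<lparr>Obj := {M \<in> Obj (D1 D). fobj (src D) M = X \<and> fobj (tgt D) M = Y},
     Arr := {\<alpha> \<in> Arr (D1 D). farr (src D) \<alpha> = Ident (D0 D) X \<and> farr (tgt D) \<alpha> = Ident (D0 D) Y}\<rparr>"

text \<open>The functors \<open>M \<odot> -\<close> and \<open>- \<odot> M\<close>.\<close>

definition post_comp :: "('o, 'v, 'h, 'c) double_cat \<Rightarrow> 'h \<Rightarrow> ('h, 'c, 'h, 'c) ftor" where
  "post_comp D M = \<lparr>fobj = (\<lambda>N. M \<odot>\<^bsub>D\<^esub> N), farr = (\<lambda>\<beta>. id2 D M \<star>\<^bsub>D\<^esub> \<beta>)\<rparr>"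

definition pre_comp :: "('o, 'v, 'h, 'c) double_cat \<Rightarrow> 'h \<Rightarrow> ('h, 'c, 'h, 'c) ftor" where
  "pre_comp D M = \<lparr>fobj = (\<lambda>N. N \<odot>\<^bsub>D\<^esub> M), farr = (\<lambda>\<beta>. \<beta> \<star>\<^bsub>D\<^esub> id2 D M)\<rparr>"

definition stable_local_colimits_of :: "('i, 'j) cat \<Rightarrow> ('o, 'v, 'h, 'c) double_cat \<Rightarrow> bool" where
  "stable_local_colimits_of I D \<longleftrightarrow>
    has_colimits I (D0 D) \<and>
    (\<forall>X \<in> Obj (D0 D). \<forall>Y \<in> Obj (D0 D). has_colimits I (local_cat D X Y)) \<and>
    (\<forall>X \<in> Obj (D0 D). \<forall>Y \<in> Obj (D0 D). \<forall>Z \<in> Obj (D0 D). \<forall>M \<in> Obj (local_cat D X Y).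
       preserves_colimits I (local_cat D Z X) (local_cat D Z Y) (post_comp D M) \<and>
       preserves_colimits I (local_cat D Y Z) (local_cat D X Z) (pre_comp D M))"

definition stable_local_colimits :: "'i itself \<Rightarrow> ('o, 'v, 'h, 'c) double_cat \<Rightarrow> bool" where
  "stable_local_colimits (_ :: 'i itself) D \<longleftrightarrow>
    (\<forall>I :: 'i small_cat. category I \<longrightarrow> stable_local_colimits_of I D)"


section \<open>Monads in a double category\<close>

record ('h, 'c) monad =
  mcell :: 'h
  mmult :: 'c
  munit :: 'c

definition is_monad :: "('o, 'v, 'h, 'c) double_cat \<Rightarrow> ('h, 'c) monad \<Rightarrow> bool" where
  "is_monad D \<A> \<longleftrightarrow>
    (let A = mcell \<A>; \<mu> = mmult \<A>; \<eta> = munit \<A>; X = fobj (src D) A in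
      A \<in> Obj (D1 D) \<and> fobj (tgt D) A = X \<and>
      \<mu> \<in> hom (local_cat D X X) (A \<odot>\<^bsub>D\<^esub> A) A \<and>
      \<eta> \<in> hom (local_cat D X X) (hunit D X) A \<and>
      \<mu> \<cdot>\<^bsub>D1 D\<^esub> (\<mu> \<star>\<^bsub>D\<^esub> id2 D A) = \<mu> \<cdot>\<^bsub>D1 D\<^esub> (id2 D A \<star>\<^bsub>D\<^esub> \<mu>) \<cdot>\<^bsub>D1 D\<^esub> hassoc D A A A \<and>
      \<mu> \<cdot>\<^bsub>D1 D\<^esub> (\<eta> \<star>\<^bsub>D\<^esub> id2 D A) = lunit D A \<and>
      \<mu> \<cdot>\<^bsub>D1 D\<^esub> (id2 D A \<star>\<^bsub>D\<^esub> \<eta>) = runit D A)"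

definition is_monad_mor ::
  "('o, 'v, 'h, 'c) double_cat \<Rightarrow> ('h, 'c) monad \<Rightarrow> ('h, 'c) monad \<Rightarrow> 'c \<Rightarrow> bool" where
  "is_monad_mor D \<A> \<B> \<alpha> \<longleftrightarrow>
    \<alpha> \<in> hom (D1 D) (mcell \<A>) (mcell \<B>) \<and>
    farr (src D) \<alpha> = farr (tgt D) \<alpha> \<and>
    mmult \<B> \<cdot>\<^bsub>D1 D\<^esub> (\<alpha> \<star>\<^bsub>D\<^esub> \<alpha>) = \<alpha> \<cdot>\<^bsub>D1 D\<^esub> mmult \<A> \<and>
    \<alpha> \<cdot>\<^bsub>D1 D\<^esub> munit \<A> = munit \<B> \<cdot>\<^bsub>D1 D\<^esub> farr (unit_ftor D) (farr (src D) \<alpha>)"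

text \<open>
  A 2-cell does not determine the monad structures on its domain and codomain, so the arrows of
  the category of monads carry their endpoints.
\<close>

definition Mnd ::
  "('o, 'v, 'h, 'c) double_cat
    \<Rightarrow> (('h, 'c) monad, ('h, 'c) monad \<times> 'c \<times> ('h, 'c) monad) cat" where
  "Mnd D =
    \<lparr>Obj = {\<A>. is_monad D \<A>},
     Arr = {(\<A>, \<alpha>, \<B>). is_monad D \<A> \<and> is_monad D \<B> \<and> is_monad_mor D \<A> \<B> \<alpha>},
     Dom = (\<lambda>(\<A>, \<alpha>, \<B>). \<A>),
     Cod = (\<lambda>(\<A>, \<alpha>, \<B>). \<B>),
     Ident = (\<lambda>\<A>. (\<A>, id2 D (mcell \<A>), \<A>)),
     Comp = (\<lambda>(\<B>', \<beta>, \<C>) (\<A>, \<alpha>, \<B>). (\<A>, \<beta> \<cdot>\<^bsub>D1 D\<^esub> \<alpha>, \<C>))\<rparr>"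

end

theory Submission
  imports Defs
begin

text \<open>
  Let a small diagram of monads \<open>A\<^sub>i\<close> on 0-cells \<open>X\<^sub>i\<close> be given. The vertical 1-cells underlying it have
  a colimit \<open>X\<close> with cocone \<open>k\<^sub>i : X\<^sub>i \<rightarrow> X\<close>, and the colimit of the monads is built on \<open>X\<close>
  by generators and relations inside the monoidal category \<open>\<D>[X, X]\<close> of endo-1-cells of \<open>X\<close>.

  Three facts make this work. First, fibrancy provides a companion and a conjoint of every
  vertical 1-cell, so a 2-cell \<open>M \<Rightarrow> B\<close> lying over \<open>(k, k)\<close> is the same as a globular 2-cell
  \<open>N \<Rightarrow> B\<close> out of the pushforward \<open>N\<close> of \<open>M\<close> (\<open>pushforward_exists\<close>). With local coproducts, a whole
  family of 2-cells lying over varying vertical 1-cells is represented by a single object of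
  \<open>\<D>[X, X]\<close> (\<open>pushforward_coproduct_exists\<close>).

  Second, a monoidal category whose tensor product preserves countable coproducts and
  coequalizers in each variable has free monoids (\<open>free_monoid_exists\<close>), and a monoid in it can be
  divided by the two-sided ideal that a parallel pair of arrows into it generates
  (\<open>quotient_monoid_exists\<close>). Applied to \<open>\<D>[X, X]\<close>: take the free monad \<open>T\<close> on the object
  representing the family of all \<open>A\<^sub>i\<close>, and divide it by relations saying that the
  2-cells \<open>A\<^sub>i \<Rightarrow> T\<close> respect multiplications and units and are compatible with the diagram. These relations
  form again a family of pairs of 2-cells over vertical 1-cells, hence a single parallel pair in \<open>\<D>[X, X]\<close>.
  The quotient \<open>Q\<close> is universal among monads on \<open>X\<close> that receive a cocone of monad morphisms lying
  over the \<open>k\<^sub>i\<close> (\<open>cocone_monad_exists\<close>).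

  Third, a monad \<open>B\<close> on \<open>Y\<close> restricts along every \<open>f : X \<rightarrow> Y\<close> to a monad on \<open>X\<close>, and the cartesian
  2-cell from the restriction to \<open>B\<close> is a monad morphism through which those lying over \<open>f\<close> factor
  (\<open>restricted_monad_exists\<close>, \<open>monad_mor_lift\<close>). A cocone from the \<open>A\<^sub>i\<close> to \<open>B\<close> induces some
  \<open>f : X \<rightarrow> Y\<close> because \<open>X\<close> is a colimit, and it factors through the restriction of \<open>B\<close>
  along \<open>f\<close>; so the universal property of \<open>Q\<close> among monads on \<open>X\<close> extends to all monads.
\<close>

section \<open>Categories, coproducts and coequalizers\<close>

text \<open>
  Arrows are typed by the three conditions on membership, domain and codomain instead of by hom-sets:
  as rewrite rules these let the simplifier discharge all side conditions of associativity,
  interchange and naturality, so the calculations below show only their algebraic steps.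
\<close>

lemma in_hom_iff [simp]:
  "f \<in> hom C x y \<longleftrightarrow> f \<in> Arr C \<and> Dom C f = x \<and> Cod C f = y"
  by (simp add: hom_def)

context category
begin

abbreviation one :: "'o \<Rightarrow> 'a" ("\<one>") where "\<one> \<equiv> Ident C"

lemma Ident_typing [simp]:
  assumes "x \<in> Obj C"
  shows "\<one> x \<in> Arr C" "Dom C (\<one> x) = x" "Cod C (\<one> x) = x"
  using Ident_in[OF assms] by auto

lemma Comp_typing [simp]:
  assumes "f \<in> Arr C" "g \<in> Arr C" "Dom C g = Cod C f"
  shows "g \<cdot> f \<in> Arr C" "Dom C (g \<cdot> f) = Dom C f" "Cod C (g \<cdot> f) = Cod C g"
  using Comp_in[OF assms] by auto

lemma Comp_one [simp]: "f \<in> Arr C \<Longrightarrow> Dom C f = x \<Longrightarrow> f \<cdot> \<one> x = f"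
  using Comp_Ident by blast

lemma one_Comp [simp]: "f \<in> Arr C \<Longrightarrow> Cod C f = x \<Longrightarrow> \<one> x \<cdot> f = f"
  using Ident_Comp by blast

declare Dom_in [simp] Cod_in [simp] Comp_assoc [simp]

lemma Comp_left_cancel_chain:
  assumes "g \<cdot> f = h" "f \<in> Arr C" "g \<in> Arr C" "Dom C g = Cod C f" "k \<in> Arr C" "Cod C k = Dom C f"
  shows "g \<cdot> (f \<cdot> k) = h \<cdot> k"
  using Comp_assoc[of k f g] assms by simp

end

definition inv_arr :: "('o, 'a) cat \<Rightarrow> 'a \<Rightarrow> 'a" where
  "inv_arr C f = (SOME g. g \<in> hom C (Cod C f) (Dom C f) \<and>
     g \<cdot>\<^bsub>C\<^esub> f = Ident C (Dom C f) \<and> f \<cdot>\<^bsub>C\<^esub> g = Ident C (Cod C f))"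

lemma inv_arr:
  assumes "is_iso C f"
  shows "inv_arr C f \<in> hom C (Cod C f) (Dom C f)"
    and "inv_arr C f \<cdot>\<^bsub>C\<^esub> f = Ident C (Dom C f)"
    and "f \<cdot>\<^bsub>C\<^esub> inv_arr C f = Ident C (Cod C f)"
proof -
  have "\<exists>g. g \<in> hom C (Cod C f) (Dom C f) \<and>
     g \<cdot>\<^bsub>C\<^esub> f = Ident C (Dom C f) \<and> f \<cdot>\<^bsub>C\<^esub> g = Ident C (Cod C f)"
    using assms unfolding is_iso_def by blast
  from someI_ex[OF this, folded inv_arr_def]
  show "inv_arr C f \<in> hom C (Cod C f) (Dom C f)"
    and "inv_arr C f \<cdot>\<^bsub>C\<^esub> f = Ident C (Dom C f)"
    and "f \<cdot>\<^bsub>C\<^esub> inv_arr C f = Ident C (Cod C f)"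
    by blast+
qed

definition is_epi :: "('o, 'a) cat \<Rightarrow> 'a \<Rightarrow> bool" where
  "is_epi C f \<longleftrightarrow> f \<in> Arr C \<and>
    (\<forall>g \<in> Arr C. \<forall>h \<in> Arr C. Dom C g = Cod C f \<and> Dom C h = Cod C f \<and> Cod C g = Cod C h \<and>
       g \<cdot>\<^bsub>C\<^esub> f = h \<cdot>\<^bsub>C\<^esub> f \<longrightarrow> g = h)"

lemma is_epiD:
  assumes "is_epi C f" "g \<cdot>\<^bsub>C\<^esub> f = h \<cdot>\<^bsub>C\<^esub> f" "g \<in> hom C (Cod C f) z" "h \<in> hom C (Cod C f) z"
  shows "g = h"
  using assms unfolding is_epi_def by auto

lemma (in category) is_epi_Comp:
  assumes f: "is_epi C f" and g: "is_epi C g" and eq: "Dom C g = Cod C f"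
  shows "is_epi C (g \<cdot> f)"
  unfolding is_epi_def
proof (intro conjI ballI impI)
  have a: "f \<in> Arr C" "g \<in> Arr C" using f g by (auto simp: is_epi_def)
  then show "g \<cdot> f \<in> Arr C" using eq by simp
  fix h k
  assume h: "h \<in> Arr C" "k \<in> Arr C"
    "Dom C h = Cod C (g \<cdot> f) \<and> Dom C k = Cod C (g \<cdot> f) \<and> Cod C h = Cod C k \<and>
      h \<cdot> g \<cdot> f = k \<cdot> g \<cdot> f"
  then have "(h \<cdot> g) \<cdot> f = (k \<cdot> g) \<cdot> f" using a eq by simp
  then have "h \<cdot> g = k \<cdot> g"
    by (rule is_epiD[OF f]) (use h a eq in simp_all)
  then show "h = k"
    by (rule is_epiD[OF g]) (use h a eq in simp_all)
qed

definition is_coproduct ::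
  "('o, 'a) cat \<Rightarrow> 'j set \<Rightarrow> ('j \<Rightarrow> 'o) \<Rightarrow> 'o \<Rightarrow> ('j \<Rightarrow> 'a) \<Rightarrow> bool" where
  "is_coproduct C J H c \<kappa> \<longleftrightarrow> c \<in> Obj C \<and> (\<forall>j \<in> J. \<kappa> j \<in> hom C (H j) c) \<and>
    (\<forall>d \<mu>. d \<in> Obj C \<and> (\<forall>j \<in> J. \<mu> j \<in> hom C (H j) d) \<longrightarrow>
       (\<exists>!h. h \<in> hom C c d \<and> (\<forall>j \<in> J. h \<cdot>\<^bsub>C\<^esub> \<kappa> j = \<mu> j)))"

definition is_coequalizer :: "('o, 'a) cat \<Rightarrow> 'a \<Rightarrow> 'a \<Rightarrow> 'o \<Rightarrow> 'a \<Rightarrow> bool" where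
  "is_coequalizer C u v c q \<longleftrightarrow> c \<in> Obj C \<and> q \<in> hom C (Cod C u) c \<and> q \<cdot>\<^bsub>C\<^esub> u = q \<cdot>\<^bsub>C\<^esub> v \<and>
    (\<forall>d f. d \<in> Obj C \<and> f \<in> hom C (Cod C u) d \<and> f \<cdot>\<^bsub>C\<^esub> u = f \<cdot>\<^bsub>C\<^esub> v \<longrightarrow>
       (\<exists>!h. h \<in> hom C c d \<and> h \<cdot>\<^bsub>C\<^esub> q = f))"

lemma is_coproduct_ex1:
  assumes "is_coproduct C J H c \<kappa>" "d \<in> Obj C" "\<And>j. j \<in> J \<Longrightarrow> \<mu> j \<in> hom C (H j) d"
  shows "\<exists>!h. h \<in> hom C c d \<and> (\<forall>j \<in> J. h \<cdot>\<^bsub>C\<^esub> \<kappa> j = \<mu> j)"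
  using assms unfolding is_coproduct_def by blast

lemma is_coproduct_ex:
  assumes "is_coproduct C J H c \<kappa>" "d \<in> Obj C" "\<And>j. j \<in> J \<Longrightarrow> \<mu> j \<in> hom C (H j) d"
  obtains h where "h \<in> hom C c d" "\<And>j. j \<in> J \<Longrightarrow> h \<cdot>\<^bsub>C\<^esub> \<kappa> j = \<mu> j"
  using is_coproduct_ex1[OF assms] that by blast

lemma (in category) is_coproduct_unique:
  assumes cp: "is_coproduct C J H c \<kappa>" and h: "h \<in> hom C c d" and k: "k \<in> hom C c d"
    and eq: "\<And>j. j \<in> J \<Longrightarrow> h \<cdot> \<kappa> j = k \<cdot> \<kappa> j"
  shows "h = k"
proof -
  have d: "d \<in> Obj C" using h by auto
  have \<kappa>: "\<forall>j \<in> J. \<kappa> j \<in> hom C (H j) c" using cp by (simp add: is_coproduct_def)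
  have ex1: "\<exists>!g. g \<in> hom C c d \<and> (\<forall>j \<in> J. g \<cdot> \<kappa> j = h \<cdot> \<kappa> j)"
    by (rule is_coproduct_ex1[OF cp d]) (use h \<kappa> in simp)
  have "h \<in> hom C c d \<and> (\<forall>j \<in> J. h \<cdot> \<kappa> j = h \<cdot> \<kappa> j)" using h by blast
  moreover have "k \<in> hom C c d \<and> (\<forall>j \<in> J. k \<cdot> \<kappa> j = h \<cdot> \<kappa> j)" using k eq by simp
  ultimately show ?thesis using ex1 by blast
qed

lemma is_coequalizer_ex:
  assumes "is_coequalizer C u v c q" "d \<in> Obj C" "f \<in> hom C (Cod C u) d" "f \<cdot>\<^bsub>C\<^esub> u = f \<cdot>\<^bsub>C\<^esub> v"
  obtains h where "h \<in> hom C c d" "h \<cdot>\<^bsub>C\<^esub> q = f"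
proof -
  have "\<exists>!h. h \<in> hom C c d \<and> h \<cdot>\<^bsub>C\<^esub> q = f"
    using assms unfolding is_coequalizer_def by blast
  then show ?thesis using that by blast
qed

lemma (in category) is_coequalizer_epi:
  assumes ce: "is_coequalizer C u v c q" and u: "u \<in> Arr C" "v \<in> hom C (Dom C u) (Cod C u)"
  shows "is_epi C q"
  unfolding is_epi_def
proof (intro conjI ballI impI)
  have q: "q \<in> hom C (Cod C u) c" "q \<cdot> u = q \<cdot> v" using ce by (auto simp: is_coequalizer_def)
  then show "q \<in> Arr C" by simp
  fix g h
  assume g: "g \<in> Arr C" "h \<in> Arr C"
    "Dom C g = Cod C q \<and> Dom C h = Cod C q \<and> Cod C g = Cod C h \<and> g \<cdot> q = h \<cdot> q"
  have "(g \<cdot> q) \<cdot> u = (g \<cdot> q) \<cdot> v" using q g u by simp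
  moreover have "g \<cdot> q \<in> hom C (Cod C u) (Cod C g)" "Cod C g \<in> Obj C" using q g by auto
  ultimately have "\<exists>!k. k \<in> hom C c (Cod C g) \<and> k \<cdot> q = g \<cdot> q"
    using ce unfolding is_coequalizer_def by blast
  moreover have "g \<in> hom C c (Cod C g) \<and> g \<cdot> q = g \<cdot> q"
    "h \<in> hom C c (Cod C g) \<and> h \<cdot> q = g \<cdot> q" using g q by simp_all
  ultimately show "g = h" by blast
qed

lemma is_colimit_ex1:
  assumes "is_colimit I C F c \<kappa>" "is_cocone I C F d \<mu>"
  shows "\<exists>!h. h \<in> hom C c d \<and> (\<forall>i \<in> Obj I. h \<cdot>\<^bsub>C\<^esub> \<kappa> i = \<mu> i)"
  using assms unfolding is_colimit_def by blast

text \<open>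
  Discrete categories whose objects are the image of an injection \<open>e : J \<rightarrow> 'i\<close> turn coproducts
  over an index set of any type into colimits of small shape. The comparisons of
  colimits with coproducts and coequalizers are equivalences, because they are used in both
  directions when a functor preserves colimits.
\<close>

definition disc_cat :: "'i set \<Rightarrow> 'i small_cat" where
  "disc_cat S = \<lparr>Obj = S, Arr = S, Dom = id, Cod = id, Ident = id, Comp = (\<lambda>g f. f)\<rparr>"

lemma category_disc_cat: "category (disc_cat S)"
  by unfold_locales (auto simp: disc_cat_def)

definition disc_ftor ::
  "('j \<Rightarrow> 'i) \<Rightarrow> 'j set \<Rightarrow> ('o, 'a) cat \<Rightarrow> ('j \<Rightarrow> 'o) \<Rightarrow> ('i, 'i, 'o, 'a) ftor" where
  "disc_ftor e J C H = \<lparr>fobj = (\<lambda>i. H (inv_into J e i)), farr = (\<lambda>i. Ident C (H (inv_into J e i)))\<rparr>"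

lemma (in category) is_functor_disc_ftor:
  assumes "\<And>j. j \<in> J \<Longrightarrow> H j \<in> Obj C"
  shows "is_functor (disc_cat (e ` J)) C (disc_ftor e J C H)"
proof (rule is_functor.intro)
  show "category C" by unfold_locales
  show "category (disc_cat (e ` J))" by (rule category_disc_cat)
qed (use assms in \<open>auto simp: disc_cat_def disc_ftor_def inv_into_into\<close>)

lemma (in category) is_colimit_disc_iff:
  assumes e: "inj_on e J"
    and F: "\<And>j. j \<in> J \<Longrightarrow> fobj F (e j) = H j" "\<And>j. j \<in> J \<Longrightarrow> farr F (e j) = \<one> (H j)"
    and \<kappa>: "\<And>j. j \<in> J \<Longrightarrow> \<kappa> (e j) = \<kappa>' j"
  shows "is_colimit (disc_cat (e ` J)) C F c \<kappa> \<longleftrightarrow> is_coproduct C J H c \<kappa>'"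
proof -
  have cocone: "is_cocone (disc_cat (e ` J)) C F d \<mu> \<longleftrightarrow>
      d \<in> Obj C \<and> (\<forall>j \<in> J. \<mu> (e j) \<in> hom C (H j) d)" for d \<mu>
    by (auto simp: is_cocone_def disc_cat_def F)
  show ?thesis
  proof
    assume cl: "is_colimit (disc_cat (e ` J)) C F c \<kappa>"
    show "is_coproduct C J H c \<kappa>'"
      unfolding is_coproduct_def
    proof (intro conjI allI impI)
      show "c \<in> Obj C" "\<forall>j \<in> J. \<kappa>' j \<in> hom C (H j) c"
        using cl \<kappa> by (auto simp: is_colimit_def cocone)
      fix d \<mu> assume "d \<in> Obj C \<and> (\<forall>j \<in> J. \<mu> j \<in> hom C (H j) d)"
      then have "is_cocone (disc_cat (e ` J)) C F d (\<lambda>i. \<mu> (inv_into J e i))"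
        using e by (simp add: cocone)
      from is_colimit_ex1[OF cl this]
      show "\<exists>!h. h \<in> hom C c d \<and> (\<forall>j \<in> J. h \<cdot> \<kappa>' j = \<mu> j)"
        using e \<kappa> by (simp add: disc_cat_def)
    qed
  next
    assume cp: "is_coproduct C J H c \<kappa>'"
    show "is_colimit (disc_cat (e ` J)) C F c \<kappa>"
      unfolding is_colimit_def
    proof (intro conjI allI impI)
      show "is_cocone (disc_cat (e ` J)) C F c \<kappa>"
        using cp \<kappa> by (auto simp: is_coproduct_def cocone)
      fix d \<mu> assume "is_cocone (disc_cat (e ` J)) C F d \<mu>"
      then have "d \<in> Obj C" "\<And>j. j \<in> J \<Longrightarrow> \<mu> (e j) \<in> hom C (H j) d"
        unfolding cocone by blast+
      then have "\<exists>!h. h \<in> hom C c d \<and> (\<forall>j \<in> J. h \<cdot> \<kappa>' j = \<mu> (e j))"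
        by (rule is_coproduct_ex1[OF cp])
      then show "\<exists>!h. h \<in> hom C c d \<and> (\<forall>i \<in> Obj (disc_cat (e ` J)). h \<cdot> \<kappa> i = \<mu> i)"
        using \<kappa> by (simp add: disc_cat_def)
    qed
  qed
qed

text \<open>
  The category with objects \<open>a\<close>, \<open>b\<close> and two parallel arrows \<open>c, d : a \<rightarrow> b\<close>; the objects serve as
  their own identities.
\<close>

definition pair_cat :: "'i \<Rightarrow> 'i \<Rightarrow> 'i \<Rightarrow> 'i \<Rightarrow> 'i small_cat" where
  "pair_cat a b c d = \<lparr>Obj = {a, b}, Arr = {a, b, c, d},
     Dom = (\<lambda>j. if j = b then b else a), Cod = (\<lambda>j. if j = a then a else b), Ident = id,
     Comp = (\<lambda>g f. if f = a \<or> f = b then g else f)\<rparr>"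

lemma category_pair_cat: "distinct [a, b, c, d] \<Longrightarrow> category (pair_cat a b c d)"
  by unfold_locales (auto simp: pair_cat_def split: if_splits)

definition pair_ftor_of :: "'i \<Rightarrow> 'i \<Rightarrow> 'i \<Rightarrow> ('o, 'a) cat \<Rightarrow> 'a \<Rightarrow> 'a \<Rightarrow> ('i, 'i, 'o, 'a) ftor" where
  "pair_ftor_of a b c C u v = \<lparr>fobj = (\<lambda>i. if i = a then Dom C u else Cod C u),
     farr = (\<lambda>j. if j = a then Ident C (Dom C u) else if j = b then Ident C (Cod C u)
                 else if j = c then u else v)\<rparr>"

lemma (in category) is_functor_pair_ftor_of:
  assumes "distinct [a, b, c, d]" "u \<in> Arr C" "v \<in> hom C (Dom C u) (Cod C u)"
  shows "is_functor (pair_cat a b c d) C (pair_ftor_of a b c C u v)"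
proof (rule is_functor.intro)
  show "category C" by unfold_locales
  show "category (pair_cat a b c d)" using assms by (intro category_pair_cat)
qed (use assms in \<open>auto simp: pair_cat_def pair_ftor_of_def split: if_splits\<close>)

lemma (in category) is_colimit_pair_iff:
  assumes abcd: "distinct [a, b, c, d]" and u: "u \<in> Arr C" "v \<in> hom C (Dom C u) (Cod C u)"
    and F: "fobj F a = Dom C u" "fobj F b = Cod C u" "farr F a = \<one> (Dom C u)"
      "farr F b = \<one> (Cod C u)" "farr F c = u" "farr F d = v"
    and \<kappa>: "\<kappa> b = q" "\<kappa> a = q \<cdot> u"
  shows "is_colimit (pair_cat a b c d) C F x \<kappa> \<longleftrightarrow> is_coequalizer C u v x q"
proof -
  have cocone: "is_cocone (pair_cat a b c d) C F y \<mu> \<longleftrightarrow> y \<in> Obj C \<and>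
      \<mu> b \<in> hom C (Cod C u) y \<and> \<mu> b \<cdot> u = \<mu> b \<cdot> v \<and> \<mu> a = \<mu> b \<cdot> u" for y \<mu>
    using abcd u by (auto simp: is_cocone_def pair_cat_def F)
  show ?thesis
  proof
    assume cl: "is_colimit (pair_cat a b c d) C F x \<kappa>"
    show "is_coequalizer C u v x q"
      unfolding is_coequalizer_def
    proof (intro conjI allI impI)
      show q: "x \<in> Obj C" "q \<in> hom C (Cod C u) x" "q \<cdot> u = q \<cdot> v"
        using cl \<kappa> by (auto simp: is_colimit_def cocone)
      fix y f assume f: "y \<in> Obj C \<and> f \<in> hom C (Cod C u) y \<and> f \<cdot> u = f \<cdot> v"
      then have "is_cocone (pair_cat a b c d) C F y (\<lambda>i. if i = b then f else f \<cdot> u)"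
        using abcd by (simp add: cocone)
      from is_colimit_ex1[OF cl this]
      have "\<exists>!h. h \<in> hom C x y \<and> (\<forall>i \<in> {a, b}. h \<cdot> \<kappa> i = (if i = b then f else f \<cdot> u))"
        unfolding pair_cat_def by (simp only: cat.simps)
      moreover have key: "h \<cdot> \<kappa> a = (h \<cdot> q) \<cdot> u" if "h \<in> hom C x y" for h
        using that u q \<kappa>(2) by simp
      have "h \<in> hom C x y \<and> (\<forall>i \<in> {a, b}. h \<cdot> \<kappa> i = (if i = b then f else f \<cdot> u))
          \<longleftrightarrow> h \<in> hom C x y \<and> h \<cdot> q = f" for h
        using abcd by (auto simp: \<kappa>(1) key simp del: Comp_assoc)
      ultimately show "\<exists>!h. h \<in> hom C x y \<and> h \<cdot> q = f" by (simp only:)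
    qed
  next
    assume ce: "is_coequalizer C u v x q"
    then have q: "x \<in> Obj C" "q \<in> hom C (Cod C u) x" "q \<cdot> u = q \<cdot> v"
      by (auto simp: is_coequalizer_def)
    show "is_colimit (pair_cat a b c d) C F x \<kappa>"
      unfolding is_colimit_def
    proof (intro conjI allI impI)
      show "is_cocone (pair_cat a b c d) C F x \<kappa>"
        using q \<kappa> by (auto simp: cocone)
      fix y \<mu> assume "is_cocone (pair_cat a b c d) C F y \<mu>"
      then have \<mu>: "y \<in> Obj C \<and> \<mu> b \<in> hom C (Cod C u) y \<and> \<mu> b \<cdot> u = \<mu> b \<cdot> v" "\<mu> a = \<mu> b \<cdot> u"
        unfolding cocone by blast+
      then have "\<exists>!h. h \<in> hom C x y \<and> h \<cdot> q = \<mu> b"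
        using ce unfolding is_coequalizer_def by blast
      moreover have key: "h \<cdot> \<kappa> a = (h \<cdot> q) \<cdot> u" if "h \<in> hom C x y" for h
        using that u q \<kappa>(2) by simp
      have "h \<in> hom C x y \<and> (\<forall>i \<in> {a, b}. h \<cdot> \<kappa> i = \<mu> i)
          \<longleftrightarrow> h \<in> hom C x y \<and> h \<cdot> q = \<mu> b" for h
        using abcd by (auto simp: \<kappa>(1) key \<mu>(2) simp del: Comp_assoc)
      ultimately show "\<exists>!h. h \<in> hom C x y \<and> (\<forall>i \<in> Obj (pair_cat a b c d). h \<cdot> \<kappa> i = \<mu> i)"
        unfolding pair_cat_def by (simp only: cat.simps)
    qed
  qed
qed

section \<open>Small coproducts and coequalizers, and their preservation\<close>

lemma ex1_unique: "\<exists>!x. P x \<Longrightarrow> P a \<Longrightarrow> P b \<Longrightarrow> a = b"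
  by blast

lemma is_functorD:
  assumes "is_functor A B F"
  shows "category A" "category B"
    "x \<in> Obj A \<Longrightarrow> fobj F x \<in> Obj B"
    "f \<in> Arr A \<Longrightarrow> farr F f \<in> Arr B"
    "f \<in> Arr A \<Longrightarrow> Dom B (farr F f) = fobj F (Dom A f)"
    "f \<in> Arr A \<Longrightarrow> Cod B (farr F f) = fobj F (Cod A f)"
    "x \<in> Obj A \<Longrightarrow> farr F (Ident A x) = Ident B (fobj F x)"
    "\<lbrakk>f \<in> Arr A; g \<in> Arr A; Dom A g = Cod A f\<rbrakk> \<Longrightarrow> farr F (g \<cdot>\<^bsub>A\<^esub> f) = farr F g \<cdot>\<^bsub>B\<^esub> farr F f"
  using assms by (simp_all add: is_functor_def)

lemma four_distinct:
  assumes "infinite (UNIV :: 'i set)"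
  obtains a b c d :: 'i where "distinct [a, b, c, d]"
proof -
  obtain f :: "nat \<Rightarrow> 'i" where "inj f" using infinite_countable_subset[OF assms] by blast
  then have "distinct [f 0, f 1, f 2, f 3]" by (simp add: inj_eq)
  then show ?thesis by (rule that)
qed

lemma coproduct_if_colimits:
  fixes e :: "'j \<Rightarrow> 'i"
  assumes C: "category C" and colim: "\<And>I :: 'i small_cat. category I \<Longrightarrow> has_colimits I C"
    and e: "inj_on e J" and H: "\<And>j. j \<in> J \<Longrightarrow> H j \<in> Obj C"
  shows "\<exists>c \<kappa>. is_coproduct C J H c \<kappa>"
proof -
  interpret category C by (rule C)
  have "is_functor (disc_cat (e ` J)) C (disc_ftor e J C H)" by (rule is_functor_disc_ftor[OF H])
  then obtain c \<kappa> where cl: "is_colimit (disc_cat (e ` J)) C (disc_ftor e J C H) c \<kappa>"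
    using colim[OF category_disc_cat[of "e ` J"]] unfolding has_colimits_def by blast
  have "is_coproduct C J H c (\<lambda>j. \<kappa> (e j))"
    by (rule iffD1[OF is_colimit_disc_iff[OF e] cl]) (use e in \<open>simp_all add: disc_ftor_def\<close>)
  then show ?thesis by blast
qed

lemma preserves_coproduct:
  fixes e :: "'j \<Rightarrow> 'i"
  assumes G: "is_functor C C' G" and pres: "\<And>I :: 'i small_cat. category I \<Longrightarrow> preserves_colimits I C C' G"
    and e: "inj_on e J" and cp: "is_coproduct C J H c \<kappa>"
  shows "is_coproduct C' J (\<lambda>j. fobj G (H j)) (fobj G c) (\<lambda>j. farr G (\<kappa> j))"
proof -
  interpret C: category C by (rule is_functorD(1)[OF G])
  interpret C': category C' by (rule is_functorD(2)[OF G])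
  let ?F = "disc_ftor e J C H" and ?k = "\<lambda>i. \<kappa> (inv_into J e i)"
  have H: "H j \<in> Obj C" if "j \<in> J" for j using cp that C.Dom_in[of "\<kappa> j"] by (auto simp: is_coproduct_def)
  have F: "is_functor (disc_cat (e ` J)) C ?F" by (rule C.is_functor_disc_ftor[OF H])
  have "is_colimit (disc_cat (e ` J)) C ?F c ?k"
    by (rule iffD2[OF C.is_colimit_disc_iff[OF e] cp]) (use e in \<open>simp_all add: disc_ftor_def\<close>)
  then have "is_colimit (disc_cat (e ` J)) C' (ftor_comp G ?F) (fobj G c) (farr G \<circ> ?k)"
    using pres[OF category_disc_cat[of "e ` J"]] F unfolding preserves_colimits_def by blast
  then show ?thesis
    by (rule iffD1[OF C'.is_colimit_disc_iff[OF e], rotated 3])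
      (use e H in \<open>simp_all add: disc_ftor_def ftor_comp_def is_functorD(7)[OF G]\<close>)
qed

lemma coequalizer_if_colimits:
  assumes inf: "infinite (UNIV :: 'i set)"
    and C: "category C" and colim: "\<And>I :: 'i small_cat. category I \<Longrightarrow> has_colimits I C"
    and u: "u \<in> Arr C" "v \<in> hom C (Dom C u) (Cod C u)"
  shows "\<exists>c q. is_coequalizer C u v c q"
proof -
  interpret category C by (rule C)
  obtain a b c d :: 'i where abcd: "distinct [a, b, c, d]" by (rule four_distinct[OF inf])
  let ?F = "pair_ftor_of a b c C u v"
  have "is_functor (pair_cat a b c d) C ?F" by (rule is_functor_pair_ftor_of[OF abcd u])
  then obtain x \<kappa> where cl: "is_colimit (pair_cat a b c d) C ?F x \<kappa>"
    using colim[OF category_pair_cat[OF abcd]] unfolding has_colimits_def by blast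
  then have "\<kappa> a = \<kappa> b \<cdot>\<^bsub>C\<^esub> u"
    using abcd by (auto simp: is_colimit_def is_cocone_def pair_cat_def pair_ftor_of_def)
  then have "is_coequalizer C u v x (\<kappa> b)"
    by (intro iffD1[OF is_colimit_pair_iff[OF abcd u] cl]) (use abcd in \<open>auto simp: pair_ftor_of_def\<close>)
  then show ?thesis by blast
qed

lemma preserves_coequalizer:
  assumes inf: "infinite (UNIV :: 'i set)"
    and G: "is_functor C C' G" and pres: "\<And>I :: 'i small_cat. category I \<Longrightarrow> preserves_colimits I C C' G"
    and ce: "is_coequalizer C u v x q" and u: "u \<in> Arr C" "v \<in> hom C (Dom C u) (Cod C u)"
  shows "is_coequalizer C' (farr G u) (farr G v) (fobj G x) (farr G q)"
proof -
  interpret C: category C by (rule is_functorD(1)[OF G])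
  interpret C': category C' by (rule is_functorD(2)[OF G])
  obtain a b c d :: 'i where abcd: "distinct [a, b, c, d]" by (rule four_distinct[OF inf])
  let ?F = "pair_ftor_of a b c C u v" and ?k = "\<lambda>i. if i = b then q else q \<cdot>\<^bsub>C\<^esub> u"
  have q: "q \<in> hom C (Cod C u) x" using ce by (simp add: is_coequalizer_def)
  have F: "is_functor (pair_cat a b c d) C ?F" by (rule C.is_functor_pair_ftor_of[OF abcd u])
  have "is_colimit (pair_cat a b c d) C ?F x ?k"
    by (rule iffD2[OF C.is_colimit_pair_iff[OF abcd u] ce]) (use abcd in \<open>auto simp: pair_ftor_of_def\<close>)
  then have cl: "is_colimit (pair_cat a b c d) C' (ftor_comp G ?F) (fobj G x) (farr G \<circ> ?k)"
    using pres[OF category_pair_cat[OF abcd]] F unfolding preserves_colimits_def by blast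
  show ?thesis
    by (rule iffD1[OF C'.is_colimit_pair_iff[OF abcd] cl])
      (use abcd u q in \<open>auto simp: pair_ftor_of_def ftor_comp_def is_functorD(4-8)[OF G]\<close>)
qed

section \<open>Monoids in a monoidal category with stable colimits\<close>

text \<open>
  The inverses of the structure isomorphisms are explicit parameters, which gives them
  names in calculations. The last three axioms are Kelly's consequences of pentagon and triangle;
  for a double category they are derived below for arbitrary horizontal 1-cells, where the
  construction of pushforwards also calls for them.
\<close>

locale monoidal = category C for C :: "('o, 'a) cat" (structure) +
  fixes ten :: "'o \<Rightarrow> 'o \<Rightarrow> 'o" (infixr "\<otimes>" 70)
    and tenA :: "'a \<Rightarrow> 'a \<Rightarrow> 'a" (infixr "\<boxtimes>" 70)
    and E :: 'o
    and as as' :: "'o \<Rightarrow> 'o \<Rightarrow> 'o \<Rightarrow> 'a"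
    and l l' r r' :: "'o \<Rightarrow> 'a"
  assumes ten_Obj [simp]: "\<lbrakk>M \<in> Obj C; N \<in> Obj C\<rbrakk> \<Longrightarrow> M \<otimes> N \<in> Obj C"
    and E_Obj [simp]: "E \<in> Obj C"
    and ten_hom: "\<lbrakk>f \<in> Arr C; g \<in> Arr C\<rbrakk>
      \<Longrightarrow> f \<boxtimes> g \<in> hom C (Dom C f \<otimes> Dom C g) (Cod C f \<otimes> Cod C g)"
    and ten_one: "\<lbrakk>M \<in> Obj C; N \<in> Obj C\<rbrakk> \<Longrightarrow> \<one> M \<boxtimes> \<one> N = \<one> (M \<otimes> N)"
    and ten_Comp [simp]: "\<lbrakk>f \<in> Arr C; g \<in> Arr C; f' \<in> Arr C; g' \<in> Arr C;
        Dom C f' = Cod C f; Dom C g' = Cod C g\<rbrakk>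
      \<Longrightarrow> (f' \<boxtimes> g') \<cdot> (f \<boxtimes> g) = (f' \<cdot> f) \<boxtimes> (g' \<cdot> g)"
    and as_hom: "\<lbrakk>M \<in> Obj C; N \<in> Obj C; P \<in> Obj C\<rbrakk>
      \<Longrightarrow> as M N P \<in> hom C ((M \<otimes> N) \<otimes> P) (M \<otimes> (N \<otimes> P))"
    and as'_hom: "\<lbrakk>M \<in> Obj C; N \<in> Obj C; P \<in> Obj C\<rbrakk>
      \<Longrightarrow> as' M N P \<in> hom C (M \<otimes> (N \<otimes> P)) ((M \<otimes> N) \<otimes> P)"
    and as_as': "\<lbrakk>M \<in> Obj C; N \<in> Obj C; P \<in> Obj C\<rbrakk>
      \<Longrightarrow> as M N P \<cdot> as' M N P = \<one> (M \<otimes> (N \<otimes> P))"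
    and as'_as: "\<lbrakk>M \<in> Obj C; N \<in> Obj C; P \<in> Obj C\<rbrakk>
      \<Longrightarrow> as' M N P \<cdot> as M N P = \<one> ((M \<otimes> N) \<otimes> P)"
    and l_hom: "M \<in> Obj C \<Longrightarrow> l M \<in> hom C (E \<otimes> M) M"
    and l'_hom: "M \<in> Obj C \<Longrightarrow> l' M \<in> hom C M (E \<otimes> M)"
    and l_l': "M \<in> Obj C \<Longrightarrow> l M \<cdot> l' M = \<one> M"
    and l'_l: "M \<in> Obj C \<Longrightarrow> l' M \<cdot> l M = \<one> (E \<otimes> M)"
    and r_hom: "M \<in> Obj C \<Longrightarrow> r M \<in> hom C (M \<otimes> E) M"
    and r'_hom: "M \<in> Obj C \<Longrightarrow> r' M \<in> hom C M (M \<otimes> E)"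
    and r_r': "M \<in> Obj C \<Longrightarrow> r M \<cdot> r' M = \<one> M"
    and r'_r: "M \<in> Obj C \<Longrightarrow> r' M \<cdot> r M = \<one> (M \<otimes> E)"
    and as_natural: "\<lbrakk>f \<in> Arr C; g \<in> Arr C; h \<in> Arr C; Cod C f = M; Cod C g = N; Cod C h = P\<rbrakk>
      \<Longrightarrow> as M N P \<cdot> ((f \<boxtimes> g) \<boxtimes> h) = (f \<boxtimes> (g \<boxtimes> h)) \<cdot> as (Dom C f) (Dom C g) (Dom C h)"
    and l_natural: "\<lbrakk>f \<in> Arr C; Cod C f = M\<rbrakk> \<Longrightarrow> l M \<cdot> (\<one> E \<boxtimes> f) = f \<cdot> l (Dom C f)"
    and r_natural: "\<lbrakk>f \<in> Arr C; Cod C f = M\<rbrakk> \<Longrightarrow> r M \<cdot> (f \<boxtimes> \<one> E) = f \<cdot> r (Dom C f)"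
    and pentagon: "\<lbrakk>M \<in> Obj C; N \<in> Obj C; P \<in> Obj C; Q \<in> Obj C\<rbrakk>
      \<Longrightarrow> as M N (P \<otimes> Q) \<cdot> as (M \<otimes> N) P Q
          = (\<one> M \<boxtimes> as N P Q) \<cdot> as M (N \<otimes> P) Q \<cdot> (as M N P \<boxtimes> \<one> Q)"
    and triangle: "\<lbrakk>M \<in> Obj C; N \<in> Obj C\<rbrakk>
      \<Longrightarrow> (\<one> M \<boxtimes> l N) \<cdot> as M E N = r M \<boxtimes> \<one> N"
    and l_ten: "\<lbrakk>M \<in> Obj C; N \<in> Obj C\<rbrakk> \<Longrightarrow> l (M \<otimes> N) \<cdot> as E M N = l M \<boxtimes> \<one> N"
    and r_ten: "\<lbrakk>M \<in> Obj C; N \<in> Obj C\<rbrakk> \<Longrightarrow> (\<one> M \<boxtimes> r N) \<cdot> as M N E = r (M \<otimes> N)"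
    and l_E_eq_r_E: "l E = r E"
begin

lemma typing [simp]:
  "\<lbrakk>f \<in> Arr C; g \<in> Arr C\<rbrakk> \<Longrightarrow> f \<boxtimes> g \<in> Arr C"
  "\<lbrakk>f \<in> Arr C; g \<in> Arr C\<rbrakk> \<Longrightarrow> Dom C (f \<boxtimes> g) = Dom C f \<otimes> Dom C g"
  "\<lbrakk>f \<in> Arr C; g \<in> Arr C\<rbrakk> \<Longrightarrow> Cod C (f \<boxtimes> g) = Cod C f \<otimes> Cod C g"
  "\<lbrakk>M \<in> Obj C; N \<in> Obj C; P \<in> Obj C\<rbrakk> \<Longrightarrow> as M N P \<in> Arr C"
  "\<lbrakk>M \<in> Obj C; N \<in> Obj C; P \<in> Obj C\<rbrakk> \<Longrightarrow> Dom C (as M N P) = (M \<otimes> N) \<otimes> P"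
  "\<lbrakk>M \<in> Obj C; N \<in> Obj C; P \<in> Obj C\<rbrakk> \<Longrightarrow> Cod C (as M N P) = M \<otimes> (N \<otimes> P)"
  "\<lbrakk>M \<in> Obj C; N \<in> Obj C; P \<in> Obj C\<rbrakk> \<Longrightarrow> as' M N P \<in> Arr C"
  "\<lbrakk>M \<in> Obj C; N \<in> Obj C; P \<in> Obj C\<rbrakk> \<Longrightarrow> Dom C (as' M N P) = M \<otimes> (N \<otimes> P)"
  "\<lbrakk>M \<in> Obj C; N \<in> Obj C; P \<in> Obj C\<rbrakk> \<Longrightarrow> Cod C (as' M N P) = (M \<otimes> N) \<otimes> P"
  "M \<in> Obj C \<Longrightarrow> l M \<in> Arr C" "M \<in> Obj C \<Longrightarrow> Dom C (l M) = E \<otimes> M" "M \<in> Obj C \<Longrightarrow> Cod C (l M) = M"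
  "M \<in> Obj C \<Longrightarrow> r M \<in> Arr C" "M \<in> Obj C \<Longrightarrow> Dom C (r M) = M \<otimes> E" "M \<in> Obj C \<Longrightarrow> Cod C (r M) = M"
  "M \<in> Obj C \<Longrightarrow> l' M \<in> Arr C" "M \<in> Obj C \<Longrightarrow> Cod C (l' M) = E \<otimes> M" "M \<in> Obj C \<Longrightarrow> Dom C (l' M) = M"
  "M \<in> Obj C \<Longrightarrow> r' M \<in> Arr C" "M \<in> Obj C \<Longrightarrow> Cod C (r' M) = M \<otimes> E" "M \<in> Obj C \<Longrightarrow> Dom C (r' M) = M"
  using ten_hom as_hom as'_hom l_hom r_hom l'_hom r'_hom by simp_all

lemma ten_Comp_chain [simp]:
  assumes "f \<in> Arr C" "g \<in> Arr C" "f' \<in> Arr C" "g' \<in> Arr C" "Dom C f' = Cod C f" "Dom C g' = Cod C g"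
    "k \<in> Arr C" "Cod C k = Dom C f \<otimes> Dom C g"
  shows "(f' \<boxtimes> g') \<cdot> (f \<boxtimes> g) \<cdot> k = ((f' \<cdot> f) \<boxtimes> (g' \<cdot> g)) \<cdot> k"
  by (rule Comp_left_cancel_chain[OF ten_Comp]) (use assms in simp_all)

lemma as'_natural:
  assumes [simp]: "f \<in> Arr C" "g \<in> Arr C" "h \<in> Arr C" and "Cod C f = M" "Cod C g = N" "Cod C h = P"
  shows "as' M N P \<cdot> (f \<boxtimes> (g \<boxtimes> h)) = ((f \<boxtimes> g) \<boxtimes> h) \<cdot> as' (Dom C f) (Dom C g) (Dom C h)"
proof -
  note [simp] = assms(4-6)[symmetric]
  let ?a = "as' (Dom C f) (Dom C g) (Dom C h)"
  have "as' M N P \<cdot> (f \<boxtimes> (g \<boxtimes> h))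
      = as' M N P \<cdot> (f \<boxtimes> (g \<boxtimes> h)) \<cdot> (as (Dom C f) (Dom C g) (Dom C h) \<cdot> ?a)"
    by (simp add: as_as')
  also have "\<dots> = as' M N P \<cdot> (as M N P \<cdot> ((f \<boxtimes> g) \<boxtimes> h)) \<cdot> ?a"
    by (simp add: as_natural)
  also have "\<dots> = (as' M N P \<cdot> as M N P) \<cdot> ((f \<boxtimes> g) \<boxtimes> h) \<cdot> ?a"
    by simp
  also have "\<dots> = ((f \<boxtimes> g) \<boxtimes> h) \<cdot> ?a"
    by (simp add: as'_as)
  finally show ?thesis .
qed

definition is_monoid :: "'o \<Rightarrow> 'a \<Rightarrow> 'a \<Rightarrow> bool" where
  "is_monoid A m n \<longleftrightarrow> A \<in> Obj C \<and> m \<in> hom C (A \<otimes> A) A \<and> n \<in> hom C E A \<and>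
    m \<cdot> (m \<boxtimes> \<one> A) = m \<cdot> (\<one> A \<boxtimes> m) \<cdot> as A A A \<and>
    m \<cdot> (n \<boxtimes> \<one> A) = l A \<and> m \<cdot> (\<one> A \<boxtimes> n) = r A"

definition is_monoid_mor :: "'o \<Rightarrow> 'a \<Rightarrow> 'a \<Rightarrow> 'o \<Rightarrow> 'a \<Rightarrow> 'a \<Rightarrow> 'a \<Rightarrow> bool" where
  "is_monoid_mor A m n B m' n' h \<longleftrightarrow> h \<in> hom C A B \<and> m' \<cdot> (h \<boxtimes> h) = h \<cdot> m \<and> h \<cdot> n = n'"

text \<open>
  For every \<open>N\<close>, the object \<open>T \<otimes> N\<close> is the free object on \<open>N\<close> among the objects \<open>P\<close> carrying an action
  \<open>G \<otimes> P \<rightarrow> P\<close>. Keeping \<open>N\<close> arbitrary yields more than initiality of \<open>T\<close>: arrows out of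
  \<open>T \<otimes> T\<close> and \<open>T \<otimes> (T \<otimes> T)\<close> are determined by their behaviour on the leftmost factor, so that
  each monoid law for \<open>T\<close> becomes a comparison of two algebra morphisms. The equations are
  written with \<open>l\<close> and \<open>as\<close> on the right, which avoids their inverses.
\<close>

definition is_free_algebra :: "'o \<Rightarrow> 'o \<Rightarrow> 'a \<Rightarrow> 'a \<Rightarrow> bool" where
  "is_free_algebra G T e a \<longleftrightarrow> T \<in> Obj C \<and> e \<in> hom C E T \<and> a \<in> hom C (G \<otimes> T) T \<and>
    (\<forall>N P f g. N \<in> Obj C \<and> f \<in> hom C N P \<and> g \<in> hom C (G \<otimes> P) P \<longrightarrow>
      (\<exists>!h. h \<in> hom C (T \<otimes> N) P \<and> h \<cdot> (e \<boxtimes> \<one> N) = f \<cdot> l N \<and>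
        h \<cdot> (a \<boxtimes> \<one> N) = g \<cdot> (\<one> G \<boxtimes> h) \<cdot> as G T N))"

lemma is_monoidD:
  assumes "is_monoid A m n"
  shows "A \<in> Obj C" "m \<in> Arr C" "Dom C m = A \<otimes> A" "Cod C m = A"
    "n \<in> Arr C" "Dom C n = E" "Cod C n = A"
    "m \<cdot> (m \<boxtimes> \<one> A) = m \<cdot> (\<one> A \<boxtimes> m) \<cdot> as A A A"
    "m \<cdot> (n \<boxtimes> \<one> A) = l A" "m \<cdot> (\<one> A \<boxtimes> n) = r A"
  using assms unfolding is_monoid_def by simp_all

lemma is_free_algebraD:
  assumes "is_free_algebra G T e a"
  shows "T \<in> Obj C" "e \<in> Arr C" "Dom C e = E" "Cod C e = T"
    "a \<in> Arr C" "Dom C a = G \<otimes> T" "Cod C a = T"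
  using assms unfolding is_free_algebra_def by simp_all

lemma is_free_algebra_ex:
  assumes "is_free_algebra G T e a" "N \<in> Obj C" "f \<in> hom C N P" "g \<in> hom C (G \<otimes> P) P"
  obtains h where "h \<in> hom C (T \<otimes> N) P" "h \<cdot> (e \<boxtimes> \<one> N) = f \<cdot> l N"
    "h \<cdot> (a \<boxtimes> \<one> N) = g \<cdot> (\<one> G \<boxtimes> h) \<cdot> as G T N"
proof -
  have "\<exists>!h. h \<in> hom C (T \<otimes> N) P \<and> h \<cdot> (e \<boxtimes> \<one> N) = f \<cdot> l N \<and>
        h \<cdot> (a \<boxtimes> \<one> N) = g \<cdot> (\<one> G \<boxtimes> h) \<cdot> as G T N"
    using assms unfolding is_free_algebra_def by blast
  then show ?thesis using that by blast
qed

lemma is_free_algebra_unique: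
  assumes "is_free_algebra G T e a" "N \<in> Obj C" "f \<in> hom C N P" "g \<in> hom C (G \<otimes> P) P"
    "h \<in> hom C (T \<otimes> N) P" "h \<cdot> (e \<boxtimes> \<one> N) = f \<cdot> l N"
    "h \<cdot> (a \<boxtimes> \<one> N) = g \<cdot> (\<one> G \<boxtimes> h) \<cdot> as G T N"
    "k \<in> hom C (T \<otimes> N) P" "k \<cdot> (e \<boxtimes> \<one> N) = f \<cdot> l N"
    "k \<cdot> (a \<boxtimes> \<one> N) = g \<cdot> (\<one> G \<boxtimes> k) \<cdot> as G T N"
  shows "h = k"
proof -
  have "\<exists>!h. h \<in> hom C (T \<otimes> N) P \<and> h \<cdot> (e \<boxtimes> \<one> N) = f \<cdot> l N \<and>
        h \<cdot> (a \<boxtimes> \<one> N) = g \<cdot> (\<one> G \<boxtimes> h) \<cdot> as G T N"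
    using assms(1-4) unfolding is_free_algebra_def by blast
  then show ?thesis using assms(5-) by blast
qed

text \<open>
  The multiplication is the algebra morphism \<open>T \<otimes> T \<rightarrow> T\<close> extending the identity of \<open>T\<close>. Left
  unitality is half of its definition; for right unitality and associativity both sides are algebra
  morphisms, out of \<open>T \<otimes> E\<close> and \<open>T \<otimes> (T \<otimes> T)\<close>, which agree on \<open>E\<close> and \<open>T \<otimes> T\<close>, where these are free.
\<close>

lemma free_algebra_monoid:
  assumes G [simp]: "G \<in> Obj C" and T: "is_free_algebra G T e a"
  obtains m where "is_monoid T m e" "m \<cdot> (a \<boxtimes> \<one> T) = a \<cdot> (\<one> G \<boxtimes> m) \<cdot> as G T T"
proof -
  note [simp] = is_free_algebraD[OF T]
  obtain m where m: "m \<in> hom C (T \<otimes> T) T" and me: "m \<cdot> (e \<boxtimes> \<one> T) = \<one> T \<cdot> l T"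
    and ma: "m \<cdot> (a \<boxtimes> \<one> T) = a \<cdot> (\<one> G \<boxtimes> m) \<cdot> as G T T"
    using is_free_algebra_ex[OF T, of T "\<one> T" T a] by auto
  have [simp]: "m \<in> Arr C" "Dom C m = T \<otimes> T" "Cod C m = T" using m by simp_all
  have me: "m \<cdot> (e \<boxtimes> \<one> T) = l T" using me by simp
  have right_unit: "m \<cdot> (\<one> T \<boxtimes> e) = r T"
  proof (rule is_free_algebra_unique[OF T, of E e T a])
    have "(m \<cdot> (\<one> T \<boxtimes> e)) \<cdot> (e \<boxtimes> \<one> E) = (m \<cdot> (e \<boxtimes> \<one> T)) \<cdot> (\<one> E \<boxtimes> e)"
      by simp
    also have "\<dots> = e \<cdot> l E" unfolding me by (simp add: l_natural)
    finally show "(m \<cdot> (\<one> T \<boxtimes> e)) \<cdot> (e \<boxtimes> \<one> E) = e \<cdot> l E" .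
    have "(m \<cdot> (\<one> T \<boxtimes> e)) \<cdot> (a \<boxtimes> \<one> E) = (m \<cdot> (a \<boxtimes> \<one> T)) \<cdot> (\<one> (G \<otimes> T) \<boxtimes> e)"
      by simp
    also have "\<dots> = a \<cdot> (\<one> G \<boxtimes> (m \<cdot> (\<one> T \<boxtimes> e))) \<cdot> as G T E"
      unfolding ma by (simp add: as_natural ten_one[symmetric])
    finally show "(m \<cdot> (\<one> T \<boxtimes> e)) \<cdot> (a \<boxtimes> \<one> E) = a \<cdot> (\<one> G \<boxtimes> (m \<cdot> (\<one> T \<boxtimes> e))) \<cdot> as G T E" .
    show "r T \<cdot> (e \<boxtimes> \<one> E) = e \<cdot> l E" by (simp add: r_natural l_E_eq_r_E)
    show "r T \<cdot> (a \<boxtimes> \<one> E) = a \<cdot> (\<one> G \<boxtimes> r T) \<cdot> as G T E" by (simp add: r_natural r_ten)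
  qed simp_all
  have "(m \<cdot> (m \<boxtimes> \<one> T)) \<cdot> as' T T T = m \<cdot> (\<one> T \<boxtimes> m)"
  proof (rule is_free_algebra_unique[OF T, of "T \<otimes> T" m T a])
    have "((m \<cdot> (m \<boxtimes> \<one> T)) \<cdot> as' T T T) \<cdot> (e \<boxtimes> \<one> (T \<otimes> T))
        = m \<cdot> ((m \<cdot> (e \<boxtimes> \<one> T)) \<boxtimes> \<one> T) \<cdot> as' E T T"
      by (simp add: ten_one[symmetric] as'_natural)
    also have "\<dots> = m \<cdot> (l (T \<otimes> T) \<cdot> as E T T) \<cdot> as' E T T" unfolding me by (simp add: l_ten)
    also have "\<dots> = m \<cdot> l (T \<otimes> T)" by (simp add: as_as')
    finally show "((m \<cdot> (m \<boxtimes> \<one> T)) \<cdot> as' T T T) \<cdot> (e \<boxtimes> \<one> (T \<otimes> T)) = m \<cdot> l (T \<otimes> T)" .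
    have pent: "(\<one> G \<boxtimes> as' T T T) \<cdot> as G T (T \<otimes> T)
      = as G (T \<otimes> T) T \<cdot> (as G T T \<boxtimes> \<one> T) \<cdot> as' (G \<otimes> T) T T"
    proof -
      have "(\<one> G \<boxtimes> as' T T T) \<cdot> as G T (T \<otimes> T)
        = (\<one> G \<boxtimes> as' T T T) \<cdot> (as G T (T \<otimes> T) \<cdot> as (G \<otimes> T) T T) \<cdot> as' (G \<otimes> T) T T"
        by (simp add: as_as')
      also have "\<dots> = as G (T \<otimes> T) T \<cdot> (as G T T \<boxtimes> \<one> T) \<cdot> as' (G \<otimes> T) T T"
        unfolding pentagon[OF G \<open>T \<in> Obj C\<close> \<open>T \<in> Obj C\<close> \<open>T \<in> Obj C\<close>] by (simp add: as'_as ten_one)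
      finally show ?thesis .
    qed
    have "((m \<cdot> (m \<boxtimes> \<one> T)) \<cdot> as' T T T) \<cdot> (a \<boxtimes> \<one> (T \<otimes> T))
        = m \<cdot> ((m \<cdot> (a \<boxtimes> \<one> T)) \<boxtimes> \<one> T) \<cdot> as' (G \<otimes> T) T T"
      by (simp add: ten_one[symmetric] as'_natural)
    also have "\<dots> = m \<cdot> ((a \<cdot> (\<one> G \<boxtimes> m) \<cdot> as G T T) \<boxtimes> \<one> T) \<cdot> as' (G \<otimes> T) T T"
      unfolding ma ..
    also have "\<dots> = (m \<cdot> (a \<boxtimes> \<one> T)) \<cdot> ((\<one> G \<boxtimes> m) \<boxtimes> \<one> T) \<cdot> (as G T T \<boxtimes> \<one> T) \<cdot> as' (G \<otimes> T) T T"
      by simp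
    also have "\<dots> = a \<cdot> (\<one> G \<boxtimes> m) \<cdot> (as G T T \<cdot> ((\<one> G \<boxtimes> m) \<boxtimes> \<one> T)) \<cdot> (as G T T \<boxtimes> \<one> T) \<cdot> as' (G \<otimes> T) T T"
      unfolding ma by simp
    also have "\<dots> = a \<cdot> (\<one> G \<boxtimes> (m \<cdot> (m \<boxtimes> \<one> T))) \<cdot> as G (T \<otimes> T) T \<cdot> (as G T T \<boxtimes> \<one> T) \<cdot> as' (G \<otimes> T) T T"
      by (subst as_natural) simp_all
    also have "\<dots> = a \<cdot> (\<one> G \<boxtimes> ((m \<cdot> (m \<boxtimes> \<one> T)) \<cdot> as' T T T)) \<cdot> as G T (T \<otimes> T)"
      unfolding pent[symmetric] by simp
    finally show "((m \<cdot> (m \<boxtimes> \<one> T)) \<cdot> as' T T T) \<cdot> (a \<boxtimes> \<one> (T \<otimes> T))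
      = a \<cdot> (\<one> G \<boxtimes> ((m \<cdot> (m \<boxtimes> \<one> T)) \<cdot> as' T T T)) \<cdot> as G T (T \<otimes> T)" .
    have "(m \<cdot> (\<one> T \<boxtimes> m)) \<cdot> (e \<boxtimes> \<one> (T \<otimes> T)) = (m \<cdot> (e \<boxtimes> \<one> T)) \<cdot> (\<one> E \<boxtimes> m)"
      by simp
    then show "(m \<cdot> (\<one> T \<boxtimes> m)) \<cdot> (e \<boxtimes> \<one> (T \<otimes> T)) = m \<cdot> l (T \<otimes> T)"
      unfolding me by (simp add: l_natural)
    have "(m \<cdot> (\<one> T \<boxtimes> m)) \<cdot> (a \<boxtimes> \<one> (T \<otimes> T)) = (m \<cdot> (a \<boxtimes> \<one> T)) \<cdot> (\<one> (G \<otimes> T) \<boxtimes> m)"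
      by simp
    then show "(m \<cdot> (\<one> T \<boxtimes> m)) \<cdot> (a \<boxtimes> \<one> (T \<otimes> T))
      = a \<cdot> (\<one> G \<boxtimes> (m \<cdot> (\<one> T \<boxtimes> m))) \<cdot> as G T (T \<otimes> T)"
      unfolding ma by (simp add: as_natural ten_one[symmetric])
  qed simp_all
  then have "((m \<cdot> (m \<boxtimes> \<one> T)) \<cdot> as' T T T) \<cdot> as T T T = (m \<cdot> (\<one> T \<boxtimes> m)) \<cdot> as T T T"
    by (rule arg_cong)
  then have "m \<cdot> (m \<boxtimes> \<one> T) = m \<cdot> (\<one> T \<boxtimes> m) \<cdot> as T T T"
    by (simp add: as'_as)
  then have "is_monoid T m e" using me right_unit by (simp add: is_monoid_def)
  with ma show ?thesis by (rule that[rotated])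
qed

text \<open>
  Freeness at \<open>N = E\<close>, transported along \<open>r : T \<otimes> E \<rightarrow> T\<close>: the object \<open>T\<close> itself is the initial
  \<open>G\<close>-algebra under \<open>E\<close>.
\<close>

lemma free_algebra_unique_from_unit:
  assumes G [simp]: "G \<in> Obj C" and T: "is_free_algebra G T e a" and f: "f \<in> hom C E P"
    and g: "g \<in> hom C (G \<otimes> P) P"
    and h: "h \<in> hom C T P" "h \<cdot> e = f" "h \<cdot> a = g \<cdot> (\<one> G \<boxtimes> h)"
    and k: "k \<in> hom C T P" "k \<cdot> e = f" "k \<cdot> a = g \<cdot> (\<one> G \<boxtimes> k)"
  shows "h = k"
proof -
  note [simp] = is_free_algebraD[OF T]
  have [simp]: "f \<in> Arr C" "Dom C f = E" "Cod C f = P" "g \<in> Arr C" "Dom C g = G \<otimes> P" "Cod C g = P"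
    using f g by simp_all
  have x: "(x \<cdot> r T) \<cdot> (e \<boxtimes> \<one> E) = f \<cdot> l E"
     "(x \<cdot> r T) \<cdot> (a \<boxtimes> \<one> E) = g \<cdot> (\<one> G \<boxtimes> (x \<cdot> r T)) \<cdot> as G T E"
    if x: "x \<in> hom C T P" "x \<cdot> e = f" "x \<cdot> a = g \<cdot> (\<one> G \<boxtimes> x)" for x
  proof -
    have [simp]: "x \<in> Arr C" "Dom C x = T" "Cod C x = P" using x by simp_all
    have "(x \<cdot> r T) \<cdot> (e \<boxtimes> \<one> E) = (x \<cdot> e) \<cdot> l E" by (simp add: r_natural l_E_eq_r_E)
    then show "(x \<cdot> r T) \<cdot> (e \<boxtimes> \<one> E) = f \<cdot> l E" unfolding x(2) .
    have "(x \<cdot> r T) \<cdot> (a \<boxtimes> \<one> E) = (x \<cdot> a) \<cdot> (\<one> G \<boxtimes> r T) \<cdot> as G T E" by (simp add: r_natural r_ten)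
    then show "(x \<cdot> r T) \<cdot> (a \<boxtimes> \<one> E) = g \<cdot> (\<one> G \<boxtimes> (x \<cdot> r T)) \<cdot> as G T E" unfolding x(3) by simp
  qed
  have "h \<cdot> r T = k \<cdot> r T"
    by (rule is_free_algebra_unique[OF T _ f g _ x[OF h] _ x[OF k]]) (use h k in simp_all)
  then have "(h \<cdot> r T) \<cdot> r' T = (k \<cdot> r T) \<cdot> r' T" by simp
  then show ?thesis using h k by (simp add: r_r')
qed

lemma free_algebra_ex_from_unit:
  assumes G [simp]: "G \<in> Obj C" and T: "is_free_algebra G T e a" and f: "f \<in> hom C E P"
    and g: "g \<in> hom C (G \<otimes> P) P"
  obtains h where "h \<in> hom C T P" "h \<cdot> e = f" "h \<cdot> a = g \<cdot> (\<one> G \<boxtimes> h)"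
proof -
  note [simp] = is_free_algebraD[OF T]
  have [simp]: "f \<in> Arr C" "Dom C f = E" "Cod C f = P" "g \<in> Arr C" "Dom C g = G \<otimes> P" "Cod C g = P"
    using f g by simp_all
  have r'_nat: "r' M \<cdot> x = (x \<boxtimes> \<one> E) \<cdot> r' (Dom C x)" if [simp]: "x \<in> Arr C" and x: "Cod C x = M" for x M
  proof -
    have "r' M \<cdot> x = r' M \<cdot> x \<cdot> r (Dom C x) \<cdot> r' (Dom C x)" using x by (simp add: r_r')
    also have "\<dots> = r' M \<cdot> (r M \<cdot> (x \<boxtimes> \<one> E)) \<cdot> r' (Dom C x)" using x by (simp add: r_natural)
    also have "\<dots> = (r' M \<cdot> r M) \<cdot> (x \<boxtimes> \<one> E) \<cdot> r' (Dom C x)" using x by auto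
    also have "\<dots> = (x \<boxtimes> \<one> E) \<cdot> r' (Dom C x)" using x by (auto simp: r'_r)
    finally show ?thesis .
  qed
  obtain h where h: "h \<in> hom C (T \<otimes> E) P" "h \<cdot> (e \<boxtimes> \<one> E) = f \<cdot> l E"
    "h \<cdot> (a \<boxtimes> \<one> E) = g \<cdot> (\<one> G \<boxtimes> h) \<cdot> as G T E"
    using is_free_algebra_ex[OF T _ f g] by auto
  have [simp]: "h \<in> Arr C" "Dom C h = T \<otimes> E" "Cod C h = P" using h by simp_all
  show ?thesis
  proof (rule that[of "h \<cdot> r' T"])
    show "h \<cdot> r' T \<in> hom C T P" by simp
    have "(h \<cdot> r' T) \<cdot> e = (h \<cdot> (e \<boxtimes> \<one> E)) \<cdot> r' E" by (simp add: r'_nat)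
    then show "(h \<cdot> r' T) \<cdot> e = f" unfolding h(2) by (simp add: l_E_eq_r_E r_r')
    have "(h \<cdot> r' T) \<cdot> a = (h \<cdot> (a \<boxtimes> \<one> E)) \<cdot> r' (G \<otimes> T)" by (simp add: r'_nat)
    also have "\<dots> = (g \<cdot> (\<one> G \<boxtimes> (h \<cdot> r' T)) \<cdot> (\<one> G \<boxtimes> r T) \<cdot> as G T E) \<cdot> r' (G \<otimes> T)"
      unfolding h(3) by (simp add: r'_r)
    also have "\<dots> = g \<cdot> (\<one> G \<boxtimes> (h \<cdot> r' T)) \<cdot> ((\<one> G \<boxtimes> r T) \<cdot> as G T E) \<cdot> r' (G \<otimes> T)"
      by simp
    also have "\<dots> = g \<cdot> (\<one> G \<boxtimes> (h \<cdot> r' T))"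
      by (simp only: r_ten[OF G \<open>T \<in> Obj C\<close>]) (simp add: r_r')
    finally show "(h \<cdot> r' T) \<cdot> a = g \<cdot> (\<one> G \<boxtimes> (h \<cdot> r' T))" .
  qed
qed

definition is_free_monoid :: "'o \<Rightarrow> 'o \<Rightarrow> 'a \<Rightarrow> 'a \<Rightarrow> 'a \<Rightarrow> bool" where
  "is_free_monoid G T m n \<gamma> \<longleftrightarrow> is_monoid T m n \<and> \<gamma> \<in> hom C G T \<and>
    (\<forall>B m' n' f. is_monoid B m' n' \<and> f \<in> hom C G B \<longrightarrow>
      (\<exists>!h. is_monoid_mor T m n B m' n' h \<and> h \<cdot> \<gamma> = f))"

text \<open>
  An arrow \<open>f : G \<rightarrow> B\<close> into a monoid makes \<open>B\<close> a \<open>G\<close>-algebra by \<open>m' \<cdot> (f \<boxtimes> \<one> B)\<close>, and monoid morphisms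
  \<open>T \<rightarrow> B\<close> extending \<open>f\<close> are the same as algebra morphisms respecting the units. This rests
  on the action of \<open>G\<close> on \<open>T\<close> being multiplication by generators, \<open>m \<cdot> (\<gamma> \<boxtimes> \<one> T) = a\<close>.
\<close>

lemma free_algebra_free_monoid:
  assumes G [simp]: "G \<in> Obj C" and T: "is_free_algebra G T e a"
  shows "\<exists>m \<gamma>. is_free_monoid G T m e \<gamma>"
proof -
  note [simp] = is_free_algebraD[OF T]
  obtain m where m: "is_monoid T m e" and ma: "m \<cdot> (a \<boxtimes> \<one> T) = a \<cdot> (\<one> G \<boxtimes> m) \<cdot> as G T T"
    using free_algebra_monoid[OF G T] by blast
  note mD [simp] = is_monoidD(1-7)[OF m]
  define \<gamma> where "\<gamma> = a \<cdot> (\<one> G \<boxtimes> e) \<cdot> r' G"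
  have \<gamma> [simp]: "\<gamma> \<in> Arr C" "Dom C \<gamma> = G" "Cod C \<gamma> = T" by (simp_all add: \<gamma>_def)
  have m\<gamma>: "m \<cdot> (\<gamma> \<boxtimes> \<one> T) = a"
  proof -
    have "m \<cdot> (\<gamma> \<boxtimes> \<one> T) = (m \<cdot> (a \<boxtimes> \<one> T)) \<cdot> ((\<one> G \<boxtimes> e) \<boxtimes> \<one> T) \<cdot> (r' G \<boxtimes> \<one> T)"
      by (simp add: \<gamma>_def)
    also have "\<dots> = a \<cdot> (\<one> G \<boxtimes> m) \<cdot> (as G T T \<cdot> ((\<one> G \<boxtimes> e) \<boxtimes> \<one> T)) \<cdot> (r' G \<boxtimes> \<one> T)"
      unfolding ma by simp
    also have "\<dots> = a \<cdot> (\<one> G \<boxtimes> (m \<cdot> (e \<boxtimes> \<one> T))) \<cdot> as G E T \<cdot> (r' G \<boxtimes> \<one> T)"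
      by (subst as_natural) simp_all
    also have "\<dots> = a \<cdot> ((\<one> G \<boxtimes> l T) \<cdot> as G E T) \<cdot> (r' G \<boxtimes> \<one> T)"
      unfolding is_monoidD(9)[OF m] by simp
    also have "\<dots> = a" by (simp only: triangle[OF G \<open>T \<in> Obj C\<close>]) (simp add: r_r' ten_one)
    finally show ?thesis .
  qed
  have "\<exists>!h. is_monoid_mor T m e B m' n' h \<and> h \<cdot> \<gamma> = f"
    if B: "is_monoid B m' n'" and f: "f \<in> hom C G B" for B m' n' f
  proof -
    note [simp] = is_monoidD(1-7)[OF B]
    have [simp]: "f \<in> Arr C" "Dom C f = G" "Cod C f = B" using f by simp_all
    show ?thesis
    proof (rule ex_ex1I)
      obtain h where h: "h \<in> hom C T B" and he: "h \<cdot> e = n'"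
        and ha: "h \<cdot> a = (m' \<cdot> (f \<boxtimes> \<one> B)) \<cdot> (\<one> G \<boxtimes> h)"
        using free_algebra_ex_from_unit[OF G T, of n' B "m' \<cdot> (f \<boxtimes> \<one> B)"] by auto
      have [simp]: "h \<in> Arr C" "Dom C h = T" "Cod C h = B" using h by simp_all
      have "h \<cdot> \<gamma> = (h \<cdot> a) \<cdot> (\<one> G \<boxtimes> e) \<cdot> r' G" by (simp add: \<gamma>_def)
      also have "\<dots> = m' \<cdot> (f \<boxtimes> (h \<cdot> e)) \<cdot> r' G" unfolding ha by simp
      also have "\<dots> = (m' \<cdot> (\<one> B \<boxtimes> n')) \<cdot> (f \<boxtimes> \<one> E) \<cdot> r' G" unfolding he by simp
      also have "\<dots> = (r B \<cdot> (f \<boxtimes> \<one> E)) \<cdot> r' G" unfolding is_monoidD(10)[OF B] by simp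
      also have "\<dots> = f" by (subst r_natural) (simp_all add: r_r')
      finally have h\<gamma>: "h \<cdot> \<gamma> = f" .
      have "m' \<cdot> (h \<boxtimes> h) = h \<cdot> m"
      proof (rule is_free_algebra_unique[OF T, of T h B "m' \<cdot> (f \<boxtimes> \<one> B)"])
        have "(m' \<cdot> (h \<boxtimes> h)) \<cdot> (e \<boxtimes> \<one> T) = m' \<cdot> ((h \<cdot> e) \<boxtimes> h)" by simp
        also have "\<dots> = (m' \<cdot> (n' \<boxtimes> \<one> B)) \<cdot> (\<one> E \<boxtimes> h)" unfolding he by simp
        also have "\<dots> = h \<cdot> l T" unfolding is_monoidD(9)[OF B] by (simp add: l_natural)
        finally show "(m' \<cdot> (h \<boxtimes> h)) \<cdot> (e \<boxtimes> \<one> T) = h \<cdot> l T" .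
        have "(m' \<cdot> (h \<boxtimes> h)) \<cdot> (a \<boxtimes> \<one> T) = m' \<cdot> ((h \<cdot> a) \<boxtimes> h)" by simp
        also have "\<dots> = (m' \<cdot> (m' \<boxtimes> \<one> B)) \<cdot> ((f \<boxtimes> h) \<boxtimes> h)" unfolding ha by simp
        also have "\<dots> = (m' \<cdot> (f \<boxtimes> \<one> B)) \<cdot> (\<one> G \<boxtimes> (m' \<cdot> (h \<boxtimes> h))) \<cdot> as G T T"
          unfolding is_monoidD(8)[OF B] by (simp add: as_natural)
        finally show "(m' \<cdot> (h \<boxtimes> h)) \<cdot> (a \<boxtimes> \<one> T)
          = (m' \<cdot> (f \<boxtimes> \<one> B)) \<cdot> (\<one> G \<boxtimes> (m' \<cdot> (h \<boxtimes> h))) \<cdot> as G T T" .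
        have "(h \<cdot> m) \<cdot> (e \<boxtimes> \<one> T) = h \<cdot> (m \<cdot> (e \<boxtimes> \<one> T))" by simp
        then show "(h \<cdot> m) \<cdot> (e \<boxtimes> \<one> T) = h \<cdot> l T" unfolding is_monoidD(9)[OF m] .
        have "(h \<cdot> m) \<cdot> (a \<boxtimes> \<one> T) = h \<cdot> (m \<cdot> (a \<boxtimes> \<one> T))" by simp
        also have "\<dots> = (h \<cdot> a) \<cdot> (\<one> G \<boxtimes> m) \<cdot> as G T T" unfolding ma by simp
        also have "\<dots> = (m' \<cdot> (f \<boxtimes> \<one> B)) \<cdot> (\<one> G \<boxtimes> (h \<cdot> m)) \<cdot> as G T T" unfolding ha by simp
        finally show "(h \<cdot> m) \<cdot> (a \<boxtimes> \<one> T) = (m' \<cdot> (f \<boxtimes> \<one> B)) \<cdot> (\<one> G \<boxtimes> (h \<cdot> m)) \<cdot> as G T T" .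
      qed simp_all
      with h he h\<gamma> show "\<exists>h. is_monoid_mor T m e B m' n' h \<and> h \<cdot> \<gamma> = f"
        unfolding is_monoid_mor_def by blast
    next
      have a: "h \<cdot> a = (m' \<cdot> (f \<boxtimes> \<one> B)) \<cdot> (\<one> G \<boxtimes> h)"
        if h: "is_monoid_mor T m e B m' n' h \<and> h \<cdot> \<gamma> = f" for h
      proof -
        have [simp]: "h \<in> Arr C" "Dom C h = T" "Cod C h = B" using h by (simp_all add: is_monoid_mor_def)
        have "h \<cdot> a = (h \<cdot> m) \<cdot> (\<gamma> \<boxtimes> \<one> T)" by (simp add: m\<gamma>)
        also have "\<dots> = (m' \<cdot> (h \<boxtimes> h)) \<cdot> (\<gamma> \<boxtimes> \<one> T)" using h unfolding is_monoid_mor_def by argo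
        also have "\<dots> = m' \<cdot> ((h \<cdot> \<gamma>) \<boxtimes> h)" by simp
        also have "\<dots> = (m' \<cdot> (f \<boxtimes> \<one> B)) \<cdot> (\<one> G \<boxtimes> h)" by (simp add: conjunct2[OF h])
        finally show ?thesis .
      qed
      fix h k assume h: "is_monoid_mor T m e B m' n' h \<and> h \<cdot> \<gamma> = f"
        and k: "is_monoid_mor T m e B m' n' k \<and> k \<cdot> \<gamma> = f"
      show "h = k"
        by (rule free_algebra_unique_from_unit[OF G T _ _ _ _ a[OF h] _ _ a[OF k]])
          (use h k in \<open>simp_all add: is_monoid_mor_def\<close>)
    qed
  qed
  then have "is_free_monoid G T m e \<gamma>" using m \<gamma> unfolding is_free_monoid_def by simp
  then show ?thesis by blast
qed

end

locale stable_monoidal = monoidal C ten tenA E as as' l l' r r'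
  for C :: "('o, 'a) cat" (structure) and ten (infixr "\<otimes>" 70) and tenA (infixr "\<boxtimes>" 70)
    and E as as' l l' r r' +
  assumes coproduct_exists: "\<And>H :: nat \<Rightarrow> 'o. (\<And>n. H n \<in> Obj C) \<Longrightarrow> \<exists>T \<iota>. is_coproduct C UNIV H T \<iota>"
    and coproduct_left: "\<And>(H :: nat \<Rightarrow> 'o) T \<iota> N. is_coproduct C UNIV H T \<iota> \<Longrightarrow> N \<in> Obj C
      \<Longrightarrow> is_coproduct C UNIV (\<lambda>n. N \<otimes> H n) (N \<otimes> T) (\<lambda>n. \<one> N \<boxtimes> \<iota> n)"
    and coproduct_right: "\<And>(H :: nat \<Rightarrow> 'o) T \<iota> N. is_coproduct C UNIV H T \<iota> \<Longrightarrow> N \<in> Obj C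
      \<Longrightarrow> is_coproduct C UNIV (\<lambda>n. H n \<otimes> N) (T \<otimes> N) (\<lambda>n. \<iota> n \<boxtimes> \<one> N)"
    and coequalizer_exists: "\<And>u v. u \<in> Arr C \<Longrightarrow> v \<in> hom C (Dom C u) (Cod C u)
      \<Longrightarrow> \<exists>Q q. is_coequalizer C u v Q q"
    and coequalizer_left: "\<And>u v Q q N. is_coequalizer C u v Q q \<Longrightarrow> u \<in> Arr C
      \<Longrightarrow> v \<in> hom C (Dom C u) (Cod C u) \<Longrightarrow> N \<in> Obj C
      \<Longrightarrow> is_coequalizer C (\<one> N \<boxtimes> u) (\<one> N \<boxtimes> v) (N \<otimes> Q) (\<one> N \<boxtimes> q)"
    and coequalizer_right: "\<And>u v Q q N. is_coequalizer C u v Q q \<Longrightarrow> u \<in> Arr C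
      \<Longrightarrow> v \<in> hom C (Dom C u) (Cod C u) \<Longrightarrow> N \<in> Obj C
      \<Longrightarrow> is_coequalizer C (u \<boxtimes> \<one> N) (v \<boxtimes> \<one> N) (Q \<otimes> N) (q \<boxtimes> \<one> N)"
begin

text \<open>
  \<open>T\<close> is the coproduct of the iterated tensor powers \<open>H n\<close> of \<open>G\<close>. Since the tensor product
  preserves it, an arrow \<open>h\<close> out of \<open>T \<otimes> N\<close> amounts to a sequence of arrows out of the \<open>H n \<otimes> N\<close>, and
  the two conditions on \<open>h\<close> say precisely that this sequence is the recursively defined \<open>k\<close>.
\<close>

lemma free_algebra_exists:
  assumes G [simp]: "G \<in> Obj C"
  shows "\<exists>T e a. is_free_algebra G T e a"
proof -
  define H where "H = rec_nat E (\<lambda>_ N. G \<otimes> N)"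
  have H0 [simp]: "H 0 = E" and HS [simp]: "\<And>n. H (Suc n) = G \<otimes> H n" by (simp_all add: H_def)
  have H [simp]: "H n \<in> Obj C" for n by (induction n) simp_all
  obtain T \<iota> where cp: "is_coproduct C UNIV H T \<iota>" using coproduct_exists[of H] H by blast
  then have T [simp]: "T \<in> Obj C" and \<iota> [simp]: "\<iota> n \<in> Arr C" "Dom C (\<iota> n) = H n" "Cod C (\<iota> n) = T" for n
    by (auto simp: is_coproduct_def)
  obtain a where a: "a \<in> hom C (G \<otimes> T) T" and a\<iota>: "\<And>n. a \<cdot> (\<one> G \<boxtimes> \<iota> n) = \<iota> (Suc n)"
    using is_coproduct_ex[OF coproduct_left[OF cp G], of T "\<lambda>n. \<iota> (Suc n)"] by auto
  have a_typing [simp]: "a \<in> Arr C" "Dom C a = G \<otimes> T" "Cod C a = T" using a by simp_all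
  have "\<exists>!h. h \<in> hom C (T \<otimes> N) P \<and> h \<cdot> (\<iota> 0 \<boxtimes> \<one> N) = f \<cdot> l N \<and>
        h \<cdot> (a \<boxtimes> \<one> N) = g \<cdot> (\<one> G \<boxtimes> h) \<cdot> as G T N"
    if N [simp]: "N \<in> Obj C" and f: "f \<in> hom C N P" and g: "g \<in> hom C (G \<otimes> P) P" for N P f g
  proof -
    have [simp]: "P \<in> Obj C" "f \<in> Arr C" "Dom C f = N" "Cod C f = P"
      "g \<in> Arr C" "Dom C g = G \<otimes> P" "Cod C g = P"
      using f g Cod_in[of f] by auto
    define k where "k = rec_nat (f \<cdot> l N) (\<lambda>n x. g \<cdot> (\<one> G \<boxtimes> x) \<cdot> as G (H n) N)"
    have k0: "k 0 = f \<cdot> l N" and kS: "\<And>n. k (Suc n) = g \<cdot> (\<one> G \<boxtimes> k n) \<cdot> as G (H n) N"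
      by (simp_all add: k_def)
    have k_hom: "k n \<in> hom C (H n \<otimes> N) P" for n by (induction n) (simp_all add: k0 kS)
    then have [simp]: "k n \<in> Arr C" "Dom C (k n) = H n \<otimes> N" "Cod C (k n) = P" for n
      by simp_all
    have step: "h \<cdot> (\<iota> (Suc n) \<boxtimes> \<one> N) = (h \<cdot> (a \<boxtimes> \<one> N)) \<cdot> ((\<one> G \<boxtimes> \<iota> n) \<boxtimes> \<one> N)"
      "(g \<cdot> (\<one> G \<boxtimes> h) \<cdot> as G T N) \<cdot> ((\<one> G \<boxtimes> \<iota> n) \<boxtimes> \<one> N)
        = g \<cdot> (\<one> G \<boxtimes> (h \<cdot> (\<iota> n \<boxtimes> \<one> N))) \<cdot> as G (H n) N"
      if "h \<in> hom C (T \<otimes> N) P" for h n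
      using that by (simp_all add: a\<iota> as_natural)
    show ?thesis
    proof (rule ex_ex1I)
      obtain h where h: "h \<in> hom C (T \<otimes> N) P" and hk: "\<And>n. h \<cdot> (\<iota> n \<boxtimes> \<one> N) = k n"
        using is_coproduct_ex[OF coproduct_right[OF cp N], of P k] k_hom by auto
      have "h \<cdot> (a \<boxtimes> \<one> N) = g \<cdot> (\<one> G \<boxtimes> h) \<cdot> as G T N"
      proof (rule is_coproduct_unique[OF coproduct_right[OF coproduct_left[OF cp G] N]])
        fix n
        show "(h \<cdot> (a \<boxtimes> \<one> N)) \<cdot> ((\<one> G \<boxtimes> \<iota> n) \<boxtimes> \<one> N)
          = (g \<cdot> (\<one> G \<boxtimes> h) \<cdot> as G T N) \<cdot> ((\<one> G \<boxtimes> \<iota> n) \<boxtimes> \<one> N)"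
          unfolding step(1)[OF h, symmetric] step(2)[OF h] hk kS ..
      qed (use h in simp_all)
      then show "\<exists>h. h \<in> hom C (T \<otimes> N) P \<and> h \<cdot> (\<iota> 0 \<boxtimes> \<one> N) = f \<cdot> l N \<and>
          h \<cdot> (a \<boxtimes> \<one> N) = g \<cdot> (\<one> G \<boxtimes> h) \<cdot> as G T N"
        using h hk[of 0] k0 by auto
    next
      have k_unique: "h \<cdot> (\<iota> n \<boxtimes> \<one> N) = k n"
        if h: "h \<in> hom C (T \<otimes> N) P \<and> h \<cdot> (\<iota> 0 \<boxtimes> \<one> N) = f \<cdot> l N \<and>
          h \<cdot> (a \<boxtimes> \<one> N) = g \<cdot> (\<one> G \<boxtimes> h) \<cdot> as G T N" for h n
      proof (induction n)
        case 0 show ?case using h k0 by simp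
      next
        case (Suc n)
        have hT: "h \<in> hom C (T \<otimes> N) P"
          and ha: "h \<cdot> (a \<boxtimes> \<one> N) = g \<cdot> (\<one> G \<boxtimes> h) \<cdot> as G T N"
          using h by blast+
        show ?case unfolding step(1)[OF hT] ha step(2)[OF hT] Suc kS ..
      qed
      fix h h'
      assume h: "h \<in> hom C (T \<otimes> N) P \<and> h \<cdot> (\<iota> 0 \<boxtimes> \<one> N) = f \<cdot> l N \<and>
          h \<cdot> (a \<boxtimes> \<one> N) = g \<cdot> (\<one> G \<boxtimes> h) \<cdot> as G T N"
        and h': "h' \<in> hom C (T \<otimes> N) P \<and> h' \<cdot> (\<iota> 0 \<boxtimes> \<one> N) = f \<cdot> l N \<and>
          h' \<cdot> (a \<boxtimes> \<one> N) = g \<cdot> (\<one> G \<boxtimes> h') \<cdot> as G T N"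
      show "h = h'"
        by (rule is_coproduct_unique[OF coproduct_right[OF cp N] conjunct1[OF h] conjunct1[OF h']])
          (simp only: k_unique[OF h] k_unique[OF h'])
    qed
  qed
  then have "is_free_algebra G T (\<iota> 0) a"
    unfolding is_free_algebra_def by simp
  then show ?thesis by blast
qed

theorem free_monoid_exists: "G \<in> Obj C \<Longrightarrow> \<exists>T m n \<gamma>. is_free_monoid G T m n \<gamma>"
  using free_algebra_exists free_algebra_free_monoid by blast

lemma epi_ten:
  assumes ce: "is_coequalizer C u v Q q" and u: "u \<in> Arr C" "v \<in> hom C (Dom C u) (Cod C u)"
    and N: "N \<in> Obj C"
  shows "is_epi C (\<one> N \<boxtimes> q)" "is_epi C (q \<boxtimes> \<one> N)"
  using is_coequalizer_epi[OF coequalizer_left[OF ce u N]]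
    is_coequalizer_epi[OF coequalizer_right[OF ce u N]] u N by simp_all

text \<open>
  The two-sided ideal generated by \<open>u\<close> and \<open>v\<close> is the image of the pair \<open>W u, W v : T \<otimes> (R \<otimes> T) \<rightarrow> T\<close>, where
  \<open>W w\<close> multiplies on both sides of \<open>w\<close>. Its coequalizer \<open>q\<close> is taken in the underlying category.
  Since tensoring preserves this coequalizer, the multiplication of \<open>T\<close> descends to \<open>Q\<close> in one
  variable after the other, and tensor products of \<open>q\<close> with identities are epimorphisms, which transfers all laws.
\<close>

theorem quotient_monoid_exists:
  assumes T: "is_monoid T m n" and u: "u \<in> hom C R T" and v: "v \<in> hom C R T"
  shows "\<exists>Q mQ nQ q. is_monoid Q mQ nQ \<and> is_monoid_mor T m n Q mQ nQ q \<and> q \<cdot> u = q \<cdot> v \<and>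
    (\<forall>B m' n' f. is_monoid B m' n' \<and> is_monoid_mor T m n B m' n' f \<and> f \<cdot> u = f \<cdot> v \<longrightarrow>
      (\<exists>!h. is_monoid_mor Q mQ nQ B m' n' h \<and> h \<cdot> q = f))"
proof -
  note TD [simp] = is_monoidD(1-7)[OF T]
  have [simp]: "R \<in> Obj C" using u Dom_in by fastforce
  define W where "W = (\<lambda>w. m \<cdot> (\<one> T \<boxtimes> (m \<cdot> (w \<boxtimes> \<one> T))))"
  have W [simp]: "W w \<in> Arr C" "Dom C (W w) = T \<otimes> (R \<otimes> T)" "Cod C (W w) = T" if "w \<in> hom C R T" for w
    using that by (simp_all add: W_def)
  \<comment> \<open>Inserting units on both sides of \<open>w\<close> gives back \<open>w\<close>, so coequalizing \<open>W u\<close> and \<open>W v\<close> suffices for \<open>u\<close> and \<open>v\<close>.\<close>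
  have W_unit: "W w \<cdot> (n \<boxtimes> (\<one> R \<boxtimes> n)) = w \<cdot> r R \<cdot> l (R \<otimes> E)" if w: "w \<in> hom C R T" for w
  proof -
    have [simp]: "w \<in> Arr C" "Dom C w = R" "Cod C w = T" using w by simp_all
    have "W w \<cdot> (n \<boxtimes> (\<one> R \<boxtimes> n)) = (m \<cdot> (n \<boxtimes> \<one> T)) \<cdot> (\<one> E \<boxtimes> ((m \<cdot> (\<one> T \<boxtimes> n)) \<cdot> (w \<boxtimes> \<one> E)))"
      by (simp add: W_def)
    also have "\<dots> = w \<cdot> r R \<cdot> l (R \<otimes> E)"
      unfolding is_monoidD(9,10)[OF T] by (simp add: r_natural l_natural)
    finally show ?thesis .
  qed
  \<comment> \<open>Multiplying \<open>W w\<close> from either side is \<open>W w\<close> after an arrow that does not depend on \<open>w\<close>: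
    the ideal property.\<close>
  have W_right: "m \<cdot> (W w \<boxtimes> \<one> T) = W w \<cdot> (\<one> T \<boxtimes> ((\<one> R \<boxtimes> m) \<cdot> as R T T)) \<cdot> as T (R \<otimes> T) T"
    if w: "w \<in> hom C R T" for w
  proof -
    have [simp]: "w \<in> Arr C" "Dom C w = R" "Cod C w = T" using w by simp_all
    have x: "m \<cdot> ((m \<cdot> (w \<boxtimes> \<one> T)) \<boxtimes> \<one> T) = (m \<cdot> (w \<boxtimes> \<one> T)) \<cdot> (\<one> R \<boxtimes> m) \<cdot> as R T T"
    proof -
      have "m \<cdot> ((m \<cdot> (w \<boxtimes> \<one> T)) \<boxtimes> \<one> T) = (m \<cdot> (m \<boxtimes> \<one> T)) \<cdot> ((w \<boxtimes> \<one> T) \<boxtimes> \<one> T)" by simp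
      also have "\<dots> = (m \<cdot> (w \<boxtimes> \<one> T)) \<cdot> (\<one> R \<boxtimes> m) \<cdot> as R T T"
        unfolding is_monoidD(8)[OF T] by (simp add: as_natural ten_one)
      finally show ?thesis .
    qed
    have "m \<cdot> (W w \<boxtimes> \<one> T) = (m \<cdot> (m \<boxtimes> \<one> T)) \<cdot> ((\<one> T \<boxtimes> (m \<cdot> (w \<boxtimes> \<one> T))) \<boxtimes> \<one> T)"
      by (simp add: W_def)
    also have "\<dots> = m \<cdot> (\<one> T \<boxtimes> (m \<cdot> ((m \<cdot> (w \<boxtimes> \<one> T)) \<boxtimes> \<one> T))) \<cdot> as T (R \<otimes> T) T"
      unfolding is_monoidD(8)[OF T] by (simp add: as_natural)
    also have "\<dots> = W w \<cdot> (\<one> T \<boxtimes> ((\<one> R \<boxtimes> m) \<cdot> as R T T)) \<cdot> as T (R \<otimes> T) T"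
      unfolding x by (simp add: W_def)
    finally show ?thesis .
  qed
  have W_left: "m \<cdot> (\<one> T \<boxtimes> W w) = W w \<cdot> (m \<boxtimes> \<one> (R \<otimes> T)) \<cdot> as' T T (R \<otimes> T)"
    if w: "w \<in> hom C R T" for w
  proof -
    have [simp]: "w \<in> Arr C" "Dom C w = R" "Cod C w = T" using w by simp_all
    have assoc': "m \<cdot> (\<one> T \<boxtimes> m) = (m \<cdot> (m \<boxtimes> \<one> T)) \<cdot> as' T T T"
      unfolding is_monoidD(8)[OF T] by (simp add: as_as' ten_one)
    have "m \<cdot> (\<one> T \<boxtimes> W w) = (m \<cdot> (\<one> T \<boxtimes> m)) \<cdot> (\<one> T \<boxtimes> (\<one> T \<boxtimes> (m \<cdot> (w \<boxtimes> \<one> T))))"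
      by (simp add: W_def)
    also have "\<dots> = W w \<cdot> (m \<boxtimes> \<one> (R \<otimes> T)) \<cdot> as' T T (R \<otimes> T)"
      unfolding assoc' by (simp add: W_def as'_natural ten_one)
    finally show ?thesis .
  qed
  have WuWv: "W u \<in> Arr C" "W v \<in> hom C (Dom C (W u)) (Cod C (W u))" using u v by simp_all
  obtain Q q where ce: "is_coequalizer C (W u) (W v) Q q"
    using coequalizer_exists[OF WuWv] by blast
  then have Q [simp]: "Q \<in> Obj C" "q \<in> Arr C" "Dom C q = T" "Cod C q = Q" and qW: "q \<cdot> W u = q \<cdot> W v"
    using u by (simp_all add: is_coequalizer_def)
  note epi = epi_ten[OF ce WuWv]
  have epi_q: "is_epi C q" by (rule is_coequalizer_epi[OF ce WuWv])
  have epi_qq: "is_epi C (q \<boxtimes> q)"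
    using is_epi_Comp[OF epi(2)[of T] epi(1)[of Q]] by simp
  have epi_qqq: "is_epi C ((q \<boxtimes> q) \<boxtimes> q)"
  proof -
    have WT: "W u \<boxtimes> \<one> T \<in> Arr C" "W v \<boxtimes> \<one> T \<in> hom C (Dom C (W u \<boxtimes> \<one> T)) (Cod C (W u \<boxtimes> \<one> T))"
      and QW: "\<one> Q \<boxtimes> W u \<in> Arr C" "\<one> Q \<boxtimes> W v \<in> hom C (Dom C (\<one> Q \<boxtimes> W u)) (Cod C (\<one> Q \<boxtimes> W u))"
      using u v by simp_all
    have "is_epi C ((q \<boxtimes> \<one> T) \<boxtimes> \<one> T)"
      by (rule epi_ten(2)[OF coequalizer_right[OF ce WuWv] WT]) simp_all
    moreover have "is_epi C ((\<one> Q \<boxtimes> q) \<boxtimes> \<one> T)"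
      by (rule epi_ten(2)[OF coequalizer_left[OF ce WuWv] QW]) simp_all
    moreover have "is_epi C (\<one> (Q \<otimes> Q) \<boxtimes> q)" by (rule epi) simp
    ultimately have "is_epi C ((\<one> (Q \<otimes> Q) \<boxtimes> q) \<cdot> ((\<one> Q \<boxtimes> q) \<boxtimes> \<one> T) \<cdot> ((q \<boxtimes> \<one> T) \<boxtimes> \<one> T))"
      by (intro is_epi_Comp) simp_all
    then show ?thesis by simp
  qed
  have qu: "q \<cdot> u = q \<cdot> v"
  proof -
    have "(q \<cdot> u) \<cdot> r R \<cdot> l (R \<otimes> E) = q \<cdot> (u \<cdot> r R \<cdot> l (R \<otimes> E))" using u by simp
    also have "\<dots> = (q \<cdot> W u) \<cdot> (n \<boxtimes> (\<one> R \<boxtimes> n))" using u by (simp add: W_unit[symmetric])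
    also have "\<dots> = (q \<cdot> v) \<cdot> r R \<cdot> l (R \<otimes> E)" unfolding qW using v by (simp add: W_unit)
    finally have "((q \<cdot> u) \<cdot> r R \<cdot> l (R \<otimes> E)) \<cdot> l' (R \<otimes> E) \<cdot> r' R
        = ((q \<cdot> v) \<cdot> r R \<cdot> l (R \<otimes> E)) \<cdot> l' (R \<otimes> E) \<cdot> r' R" by (rule arg_cong)
    then have "(q \<cdot> u) \<cdot> r R \<cdot> (l (R \<otimes> E) \<cdot> l' (R \<otimes> E)) \<cdot> r' R
        = (q \<cdot> v) \<cdot> r R \<cdot> (l (R \<otimes> E) \<cdot> l' (R \<otimes> E)) \<cdot> r' R" using u v by simp
    then show ?thesis using u v by (simp add: l_l' r_r')
  qed
  \<comment> \<open>Descend in the left variable, where \<open>W_right\<close> applies, and then in the right variable by \<open>W_left\<close>.\<close>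
  obtain w where w: "w \<in> hom C (Q \<otimes> T) Q" and wq: "w \<cdot> (q \<boxtimes> \<one> T) = q \<cdot> m"
  proof (rule is_coequalizer_ex[OF coequalizer_right[OF ce WuWv TD(1)], of Q "q \<cdot> m"])
    have "(q \<cdot> m) \<cdot> (W x \<boxtimes> \<one> T) = (q \<cdot> W x) \<cdot> (\<one> T \<boxtimes> ((\<one> R \<boxtimes> m) \<cdot> as R T T)) \<cdot> as T (R \<otimes> T) T"
      if "x \<in> hom C R T" for x
      using W_right[OF that] that by simp
    from this[OF u] this[OF v] show "(q \<cdot> m) \<cdot> (W u \<boxtimes> \<one> T) = (q \<cdot> m) \<cdot> (W v \<boxtimes> \<one> T)"
      unfolding qW by simp
  qed (use u in simp_all)
  have [simp]: "w \<in> Arr C" "Dom C w = Q \<otimes> T" "Cod C w = Q" using w by simp_all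
  obtain mQ where mQ: "mQ \<in> hom C (Q \<otimes> Q) Q" and mQq: "mQ \<cdot> (\<one> Q \<boxtimes> q) = w"
  proof (rule is_coequalizer_ex[OF coequalizer_left[OF ce WuWv Q(1)], of Q w])
    have *: "(w \<cdot> (\<one> Q \<boxtimes> W x)) \<cdot> (q \<boxtimes> \<one> (T \<otimes> (R \<otimes> T)))
        = (q \<cdot> W x) \<cdot> (m \<boxtimes> \<one> (R \<otimes> T)) \<cdot> as' T T (R \<otimes> T)"
      if "x \<in> hom C R T" for x
    proof -
      have "(w \<cdot> (\<one> Q \<boxtimes> W x)) \<cdot> (q \<boxtimes> \<one> (T \<otimes> (R \<otimes> T))) = (w \<cdot> (q \<boxtimes> \<one> T)) \<cdot> (\<one> T \<boxtimes> W x)"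
        using that by simp
      also have "\<dots> = q \<cdot> (m \<cdot> (\<one> T \<boxtimes> W x))" unfolding wq using that by simp
      also have "\<dots> = (q \<cdot> W x) \<cdot> (m \<boxtimes> \<one> (R \<otimes> T)) \<cdot> as' T T (R \<otimes> T)"
        unfolding W_left[OF that] using that by simp
      finally show ?thesis .
    qed
    show "w \<cdot> (\<one> Q \<boxtimes> W u) = w \<cdot> (\<one> Q \<boxtimes> W v)"
    proof (rule is_epiD[OF epi(2)[of "T \<otimes> (R \<otimes> T)"]])
      show "(w \<cdot> (\<one> Q \<boxtimes> W u)) \<cdot> (q \<boxtimes> \<one> (T \<otimes> (R \<otimes> T)))
        = (w \<cdot> (\<one> Q \<boxtimes> W v)) \<cdot> (q \<boxtimes> \<one> (T \<otimes> (R \<otimes> T)))"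
        unfolding *[OF u] *[OF v] qW ..
    qed (use u v in simp_all)
  qed (use u in simp_all)
  have [simp]: "mQ \<in> Arr C" "Dom C mQ = Q \<otimes> Q" "Cod C mQ = Q" using mQ by simp_all
  have mQqq: "mQ \<cdot> (q \<boxtimes> q) = q \<cdot> m"
  proof -
    have "mQ \<cdot> (q \<boxtimes> q) = (mQ \<cdot> (\<one> Q \<boxtimes> q)) \<cdot> (q \<boxtimes> \<one> T)" by simp
    then show ?thesis unfolding mQq wq .
  qed
  have Q_monoid: "is_monoid Q mQ (q \<cdot> n)"
  proof -
    have "mQ \<cdot> (mQ \<boxtimes> \<one> Q) = mQ \<cdot> (\<one> Q \<boxtimes> mQ) \<cdot> as Q Q Q"
    proof (rule is_epiD[OF epi_qqq])
      have "(mQ \<cdot> (mQ \<boxtimes> \<one> Q)) \<cdot> ((q \<boxtimes> q) \<boxtimes> q) = mQ \<cdot> ((mQ \<cdot> (q \<boxtimes> q)) \<boxtimes> q)" by simp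
      also have "\<dots> = mQ \<cdot> ((q \<cdot> m) \<boxtimes> q)" unfolding mQqq ..
      also have "\<dots> = (mQ \<cdot> (q \<boxtimes> q)) \<cdot> (m \<boxtimes> \<one> T)" by simp
      also have "\<dots> = q \<cdot> (m \<cdot> (m \<boxtimes> \<one> T))" unfolding mQqq by simp
      also have "\<dots> = (q \<cdot> m) \<cdot> (\<one> T \<boxtimes> m) \<cdot> as T T T" unfolding is_monoidD(8)[OF T] by simp
      also have "\<dots> = (mQ \<cdot> (q \<boxtimes> q)) \<cdot> (\<one> T \<boxtimes> m) \<cdot> as T T T" unfolding mQqq ..
      also have "\<dots> = mQ \<cdot> (q \<boxtimes> (q \<cdot> m)) \<cdot> as T T T" by simp
      also have "\<dots> = (mQ \<cdot> (\<one> Q \<boxtimes> mQ) \<cdot> as Q Q Q) \<cdot> ((q \<boxtimes> q) \<boxtimes> q)"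
        unfolding mQqq[symmetric] by (simp add: as_natural)
      finally show "(mQ \<cdot> (mQ \<boxtimes> \<one> Q)) \<cdot> ((q \<boxtimes> q) \<boxtimes> q)
        = (mQ \<cdot> (\<one> Q \<boxtimes> mQ) \<cdot> as Q Q Q) \<cdot> ((q \<boxtimes> q) \<boxtimes> q)" .
    qed simp_all
    moreover have "mQ \<cdot> ((q \<cdot> n) \<boxtimes> \<one> Q) = l Q"
    proof (rule is_epiD[OF epi(1)[of E]])
      have "(mQ \<cdot> ((q \<cdot> n) \<boxtimes> \<one> Q)) \<cdot> (\<one> E \<boxtimes> q) = (mQ \<cdot> (q \<boxtimes> q)) \<cdot> (n \<boxtimes> \<one> T)" by simp
      also have "\<dots> = q \<cdot> (m \<cdot> (n \<boxtimes> \<one> T))" unfolding mQqq by simp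
      also have "\<dots> = l Q \<cdot> (\<one> E \<boxtimes> q)" unfolding is_monoidD(9)[OF T] by (simp add: l_natural)
      finally show "(mQ \<cdot> ((q \<cdot> n) \<boxtimes> \<one> Q)) \<cdot> (\<one> E \<boxtimes> q) = l Q \<cdot> (\<one> E \<boxtimes> q)" .
    qed simp_all
    moreover have "mQ \<cdot> (\<one> Q \<boxtimes> (q \<cdot> n)) = r Q"
    proof (rule is_epiD[OF epi(2)[of E]])
      have "(mQ \<cdot> (\<one> Q \<boxtimes> (q \<cdot> n))) \<cdot> (q \<boxtimes> \<one> E) = (mQ \<cdot> (q \<boxtimes> q)) \<cdot> (\<one> T \<boxtimes> n)" by simp
      also have "\<dots> = q \<cdot> (m \<cdot> (\<one> T \<boxtimes> n))" unfolding mQqq by simp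
      also have "\<dots> = r Q \<cdot> (q \<boxtimes> \<one> E)" unfolding is_monoidD(10)[OF T] by (simp add: r_natural)
      finally show "(mQ \<cdot> (\<one> Q \<boxtimes> (q \<cdot> n))) \<cdot> (q \<boxtimes> \<one> E) = r Q \<cdot> (q \<boxtimes> \<one> E)" .
    qed simp_all
    ultimately show ?thesis by (simp add: is_monoid_def)
  qed
  have "\<exists>!h. is_monoid_mor Q mQ (q \<cdot> n) B m' n' h \<and> h \<cdot> q = f"
    if B: "is_monoid B m' n'" and f: "is_monoid_mor T m n B m' n' f" and fu: "f \<cdot> u = f \<cdot> v"
    for B m' n' f
  proof (rule ex_ex1I)
    note [simp] = is_monoidD(1-7)[OF B]
    have [simp]: "f \<in> Arr C" "Dom C f = T" "Cod C f = B" and fm: "f \<cdot> m = m' \<cdot> (f \<boxtimes> f)" and fn: "f \<cdot> n = n'"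
      using f by (simp_all add: is_monoid_mor_def)
    have fW: "f \<cdot> W x = m' \<cdot> (f \<boxtimes> (m' \<cdot> ((f \<cdot> x) \<boxtimes> f)))" if x: "x \<in> hom C R T" for x
    proof -
      have "f \<cdot> W x = (f \<cdot> m) \<cdot> (\<one> T \<boxtimes> (m \<cdot> (x \<boxtimes> \<one> T)))" using x by (simp add: W_def)
      also have "\<dots> = (m' \<cdot> (f \<boxtimes> f)) \<cdot> (\<one> T \<boxtimes> (m \<cdot> (x \<boxtimes> \<one> T)))" unfolding fm ..
      also have "\<dots> = m' \<cdot> (f \<boxtimes> ((f \<cdot> m) \<cdot> (x \<boxtimes> \<one> T)))" using x by simp
      also have "\<dots> = m' \<cdot> (f \<boxtimes> (m' \<cdot> ((f \<cdot> x) \<boxtimes> f)))" unfolding fm using x by simp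
      finally show ?thesis .
    qed
    have "f \<cdot> W u = f \<cdot> W v" unfolding fW[OF u] fW[OF v] fu ..
    then obtain h where h: "h \<in> hom C Q B" and hq: "h \<cdot> q = f"
      using is_coequalizer_ex[OF ce, of B f] u by auto
    have [simp]: "h \<in> Arr C" "Dom C h = Q" "Cod C h = B" using h by simp_all
    have "m' \<cdot> (h \<boxtimes> h) = h \<cdot> mQ"
    proof (rule is_epiD[OF epi_qq])
      have "(m' \<cdot> (h \<boxtimes> h)) \<cdot> (q \<boxtimes> q) = m' \<cdot> ((h \<cdot> q) \<boxtimes> (h \<cdot> q))" by simp
      also have "\<dots> = (h \<cdot> q) \<cdot> m" unfolding hq fm ..
      also have "\<dots> = h \<cdot> (q \<cdot> m)" by simp
      also have "\<dots> = (h \<cdot> mQ) \<cdot> (q \<boxtimes> q)" unfolding mQqq[symmetric] by simp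
      finally show "(m' \<cdot> (h \<boxtimes> h)) \<cdot> (q \<boxtimes> q) = (h \<cdot> mQ) \<cdot> (q \<boxtimes> q)" .
    qed simp_all
    moreover have "h \<cdot> q \<cdot> n = (h \<cdot> q) \<cdot> n" by simp
    then have "h \<cdot> q \<cdot> n = n'" unfolding hq fn .
    ultimately have "is_monoid_mor Q mQ (q \<cdot> n) B m' n' h \<and> h \<cdot> q = f"
      using h hq unfolding is_monoid_mor_def by blast
    then show "\<exists>h. is_monoid_mor Q mQ (q \<cdot> n) B m' n' h \<and> h \<cdot> q = f" by (rule exI)
  next
    fix h k
    assume h: "is_monoid_mor Q mQ (q \<cdot> n) B m' n' h \<and> h \<cdot> q = f"
      and k: "is_monoid_mor Q mQ (q \<cdot> n) B m' n' k \<and> k \<cdot> q = f"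
    show "h = k"
    proof (rule is_epiD[OF epi_q])
      show "h \<cdot> q = k \<cdot> q" using h k by argo
      show "h \<in> hom C (Cod C q) B" "k \<in> hom C (Cod C q) B"
        using h k unfolding is_monoid_mor_def by simp_all
    qed
  qed
  moreover have "is_monoid_mor T m n Q mQ (q \<cdot> n) q" using mQqq by (simp add: is_monoid_mor_def)
  ultimately show ?thesis using Q_monoid qu by blast
qed

end

section \<open>Calculating in a double category\<close>

context double_category
begin

sublocale V0: category "D0 D" by (rule category_D0)
sublocale V1: category "D1 D" by (rule category_D1)

abbreviation vcomp :: "'c \<Rightarrow> 'c \<Rightarrow> 'c" (infixr "\<bullet>" 55) where "\<beta> \<bullet> \<alpha> \<equiv> \<beta> \<cdot>\<^bsub>D1 D\<^esub> \<alpha>"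
abbreviation so :: "'h \<Rightarrow> 'o" where "so \<equiv> fobj (src D)"
abbreviation to :: "'h \<Rightarrow> 'o" where "to \<equiv> fobj (tgt D)"
abbreviation sa :: "'c \<Rightarrow> 'v" where "sa \<equiv> farr (src D)"
abbreviation ta :: "'c \<Rightarrow> 'v" where "ta \<equiv> farr (tgt D)"
abbreviation U :: "'o \<Rightarrow> 'h" where "U \<equiv> hunit D"
abbreviation Ua :: "'v \<Rightarrow> 'c" where "Ua \<equiv> farr (unit_ftor D)"
abbreviation I0 :: "'o \<Rightarrow> 'v" where "I0 \<equiv> Ident (D0 D)"
abbreviation I1 :: "'h \<Rightarrow> 'c" where "I1 \<equiv> id2 D"
abbreviation (input) Obj0 :: "'o set" where "Obj0 \<equiv> Obj (D0 D)"
abbreviation (input) Obj1 :: "'h set" where "Obj1 \<equiv> Obj (D1 D)"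
abbreviation (input) Arr1 :: "'c set" where "Arr1 \<equiv> Arr (D1 D)"
abbreviation (input) Dom1 :: "'c \<Rightarrow> 'h" where "Dom1 \<equiv> Dom (D1 D)"
abbreviation (input) Cod1 :: "'c \<Rightarrow> 'h" where "Cod1 \<equiv> Cod (D1 D)"
abbreviation (input) hom1 :: "'h \<Rightarrow> 'h \<Rightarrow> 'c set" where "hom1 \<equiv> hom (D1 D)"
abbreviation (input) vcomp0 :: "'v \<Rightarrow> 'v \<Rightarrow> 'v" (infixr "\<circ>\<^sub>0" 55) where "g \<circ>\<^sub>0 f \<equiv> g \<cdot>\<^bsub>D0 D\<^esub> f"

lemma src_simps [simp]:
  "M \<in> Obj1 \<Longrightarrow> so M \<in> Obj0"
  "\<alpha> \<in> Arr1 \<Longrightarrow> sa \<alpha> \<in> Arr (D0 D)"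
  "\<alpha> \<in> Arr1 \<Longrightarrow> Dom (D0 D) (sa \<alpha>) = so (Dom1 \<alpha>)"
  "\<alpha> \<in> Arr1 \<Longrightarrow> Cod (D0 D) (sa \<alpha>) = so (Cod1 \<alpha>)"
  "M \<in> Obj1 \<Longrightarrow> sa (I1 M) = I0 (so M)"
  "\<lbrakk>\<alpha> \<in> Arr1; \<beta> \<in> Arr1; Dom1 \<beta> = Cod1 \<alpha>\<rbrakk>
    \<Longrightarrow> sa (\<beta> \<bullet> \<alpha>) = sa \<beta> \<circ>\<^sub>0 sa \<alpha>"
  using is_functor.fobj_in[OF functor_src] is_functor.farr_in[OF functor_src]
    is_functor.farr_Ident[OF functor_src] is_functor.farr_Comp[OF functor_src] by simp_all

lemma tgt_simps [simp]:
  "M \<in> Obj1 \<Longrightarrow> to M \<in> Obj0"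
  "\<alpha> \<in> Arr1 \<Longrightarrow> ta \<alpha> \<in> Arr (D0 D)"
  "\<alpha> \<in> Arr1 \<Longrightarrow> Dom (D0 D) (ta \<alpha>) = to (Dom1 \<alpha>)"
  "\<alpha> \<in> Arr1 \<Longrightarrow> Cod (D0 D) (ta \<alpha>) = to (Cod1 \<alpha>)"
  "M \<in> Obj1 \<Longrightarrow> ta (I1 M) = I0 (to M)"
  "\<lbrakk>\<alpha> \<in> Arr1; \<beta> \<in> Arr1; Dom1 \<beta> = Cod1 \<alpha>\<rbrakk>
    \<Longrightarrow> ta (\<beta> \<bullet> \<alpha>) = ta \<beta> \<circ>\<^sub>0 ta \<alpha>"
  using is_functor.fobj_in[OF functor_tgt] is_functor.farr_in[OF functor_tgt]
    is_functor.farr_Ident[OF functor_tgt] is_functor.farr_Comp[OF functor_tgt] by simp_all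

lemma unit_simps [simp]:
  "X \<in> Obj0 \<Longrightarrow> U X \<in> Obj1"
  "X \<in> Obj0 \<Longrightarrow> so (U X) = X"
  "X \<in> Obj0 \<Longrightarrow> to (U X) = X"
  "f \<in> Arr (D0 D) \<Longrightarrow> Ua f \<in> Arr1"
  "f \<in> Arr (D0 D) \<Longrightarrow> Dom1 (Ua f) = U (Dom (D0 D) f)"
  "f \<in> Arr (D0 D) \<Longrightarrow> Cod1 (Ua f) = U (Cod (D0 D) f)"
  "f \<in> Arr (D0 D) \<Longrightarrow> sa (Ua f) = f"
  "f \<in> Arr (D0 D) \<Longrightarrow> ta (Ua f) = f"
  "X \<in> Obj0 \<Longrightarrow> Ua (I0 X) = I1 (U X)"
  using is_functor.fobj_in[OF functor_unit] is_functor.farr_in[OF functor_unit]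
    is_functor.farr_Ident[OF functor_unit] src_unit tgt_unit src_unit_arr tgt_unit_arr by simp_all

lemma Ua_Comp: "\<lbrakk>f \<in> Arr (D0 D); g \<in> Arr (D0 D); Dom (D0 D) g = Cod (D0 D) f\<rbrakk>
    \<Longrightarrow> Ua (g \<circ>\<^sub>0 f) = Ua g \<bullet> Ua f"
  using is_functor.farr_Comp[OF functor_unit] by simp

lemma pullback_simps:
  "Obj (pullback_cat A B F G) = {(x, y). x \<in> Obj A \<and> y \<in> Obj B \<and> fobj F x = fobj G y}"
  "Arr (pullback_cat A B F G) = {(f, g). f \<in> Arr A \<and> g \<in> Arr B \<and> farr F f = farr G g}"
  "Dom (pullback_cat A B F G) (f, g) = (Dom A f, Dom B g)"
  "Cod (pullback_cat A B F G) (f, g) = (Cod A f, Cod B g)"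
  "Ident (pullback_cat A B F G) (x, y) = (Ident A x, Ident B y)"
  "(f', g') \<cdot>\<^bsub>pullback_cat A B F G\<^esub> (f, g) = (f' \<cdot>\<^bsub>A\<^esub> f, g' \<cdot>\<^bsub>B\<^esub> g)"
  by (simp_all add: pullback_cat_def prod_cat_def)

lemma hcomp_obj_simps [simp]:
  assumes "M \<in> Obj1" "N \<in> Obj1" "so M = to N"
  shows "M \<odot> N \<in> Obj1" "so (M \<odot> N) = so N" "to (M \<odot> N) = to M"
  using is_functor.fobj_in[OF functor_hcomp, of "(M, N)"] src_hcomp[of M N] tgt_hcomp[of M N] assms
  by (simp_all add: pullback_simps hcomp_obj_def)

lemma hcomp_arr_simps [simp]:
  assumes "\<alpha> \<in> Arr1" "\<beta> \<in> Arr1" "sa \<alpha> = ta \<beta>"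
  shows "\<alpha> \<star> \<beta> \<in> Arr1" "Dom1 (\<alpha> \<star> \<beta>) = Dom1 \<alpha> \<odot> Dom1 \<beta>"
    "Cod1 (\<alpha> \<star> \<beta>) = Cod1 \<alpha> \<odot> Cod1 \<beta>"
    "sa (\<alpha> \<star> \<beta>) = sa \<beta>" "ta (\<alpha> \<star> \<beta>) = ta \<alpha>"
  using is_functor.farr_in[OF functor_hcomp, of "(\<alpha>, \<beta>)"] src_hcomp_arr[of \<alpha> \<beta>] tgt_hcomp_arr[of \<alpha> \<beta>] assms
  by (simp_all add: pullback_simps hcomp_obj_def hcomp_arr_def)

lemma hcomp_id: "\<lbrakk>M \<in> Obj1; N \<in> Obj1; so M = to N\<rbrakk> \<Longrightarrow> I1 M \<star> I1 N = I1 (M \<odot> N)"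
  using is_functor.farr_Ident[OF functor_hcomp, of "(M, N)"]
  by (simp add: pullback_simps hcomp_obj_def hcomp_arr_def)

lemma interchange [simp]:
  assumes "\<alpha> \<in> Arr1" "\<beta> \<in> Arr1" "\<alpha>' \<in> Arr1" "\<beta>' \<in> Arr1"
    "Dom1 \<alpha>' = Cod1 \<alpha>" "Dom1 \<beta>' = Cod1 \<beta>" "sa \<alpha> = ta \<beta>" "sa \<alpha>' = ta \<beta>'"
  shows "(\<alpha>' \<star> \<beta>') \<bullet> (\<alpha> \<star> \<beta>) = (\<alpha>' \<bullet> \<alpha>) \<star> (\<beta>' \<bullet> \<beta>)"
  using is_functor.farr_Comp[OF functor_hcomp, of "(\<alpha>, \<beta>)" "(\<alpha>', \<beta>')"] assms
  by (simp add: pullback_simps hcomp_obj_def hcomp_arr_def)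

lemma interchange_chain [simp]:
  assumes "\<alpha> \<in> Arr1" "\<beta> \<in> Arr1" "\<alpha>' \<in> Arr1" "\<beta>' \<in> Arr1"
    "Dom1 \<alpha>' = Cod1 \<alpha>" "Dom1 \<beta>' = Cod1 \<beta>" "sa \<alpha> = ta \<beta>" "sa \<alpha>' = ta \<beta>'"
    "\<gamma> \<in> Arr1" "Cod1 \<gamma> = Dom1 \<alpha> \<odot> Dom1 \<beta>"
  shows "(\<alpha>' \<star> \<beta>') \<bullet> (\<alpha> \<star> \<beta>) \<bullet> \<gamma> = ((\<alpha>' \<bullet> \<alpha>) \<star> (\<beta>' \<bullet> \<beta>)) \<bullet> \<gamma>"
  by (rule V1.Comp_left_cancel_chain[OF interchange]) (use assms in simp_all)

lemma globular_sa_ta: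
  assumes "globular D \<alpha>"
  shows "sa \<alpha> = I0 (so (Dom1 \<alpha>))" "ta \<alpha> = I0 (to (Dom1 \<alpha>))"
proof -
  have \<alpha>: "\<alpha> \<in> Arr1" using assms by (simp add: globular_def)
  obtain X Y where X: "X \<in> Obj0" "sa \<alpha> = I0 X" and Y: "Y \<in> Obj0" "ta \<alpha> = I0 Y"
    using assms by (auto simp: globular_def)
  have "so (Dom1 \<alpha>) = X" using src_simps(3)[OF \<alpha>] X by simp
  moreover have "to (Dom1 \<alpha>) = Y" using tgt_simps(3)[OF \<alpha>] Y by simp
  ultimately show "sa \<alpha> = I0 (so (Dom1 \<alpha>))" "ta \<alpha> = I0 (to (Dom1 \<alpha>))" using X Y by simp_all
qed

text \<open>
  Inverting a globular isomorphism in the category of all 2-cells stays within the globular ones.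
\<close>

lemma inv_globular:
  assumes "is_iso (D1 D) \<alpha>" "globular D \<alpha>"
  shows "sa (inv_arr (D1 D) \<alpha>) = I0 (so (Dom1 \<alpha>))" "ta (inv_arr (D1 D) \<alpha>) = I0 (to (Dom1 \<alpha>))"
proof -
  have [simp]: "\<alpha> \<in> Arr1" using assms by (simp add: globular_def)
  let ?\<beta> = "inv_arr (D1 D) \<alpha>"
  have [simp]: "?\<beta> \<in> Arr1" "Dom1 ?\<beta> = Cod1 \<alpha>" "Cod1 ?\<beta> = Dom1 \<alpha>"
    using inv_arr(1)[OF assms(1)] by simp_all
  have e: "so (Cod1 \<alpha>) = so (Dom1 \<alpha>)" "to (Cod1 \<alpha>) = to (Dom1 \<alpha>)"
    using src_simps(4)[of \<alpha>] tgt_simps(4)[of \<alpha>] by (simp_all add: globular_sa_ta[OF assms(2)])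
  show "sa ?\<beta> = I0 (so (Dom1 \<alpha>))"
    using arg_cong[OF inv_arr(2)[OF assms(1)], of sa] by (simp add: globular_sa_ta[OF assms(2)] e)
  show "ta ?\<beta> = I0 (to (Dom1 \<alpha>))"
    using arg_cong[OF inv_arr(2)[OF assms(1)], of ta] by (simp add: globular_sa_ta[OF assms(2)] e)
qed

definition hassoc' :: "'h \<Rightarrow> 'h \<Rightarrow> 'h \<Rightarrow> 'c" where
  "hassoc' M N P = inv_arr (D1 D) (hassoc D M N P)"
definition lunit' :: "'h \<Rightarrow> 'c" where "lunit' M = inv_arr (D1 D) (lunit D M)"
definition runit' :: "'h \<Rightarrow> 'c" where "runit' M = inv_arr (D1 D) (runit D M)"

lemma hassoc_simps [simp]:
  assumes "M \<in> Obj1" "N \<in> Obj1" "P \<in> Obj1" "so M = to N" "so N = to P"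
  shows "hassoc D M N P \<in> Arr1" "Dom1 (hassoc D M N P) = (M \<odot> N) \<odot> P"
    "Cod1 (hassoc D M N P) = M \<odot> (N \<odot> P)"
    "sa (hassoc D M N P) = I0 (so P)" "ta (hassoc D M N P) = I0 (to M)"
    "hassoc' M N P \<in> Arr1" "Cod1 (hassoc' M N P) = (M \<odot> N) \<odot> P"
    "Dom1 (hassoc' M N P) = M \<odot> (N \<odot> P)"
    "sa (hassoc' M N P) = I0 (so P)" "ta (hassoc' M N P) = I0 (to M)"
    "hassoc D M N P \<bullet> hassoc' M N P = I1 (M \<odot> (N \<odot> P))"
    "hassoc' M N P \<bullet> hassoc D M N P = I1 ((M \<odot> N) \<odot> P)"
  using hassoc_in[OF assms] inv_arr[of "D1 D" "hassoc D M N P"] assms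
  by (simp_all add: globular_sa_ta inv_globular hassoc'_def)

lemma lunit_simps [simp]:
  assumes "M \<in> Obj1"
  shows "lunit D M \<in> Arr1" "Dom1 (lunit D M) = U (to M) \<odot> M" "Cod1 (lunit D M) = M"
    "sa (lunit D M) = I0 (so M)" "ta (lunit D M) = I0 (to M)"
    "lunit' M \<in> Arr1" "Cod1 (lunit' M) = U (to M) \<odot> M" "Dom1 (lunit' M) = M"
    "sa (lunit' M) = I0 (so M)" "ta (lunit' M) = I0 (to M)"
    "lunit D M \<bullet> lunit' M = I1 M" "lunit' M \<bullet> lunit D M = I1 (U (to M) \<odot> M)"
  using lunit_in[OF assms] inv_arr[of "D1 D" "lunit D M"] assms
  by (simp_all add: globular_sa_ta inv_globular lunit'_def)

lemma runit_simps [simp]: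
  assumes "M \<in> Obj1"
  shows "runit D M \<in> Arr1" "Dom1 (runit D M) = M \<odot> U (so M)" "Cod1 (runit D M) = M"
    "sa (runit D M) = I0 (so M)" "ta (runit D M) = I0 (to M)"
    "runit' M \<in> Arr1" "Cod1 (runit' M) = M \<odot> U (so M)" "Dom1 (runit' M) = M"
    "sa (runit' M) = I0 (so M)" "ta (runit' M) = I0 (to M)"
    "runit D M \<bullet> runit' M = I1 M" "runit' M \<bullet> runit D M = I1 (M \<odot> U (so M))"
  using runit_in[OF assms] inv_arr[of "D1 D" "runit D M"] assms
  by (simp_all add: globular_sa_ta inv_globular runit'_def)

lemma hassoc_nat:
  assumes "\<alpha> \<in> Arr1" "\<beta> \<in> Arr1" "\<gamma> \<in> Arr1" "sa \<alpha> = ta \<beta>" "sa \<beta> = ta \<gamma>"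
    "Cod1 \<alpha> = M" "Cod1 \<beta> = N" "Cod1 \<gamma> = P"
  shows "hassoc D M N P \<bullet> ((\<alpha> \<star> \<beta>) \<star> \<gamma>)
    = (\<alpha> \<star> (\<beta> \<star> \<gamma>)) \<bullet> hassoc D (Dom1 \<alpha>) (Dom1 \<beta>) (Dom1 \<gamma>)"
  using assms by (intro hassoc_natural) simp_all

lemma lunit_nat:
  assumes "\<alpha> \<in> Arr1" "Cod1 \<alpha> = M" "ta \<alpha> = f"
  shows "lunit D M \<bullet> (Ua f \<star> \<alpha>) = \<alpha> \<bullet> lunit D (Dom1 \<alpha>)"
  using lunit_natural[of \<alpha> "Dom1 \<alpha>" M] assms by simp

lemma runit_nat:
  assumes "\<alpha> \<in> Arr1" "Cod1 \<alpha> = M" "sa \<alpha> = f"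
  shows "runit D M \<bullet> (\<alpha> \<star> Ua f) = \<alpha> \<bullet> runit D (Dom1 \<alpha>)"
  using runit_natural[of \<alpha> "Dom1 \<alpha>" M] assms by simp

lemma iso_cancel_right:
  assumes "\<alpha> \<bullet> \<gamma> = \<beta> \<bullet> \<gamma>" "\<gamma> \<in> hom1 M N" "\<gamma>' \<in> hom1 N M" "\<gamma> \<bullet> \<gamma>' = I1 N"
    "\<alpha> \<in> Arr1" "Dom1 \<alpha> = N" "\<beta> \<in> Arr1" "Dom1 \<beta> = N"
  shows "\<alpha> = \<beta>"
proof -
  have "(\<alpha> \<bullet> \<gamma>) \<bullet> \<gamma>' = (\<beta> \<bullet> \<gamma>) \<bullet> \<gamma>'" using assms(1) by simp
  then show ?thesis using assms(2-) by simp
qed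

lemma iso_cancel_left:
  assumes "\<gamma> \<bullet> \<alpha> = \<gamma> \<bullet> \<beta>" "\<gamma> \<in> hom1 M N" "\<gamma>' \<in> hom1 N M" "\<gamma>' \<bullet> \<gamma> = I1 M"
    "\<alpha> \<in> Arr1" "Cod1 \<alpha> = M" "\<beta> \<in> Arr1" "Cod1 \<beta> = M"
  shows "\<alpha> = \<beta>"
proof -
  have "\<gamma>' \<bullet> (\<gamma> \<bullet> \<alpha>) = \<gamma>' \<bullet> (\<gamma> \<bullet> \<beta>)" using assms(1) by simp
  then have "(\<gamma>' \<bullet> \<gamma>) \<bullet> \<alpha> = (\<gamma>' \<bullet> \<gamma>) \<bullet> \<beta>" using assms(2,3,5-8) by simp
  then show ?thesis using assms(4-) by simp
qed

text \<open>
  Whiskering with a unit is faithful because the unit isomorphism is natural. Kelly's argument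
  proves the next coherence laws after such a whiskering, where pentagon and triangle apply.
\<close>

lemma unit_whisker_left_cancel:
  assumes eq: "I1 (U X) \<star> \<alpha> = I1 (U X) \<star> \<beta>" and X [simp]: "X \<in> Obj0"
    and \<alpha>: "\<alpha> \<in> hom1 M N" "ta \<alpha> = I0 X" and \<beta>: "\<beta> \<in> hom1 M N" "ta \<beta> = I0 X"
  shows "\<alpha> = \<beta>"
proof -
  have M: "M \<in> Obj1" using \<alpha> by auto
  have "lunit D N \<bullet> (I1 (U X) \<star> \<alpha>) = \<alpha> \<bullet> lunit D M"
    using lunit_nat[of \<alpha> N "I0 X"] \<alpha> by simp
  moreover have "lunit D N \<bullet> (I1 (U X) \<star> \<beta>) = \<beta> \<bullet> lunit D M"
    using lunit_nat[of \<beta> N "I0 X"] \<beta> by simp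
  ultimately have "\<alpha> \<bullet> lunit D M = \<beta> \<bullet> lunit D M" using eq by simp
  then show ?thesis
    by (rule iso_cancel_right[where \<gamma>' = "lunit' M"]) (use M \<alpha> \<beta> in simp_all)
qed

lemma unit_whisker_right_cancel:
  assumes eq: "\<alpha> \<star> I1 (U X) = \<beta> \<star> I1 (U X)" and X [simp]: "X \<in> Obj0"
    and \<alpha>: "\<alpha> \<in> hom1 M N" "sa \<alpha> = I0 X" and \<beta>: "\<beta> \<in> hom1 M N" "sa \<beta> = I0 X"
  shows "\<alpha> = \<beta>"
proof -
  have M: "M \<in> Obj1" using \<alpha> by auto
  have "runit D N \<bullet> (\<alpha> \<star> I1 (U X)) = \<alpha> \<bullet> runit D M"
    using runit_nat[of \<alpha> N "I0 X"] \<alpha> by simp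
  moreover have "runit D N \<bullet> (\<beta> \<star> I1 (U X)) = \<beta> \<bullet> runit D M"
    using runit_nat[of \<beta> N "I0 X"] \<beta> by simp
  ultimately have "\<alpha> \<bullet> runit D M = \<beta> \<bullet> runit D M" using eq by simp
  then show ?thesis
    by (rule iso_cancel_right[where \<gamma>' = "runit' M"]) (use M \<alpha> \<beta> in simp_all)
qed

lemma lunit_hcomp:
  assumes M [simp]: "M \<in> Obj1" and N [simp]: "N \<in> Obj1" and MN [simp]: "so M = to N"
  shows "lunit D (M \<odot> N) \<bullet> hassoc D (U (to M)) M N = lunit D M \<star> I1 N"
proof (rule unit_whisker_left_cancel[where X = "to M"])
  let ?E = "U (to M)"
  let ?i = "hassoc D ?E (?E \<odot> M) N \<bullet> (hassoc D ?E ?E M \<star> I1 N)"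
  let ?i' = "(hassoc' ?E ?E M \<star> I1 N) \<bullet> hassoc' ?E (?E \<odot> M) N"
  have "(I1 ?E \<star> (lunit D (M \<odot> N) \<bullet> hassoc D ?E M N)) \<bullet> ?i
      = (I1 ?E \<star> lunit D (M \<odot> N)) \<bullet> (I1 ?E \<star> hassoc D ?E M N) \<bullet> ?i"
    by simp
  also have "\<dots> = (I1 ?E \<star> lunit D (M \<odot> N)) \<bullet> hassoc D ?E ?E (M \<odot> N) \<bullet> hassoc D (?E \<odot> ?E) M N"
    using pentagon[of ?E ?E M N] by simp
  also have "\<dots> = ((I1 ?E \<star> lunit D (M \<odot> N)) \<bullet> hassoc D ?E ?E (M \<odot> N)) \<bullet> hassoc D (?E \<odot> ?E) M N"
    by simp
  also have "\<dots> = (runit D ?E \<star> (I1 M \<star> I1 N)) \<bullet> hassoc D (?E \<odot> ?E) M N"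
    using triangle[of ?E "M \<odot> N"] by (simp add: hcomp_id)
  also have "\<dots> = hassoc D ?E M N \<bullet> ((runit D ?E \<star> I1 M) \<star> I1 N)"
    by (subst hassoc_nat) simp_all
  also have "\<dots> = hassoc D ?E M N \<bullet> (((I1 ?E \<star> lunit D M) \<bullet> hassoc D ?E ?E M) \<star> I1 N)"
    using triangle[of ?E M] by simp
  also have "\<dots> = (hassoc D ?E M N \<bullet> ((I1 ?E \<star> lunit D M) \<star> I1 N)) \<bullet> (hassoc D ?E ?E M \<star> I1 N)"
    by simp
  also have "\<dots> = (I1 ?E \<star> (lunit D M \<star> I1 N)) \<bullet> ?i"
    by (subst hassoc_nat) simp_all
  finally show "I1 ?E \<star> (lunit D (M \<odot> N) \<bullet> hassoc D ?E M N) = I1 ?E \<star> (lunit D M \<star> I1 N)"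
  proof (rule iso_cancel_right[where \<gamma>' = ?i'])
    have "?i \<bullet> ?i' = hassoc D ?E (?E \<odot> M) N
        \<bullet> (((hassoc D ?E ?E M \<bullet> hassoc' ?E ?E M) \<star> I1 N) \<bullet> hassoc' ?E (?E \<odot> M) N)"
      by (simp del: hassoc_simps(11))
    then show "?i \<bullet> ?i' = I1 (?E \<odot> (?E \<odot> M) \<odot> N)" by (simp add: hcomp_id)
  qed simp_all
qed simp_all

lemma runit_hcomp:
  assumes M [simp]: "M \<in> Obj1" and N [simp]: "N \<in> Obj1" and MN [simp]: "so M = to N"
  shows "(I1 M \<star> runit D N) \<bullet> hassoc D M N (U (so N)) = runit D (M \<odot> N)"
proof (rule unit_whisker_right_cancel[where X = "so N"])
  let ?E = "U (so N)"
  have "hassoc D M N ?E \<bullet> (((I1 M \<star> runit D N) \<bullet> hassoc D M N ?E) \<star> I1 ?E)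
      = (hassoc D M N ?E \<bullet> ((I1 M \<star> runit D N) \<star> I1 ?E)) \<bullet> (hassoc D M N ?E \<star> I1 ?E)"
    by simp
  also have "\<dots> = (I1 M \<star> (runit D N \<star> I1 ?E)) \<bullet> hassoc D M (N \<odot> ?E) ?E \<bullet> (hassoc D M N ?E \<star> I1 ?E)"
    by (subst hassoc_nat) simp_all
  also have "\<dots> = (I1 M \<star> ((I1 N \<star> lunit D ?E) \<bullet> hassoc D N ?E ?E)) \<bullet> hassoc D M (N \<odot> ?E) ?E
      \<bullet> (hassoc D M N ?E \<star> I1 ?E)"
    using triangle[of N ?E] by simp
  also have "\<dots> = (I1 M \<star> (I1 N \<star> lunit D ?E)) \<bullet> ((I1 M \<star> hassoc D N ?E ?E) \<bullet> hassoc D M (N \<odot> ?E) ?E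
      \<bullet> (hassoc D M N ?E \<star> I1 ?E))"
    by simp
  also have "\<dots> = ((I1 M \<star> (I1 N \<star> lunit D ?E)) \<bullet> hassoc D M N (?E \<odot> ?E)) \<bullet> hassoc D (M \<odot> N) ?E ?E"
    using pentagon[of M N ?E ?E] by simp
  also have "\<dots> = (hassoc D M N ?E \<bullet> ((I1 M \<star> I1 N) \<star> lunit D ?E)) \<bullet> hassoc D (M \<odot> N) ?E ?E"
    by (subst hassoc_nat) simp_all
  also have "\<dots> = hassoc D M N ?E \<bullet> ((I1 (M \<odot> N) \<star> lunit D ?E) \<bullet> hassoc D (M \<odot> N) ?E ?E)"
    by (simp add: hcomp_id)
  also have "\<dots> = hassoc D M N ?E \<bullet> (runit D (M \<odot> N) \<star> I1 ?E)"
    using triangle[of "M \<odot> N" ?E] by simp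
  finally show "((I1 M \<star> runit D N) \<bullet> hassoc D M N ?E) \<star> I1 ?E = runit D (M \<odot> N) \<star> I1 ?E"
    by (rule iso_cancel_left[where \<gamma>' = "hassoc' M N ?E"]) simp_all
qed simp_all

text \<open>
  Naturality of \<open>lunit\<close> at itself identifies \<open>1 \<star> lunit\<close> with the \<open>lunit\<close> of \<open>1 \<odot> 1\<close>; the triangle and
  \<open>lunit_hcomp\<close> then compare both unit isomorphisms after whiskering.
\<close>

lemma lunit_eq_runit:
  assumes X [simp]: "X \<in> Obj0"
  shows "lunit D (U X) = runit D (U X)"
proof (rule unit_whisker_right_cancel[where X = X])
  let ?E = "U X"
  have "lunit D ?E \<bullet> (I1 ?E \<star> lunit D ?E) = lunit D ?E \<bullet> lunit D (?E \<odot> ?E)"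
    using lunit_nat[of "lunit D ?E" ?E "I0 X"] by simp
  then have "I1 ?E \<star> lunit D ?E = lunit D (?E \<odot> ?E)"
    by (rule iso_cancel_left[where \<gamma>' = "lunit' ?E"]) simp_all
  then show "lunit D ?E \<star> I1 ?E = runit D ?E \<star> I1 ?E"
    using lunit_hcomp[of ?E ?E] triangle[of ?E ?E] by simp
qed simp_all

section \<open>Cartesian 2-cells, companions and conjoints\<close>

text \<open>
  Cartesian arrows of the functor \<open>\<langle>src, tgt\<rangle>\<close>, with its two components separated.
\<close>

definition cart :: "'c \<Rightarrow> bool" where
  "cart \<phi> \<longleftrightarrow> \<phi> \<in> Arr1 \<and>
    (\<forall>\<psi> \<in> Arr1. \<forall>v w. Cod1 \<psi> = Cod1 \<phi> \<and>
      v \<in> hom (D0 D) (so (Dom1 \<psi>)) (so (Dom1 \<phi>)) \<and>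
      w \<in> hom (D0 D) (to (Dom1 \<psi>)) (to (Dom1 \<phi>)) \<and>
      sa \<phi> \<circ>\<^sub>0 v = sa \<psi> \<and> ta \<phi> \<circ>\<^sub>0 w = ta \<psi> \<longrightarrow>
      (\<exists>!\<chi>. \<chi> \<in> hom1 (Dom1 \<psi>) (Dom1 \<phi>) \<and> sa \<chi> = v \<and> ta \<chi> = w \<and> \<phi> \<bullet> \<chi> = \<psi>))"

lemma fibrant_cart:
  assumes fib: "fibrant D" and B: "B \<in> Obj1"
    and f: "f \<in> Arr (D0 D)" "Cod (D0 D) f = so B" and g: "g \<in> Arr (D0 D)" "Cod (D0 D) g = to B"
  obtains \<phi> where "cart \<phi>" "\<phi> \<in> Arr1" "Cod1 \<phi> = B" "sa \<phi> = f" "ta \<phi> = g"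
    "so (Dom1 \<phi>) = Dom (D0 D) f" "to (Dom1 \<phi>) = Dom (D0 D) g"
proof -
  let ?P = "pair_ftor (src D) (tgt D)" and ?D0 = "prod_cat (D0 D) (D0 D)"
  have "(f, g) \<in> Arr ?D0" "Cod ?D0 (f, g) = fobj ?P B"
    using f g by (simp_all add: prod_cat_def pair_ftor_def)
  then obtain \<phi> where \<phi>: "is_cartesian (D1 D) ?D0 ?P \<phi>" "Cod1 \<phi> = B" "farr ?P \<phi> = (f, g)"
    using fib B unfolding fibrant_def is_fibration_def by blast
  have \<phi>D [simp]: "\<phi> \<in> Arr1" "sa \<phi> = f" "ta \<phi> = g"
    using \<phi> by (simp_all add: is_cartesian_def pair_ftor_def)
  have "cart \<phi>"
    unfolding cart_def
  proof (intro conjI ballI allI impI)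
    fix \<psi> v w
    assume \<psi>: "\<psi> \<in> Arr1"
      "Cod1 \<psi> = Cod1 \<phi> \<and>
      v \<in> hom (D0 D) (so (Dom1 \<psi>)) (so (Dom1 \<phi>)) \<and>
      w \<in> hom (D0 D) (to (Dom1 \<psi>)) (to (Dom1 \<phi>)) \<and>
      sa \<phi> \<circ>\<^sub>0 v = sa \<psi> \<and> ta \<phi> \<circ>\<^sub>0 w = ta \<psi>"
    have "(v, w) \<in> hom ?D0 (fobj ?P (Dom1 \<psi>)) (fobj ?P (Dom1 \<phi>))"
      "farr ?P \<phi> \<cdot>\<^bsub>?D0\<^esub> (v, w) = farr ?P \<psi>"
      using \<psi> by (simp_all add: prod_cat_def pair_ftor_def)
    with \<phi>(1) \<psi> have "\<exists>!\<chi>. \<chi> \<in> hom1 (Dom1 \<psi>) (Dom1 \<phi>) \<and>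
        farr ?P \<chi> = (v, w) \<and> \<phi> \<bullet> \<chi> = \<psi>"
      unfolding is_cartesian_def by blast
    then show "\<exists>!\<chi>. \<chi> \<in> hom1 (Dom1 \<psi>) (Dom1 \<phi>) \<and> sa \<chi> = v \<and> ta \<chi> = w \<and> \<phi> \<bullet> \<chi> = \<psi>"
      by (simp add: pair_ftor_def)
  qed simp
  moreover have "so (Dom1 \<phi>) = Dom (D0 D) f" "to (Dom1 \<phi>) = Dom (D0 D) g"
    using src_simps(3)[OF \<phi>D(1)] tgt_simps(3)[OF \<phi>D(1)] by simp_all
  ultimately show ?thesis using that[of \<phi>] \<phi> by simp
qed

lemma cart_ex1:
  assumes "cart \<phi>" "\<psi> \<in> Arr1" "Cod1 \<psi> = Cod1 \<phi>"
    "v \<in> hom (D0 D) (so (Dom1 \<psi>)) (so (Dom1 \<phi>))"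
    "w \<in> hom (D0 D) (to (Dom1 \<psi>)) (to (Dom1 \<phi>))"
    "sa \<phi> \<circ>\<^sub>0 v = sa \<psi>" "ta \<phi> \<circ>\<^sub>0 w = ta \<psi>"
  shows "\<exists>!\<chi>. \<chi> \<in> hom1 (Dom1 \<psi>) (Dom1 \<phi>) \<and> sa \<chi> = v \<and> ta \<chi> = w \<and> \<phi> \<bullet> \<chi> = \<psi>"
  using assms unfolding cart_def by blast

lemma cart_ex:
  assumes "cart \<phi>" "\<psi> \<in> Arr1" "Cod1 \<psi> = Cod1 \<phi>"
    "v \<in> hom (D0 D) (so (Dom1 \<psi>)) (so (Dom1 \<phi>))"
    "w \<in> hom (D0 D) (to (Dom1 \<psi>)) (to (Dom1 \<phi>))"
    "sa \<phi> \<circ>\<^sub>0 v = sa \<psi>" "ta \<phi> \<circ>\<^sub>0 w = ta \<psi>"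
  obtains \<chi> where "\<chi> \<in> Arr1" "Dom1 \<chi> = Dom1 \<psi>" "Cod1 \<chi> = Dom1 \<phi>"
    "sa \<chi> = v" "ta \<chi> = w" "\<phi> \<bullet> \<chi> = \<psi>"
  using cart_ex1[OF assms] that by auto

lemma cart_unique:
  assumes \<phi>: "cart \<phi>" and \<chi>: "\<chi> \<in> Arr1" "Cod1 \<chi> = Dom1 \<phi>"
    and \<chi>': "\<chi>' \<in> Arr1" "Dom1 \<chi>' = Dom1 \<chi>" "Cod1 \<chi>' = Dom1 \<phi>"
    and eq: "sa \<chi> = sa \<chi>'" "ta \<chi> = ta \<chi>'" "\<phi> \<bullet> \<chi> = \<phi> \<bullet> \<chi>'"
  shows "\<chi> = \<chi>'"
proof -
  have [simp]: "\<phi> \<in> Arr1" using \<phi> by (simp add: cart_def)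
  have s: "sa \<chi> \<in> hom (D0 D) (so (Dom1 \<chi>)) (so (Dom1 \<phi>))"
    "ta \<chi> \<in> hom (D0 D) (to (Dom1 \<chi>)) (to (Dom1 \<phi>))"
    using \<chi> by (simp_all del: eq)
  let ?\<psi> = "\<phi> \<bullet> \<chi>"
  have \<psi>: "?\<psi> \<in> Arr1" "Cod1 ?\<psi> = Cod1 \<phi>" "Dom1 ?\<psi> = Dom1 \<chi>"
    "sa \<phi> \<circ>\<^sub>0 sa \<chi> = sa ?\<psi>" "ta \<phi> \<circ>\<^sub>0 ta \<chi> = ta ?\<psi>"
    using \<chi> by simp_all
  have "\<exists>!x. x \<in> hom1 (Dom1 ?\<psi>) (Dom1 \<phi>) \<and> sa x = sa \<chi> \<and> ta x = ta \<chi> \<and> \<phi> \<bullet> x = ?\<psi>"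
    by (rule cart_ex1[OF \<phi> \<psi>(1,2)]) (use \<psi>(3-) s in \<open>simp_all only:\<close>)
  moreover have "\<chi> \<in> hom1 (Dom1 ?\<psi>) (Dom1 \<phi>) \<and> sa \<chi> = sa \<chi> \<and> ta \<chi> = ta \<chi> \<and> \<phi> \<bullet> \<chi> = ?\<psi>"
    using \<chi> by simp
  moreover have "\<chi>' \<in> hom1 (Dom1 ?\<psi>) (Dom1 \<phi>) \<and> sa \<chi>' = sa \<chi> \<and> ta \<chi>' = ta \<chi> \<and> \<phi> \<bullet> \<chi>' = ?\<psi>"
    using \<chi> \<chi>' eq by simp
  ultimately show ?thesis by blast
qed

text \<open>
  The companion is the restriction of the unit \<open>1\<^sub>X\<close> along \<open>k\<close> on the source side, with
  \<open>\<epsilon>\<close> the cartesian 2-cell; \<open>\<eta>\<close> is the factorization of the unit 2-cell on \<open>k\<close> through \<open>\<epsilon>\<close>. The remaining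
  triangle identity is an equality of 2-cells into \<open>K\<close>, hence can be tested after composing with \<open>\<epsilon>\<close>.
\<close>

lemma companion_exists:
  assumes fib: "fibrant D" and k: "k \<in> hom (D0 D) Z X"
  obtains K \<epsilon> \<eta> where "K \<in> Obj1" "so K = Z" "to K = X"
    "\<epsilon> \<in> Arr1" "Dom1 \<epsilon> = K" "Cod1 \<epsilon> = U X" "sa \<epsilon> = k" "ta \<epsilon> = I0 X"
    "\<eta> \<in> Arr1" "Dom1 \<eta> = U Z" "Cod1 \<eta> = K" "sa \<eta> = I0 Z" "ta \<eta> = k"
    "\<epsilon> \<bullet> \<eta> = Ua k" "lunit D K \<bullet> (\<epsilon> \<star> \<eta>) = runit D K"
proof -
  have k' [simp]: "k \<in> Arr (D0 D)" "Dom (D0 D) k = Z" "Cod (D0 D) k = X" using k by simp_all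
  have Z [simp]: "Z \<in> Obj0" "X \<in> Obj0" using V0.Dom_in[of k] V0.Cod_in[of k] k' by simp_all
  obtain \<epsilon> where \<epsilon>c: "cart \<epsilon>" and \<epsilon> [simp]: "\<epsilon> \<in> Arr1" "Cod1 \<epsilon> = U X" "sa \<epsilon> = k" "ta \<epsilon> = I0 X"
    and K: "so (Dom1 \<epsilon>) = Z" "to (Dom1 \<epsilon>) = X"
    using fibrant_cart[OF fib, of "U X" k "I0 X"] by auto
  define K where "K = Dom1 \<epsilon>"
  have K [simp]: "K \<in> Obj1" "so K = Z" "to K = X" "Dom1 \<epsilon> = K"
    using K by (simp_all add: K_def)
  obtain \<eta> where \<eta> [simp]: "\<eta> \<in> Arr1" "Dom1 \<eta> = U Z" "Cod1 \<eta> = K" "sa \<eta> = I0 Z" "ta \<eta> = k"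
    and \<epsilon>\<eta>: "\<epsilon> \<bullet> \<eta> = Ua k"
    using cart_ex[OF \<epsilon>c, of "Ua k" "I0 Z" k] by auto
  have "lunit D K \<bullet> (\<epsilon> \<star> \<eta>) = runit D K"
  proof (rule cart_unique[OF \<epsilon>c])
    have "\<epsilon> \<bullet> lunit D K \<bullet> (\<epsilon> \<star> \<eta>) = (\<epsilon> \<bullet> lunit D K) \<bullet> (\<epsilon> \<star> \<eta>)" by simp
    also have "\<dots> = (lunit D (U X) \<bullet> (I1 (U X) \<star> \<epsilon>)) \<bullet> (\<epsilon> \<star> \<eta>)"
      using lunit_nat[of \<epsilon> "U X" "I0 X"] by simp
    also have "\<dots> = runit D (U X) \<bullet> (\<epsilon> \<star> Ua k)" by (simp add: lunit_eq_runit \<epsilon>\<eta>)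
    also have "\<dots> = \<epsilon> \<bullet> runit D K" using runit_nat[of \<epsilon> "U X" k] by simp
    finally show "\<epsilon> \<bullet> lunit D K \<bullet> (\<epsilon> \<star> \<eta>) = \<epsilon> \<bullet> runit D K" .
  qed simp_all
  then show ?thesis using that[of K \<epsilon> \<eta>] \<epsilon>\<eta> by simp
qed

text \<open>
  The mirror image of the companion: the unit is restricted along \<open>k\<close> on the target side.
\<close>

lemma conjoint_exists:
  assumes fib: "fibrant D" and k: "k \<in> hom (D0 D) Z X"
  obtains K \<epsilon> \<eta> where "K \<in> Obj1" "so K = X" "to K = Z"
    "\<epsilon> \<in> Arr1" "Dom1 \<epsilon> = K" "Cod1 \<epsilon> = U X" "sa \<epsilon> = I0 X" "ta \<epsilon> = k"
    "\<eta> \<in> Arr1" "Dom1 \<eta> = U Z" "Cod1 \<eta> = K" "sa \<eta> = k" "ta \<eta> = I0 Z"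
    "\<epsilon> \<bullet> \<eta> = Ua k" "runit D K \<bullet> (\<eta> \<star> \<epsilon>) = lunit D K"
proof -
  have k' [simp]: "k \<in> Arr (D0 D)" "Dom (D0 D) k = Z" "Cod (D0 D) k = X" using k by simp_all
  have Z [simp]: "Z \<in> Obj0" "X \<in> Obj0" using V0.Dom_in[of k] V0.Cod_in[of k] k' by simp_all
  obtain \<epsilon> where \<epsilon>c: "cart \<epsilon>" and \<epsilon> [simp]: "\<epsilon> \<in> Arr1" "Cod1 \<epsilon> = U X" "sa \<epsilon> = I0 X" "ta \<epsilon> = k"
    and K: "so (Dom1 \<epsilon>) = X" "to (Dom1 \<epsilon>) = Z"
    using fibrant_cart[OF fib, of "U X" "I0 X" k] by auto
  define K where "K = Dom1 \<epsilon>"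
  have K [simp]: "K \<in> Obj1" "so K = X" "to K = Z" "Dom1 \<epsilon> = K"
    using K by (simp_all add: K_def)
  obtain \<eta> where \<eta> [simp]: "\<eta> \<in> Arr1" "Dom1 \<eta> = U Z" "Cod1 \<eta> = K" "sa \<eta> = k" "ta \<eta> = I0 Z"
    and \<epsilon>\<eta>: "\<epsilon> \<bullet> \<eta> = Ua k"
    using cart_ex[OF \<epsilon>c, of "Ua k" k "I0 Z"] by auto
  have "runit D K \<bullet> (\<eta> \<star> \<epsilon>) = lunit D K"
  proof (rule cart_unique[OF \<epsilon>c])
    have "\<epsilon> \<bullet> runit D K \<bullet> (\<eta> \<star> \<epsilon>) = (\<epsilon> \<bullet> runit D K) \<bullet> (\<eta> \<star> \<epsilon>)" by simp
    also have "\<dots> = (runit D (U X) \<bullet> (\<epsilon> \<star> I1 (U X))) \<bullet> (\<eta> \<star> \<epsilon>)"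
      using runit_nat[of \<epsilon> "U X" "I0 X"] by simp
    also have "\<dots> = lunit D (U X) \<bullet> (Ua k \<star> \<epsilon>)" by (simp add: lunit_eq_runit \<epsilon>\<eta>)
    also have "\<dots> = \<epsilon> \<bullet> lunit D K" using lunit_nat[of \<epsilon> "U X" k] by simp
    finally show "\<epsilon> \<bullet> runit D K \<bullet> (\<eta> \<star> \<epsilon>) = \<epsilon> \<bullet> lunit D K" .
  qed simp_all
  then show ?thesis using that[of K \<epsilon> \<eta>] \<epsilon>\<eta> by simp
qed

text \<open>
  Composing with the companion \<open>K\<close> pushes forward in the target variable. The 2-cell \<open>\<theta>\<close> corresponds to
  \<open>lunit \<bullet> (\<epsilon> \<star> \<theta>)\<close>; one round trip is \<open>\<epsilon> \<bullet> \<eta> = 1\<^sub>k\<close>, the other is the triangle identity, which enters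
  as \<open>retract\<close>. The vertical 1-cell \<open>sa \<theta>\<close> is left arbitrary, so that the pushforward in the source
  variable can be performed afterwards.
\<close>

lemma target_pushforward:
  assumes fib: "fibrant D" and M [simp]: "M \<in> Obj1" and k: "k \<in> hom (D0 D) (to M) X"
  obtains N p where "N \<in> Obj1" "so N = so M" "to N = X"
    "p \<in> Arr1" "Dom1 p = M" "Cod1 p = N" "sa p = I0 (so M)" "ta p = k"
    "\<And>\<theta>. \<theta> \<in> Arr1 \<Longrightarrow> Dom1 \<theta> = M \<Longrightarrow> ta \<theta> = k
      \<Longrightarrow> \<exists>!h. h \<in> hom1 N (Cod1 \<theta>) \<and> sa h = sa \<theta> \<and> ta h = I0 X \<and> h \<bullet> p = \<theta>"
proof -
  have k' [simp]: "k \<in> Arr (D0 D)" "Dom (D0 D) k = to M" "Cod (D0 D) k = X" using k by simp_all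
  have X [simp]: "X \<in> Obj0" using V0.Cod_in[of k] k' by simp
  obtain K \<epsilon> \<eta> where [simp]: "K \<in> Obj1" "so K = to M" "to K = X"
    "\<epsilon> \<in> Arr1" "Dom1 \<epsilon> = K" "Cod1 \<epsilon> = U X" "sa \<epsilon> = k" "ta \<epsilon> = I0 X"
    "\<eta> \<in> Arr1" "Dom1 \<eta> = U (to M)" "Cod1 \<eta> = K" "sa \<eta> = I0 (to M)" "ta \<eta> = k"
    and \<epsilon>\<eta>: "\<epsilon> \<bullet> \<eta> = Ua k" and zigzag: "lunit D K \<bullet> (\<epsilon> \<star> \<eta>) = runit D K"
    by (rule companion_exists[OF fib k])
  let ?p = "(\<eta> \<star> I1 M) \<bullet> lunit' M"
  have retract: "lunit D (K \<odot> M) \<bullet> (\<epsilon> \<star> ?p) = I1 (K \<odot> M)"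
  proof -
    have "(lunit D (K \<odot> M) \<bullet> (\<epsilon> \<star> (\<eta> \<star> I1 M))) \<bullet> hassoc D K (U (to M)) M
        = lunit D (K \<odot> M) \<bullet> (hassoc D (U X) K M \<bullet> ((\<epsilon> \<star> \<eta>) \<star> I1 M))"
      by (subst hassoc_nat) simp_all
    also have "\<dots> = (lunit D (K \<odot> M) \<bullet> hassoc D (U X) K M) \<bullet> ((\<epsilon> \<star> \<eta>) \<star> I1 M)"
      by simp
    also have "\<dots> = (lunit D K \<bullet> (\<epsilon> \<star> \<eta>)) \<star> I1 M"
      using lunit_hcomp[of K M] by simp
    also have "\<dots> = (I1 K \<star> lunit D M) \<bullet> hassoc D K (U (to M)) M"
      unfolding zigzag using triangle[of K M] by simp
    finally have "lunit D (K \<odot> M) \<bullet> (\<epsilon> \<star> (\<eta> \<star> I1 M)) = I1 K \<star> lunit D M"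
      by (rule iso_cancel_right[where \<gamma>' = "hassoc' K (U (to M)) M"]) simp_all
    then have "(lunit D (K \<odot> M) \<bullet> (\<epsilon> \<star> (\<eta> \<star> I1 M))) \<bullet> (I1 K \<star> lunit' M) = I1 (K \<odot> M)"
      by (simp add: hcomp_id)
    then show ?thesis by simp
  qed
  have universal: "\<exists>!h. h \<in> hom1 (K \<odot> M) (Cod1 \<theta>) \<and> sa h = sa \<theta> \<and> ta h = I0 X \<and> h \<bullet> ?p = \<theta>"
    if \<theta> [simp]: "\<theta> \<in> Arr1" "Dom1 \<theta> = M" "ta \<theta> = k" for \<theta>
  proof (rule ex_ex1I)
    have toB [simp]: "to (Cod1 \<theta>) = X" using tgt_simps(4)[of \<theta>] by simp
    let ?h = "lunit D (Cod1 \<theta>) \<bullet> (\<epsilon> \<star> \<theta>)"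
    have "?h \<bullet> ?p = (lunit D (Cod1 \<theta>) \<bullet> (Ua k \<star> \<theta>)) \<bullet> lunit' M" by (simp add: \<epsilon>\<eta>)
    also have "\<dots> = \<theta>" using lunit_nat[of \<theta> "Cod1 \<theta>" k] by simp
    finally have "?h \<bullet> ?p = \<theta>" .
    moreover have "?h \<in> hom1 (K \<odot> M) (Cod1 \<theta>) \<and> sa ?h = sa \<theta> \<and> ta ?h = I0 X" by simp
    ultimately show "\<exists>h. h \<in> hom1 (K \<odot> M) (Cod1 \<theta>) \<and> sa h = sa \<theta> \<and> ta h = I0 X \<and> h \<bullet> ?p = \<theta>"
      by blast
    have det: "h = lunit D (Cod1 \<theta>) \<bullet> (\<epsilon> \<star> \<theta>)"
      if h: "h \<in> hom1 (K \<odot> M) (Cod1 \<theta>)" "ta h = I0 X" "h \<bullet> ?p = \<theta>" for h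
    proof -
      have [simp]: "h \<in> Arr1" "Dom1 h = K \<odot> M" "Cod1 h = Cod1 \<theta>" "ta h = I0 X"
        using h by simp_all
      have "lunit D (Cod1 \<theta>) \<bullet> (\<epsilon> \<star> (h \<bullet> ?p)) = (lunit D (Cod1 \<theta>) \<bullet> (I1 (U X) \<star> h)) \<bullet> (\<epsilon> \<star> ?p)"
        by simp
      also have "\<dots> = h \<bullet> (lunit D (K \<odot> M) \<bullet> (\<epsilon> \<star> ?p))"
        using lunit_nat[of h "Cod1 \<theta>" "I0 X"] by simp
      also have "\<dots> = h" unfolding retract by simp
      finally show ?thesis unfolding h(3) by simp
    qed
    fix h h'
    assume h: "h \<in> hom1 (K \<odot> M) (Cod1 \<theta>) \<and> sa h = sa \<theta> \<and> ta h = I0 X \<and> h \<bullet> ?p = \<theta>"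
      and h': "h' \<in> hom1 (K \<odot> M) (Cod1 \<theta>) \<and> sa h' = sa \<theta> \<and> ta h' = I0 X \<and> h' \<bullet> ?p = \<theta>"
    show "h = h'" using det[of h] det[of h'] h h' by argo
  qed
  show ?thesis by (rule that[of "K \<odot> M" ?p, OF _ _ _ _ _ _ _ _ universal]) simp_all
qed

lemma source_pushforward:
  assumes fib: "fibrant D" and M [simp]: "M \<in> Obj1" and k: "k \<in> hom (D0 D) (so M) X"
  obtains N p where "N \<in> Obj1" "so N = X" "to N = to M"
    "p \<in> Arr1" "Dom1 p = M" "Cod1 p = N" "sa p = k" "ta p = I0 (to M)"
    "\<And>\<theta>. \<theta> \<in> Arr1 \<Longrightarrow> Dom1 \<theta> = M \<Longrightarrow> sa \<theta> = k
      \<Longrightarrow> \<exists>!h. h \<in> hom1 N (Cod1 \<theta>) \<and> sa h = I0 X \<and> ta h = ta \<theta> \<and> h \<bullet> p = \<theta>"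
proof -
  have k' [simp]: "k \<in> Arr (D0 D)" "Dom (D0 D) k = so M" "Cod (D0 D) k = X" using k by simp_all
  have X [simp]: "X \<in> Obj0" using V0.Cod_in[of k] k' by simp
  obtain K \<epsilon> \<eta> where [simp]: "K \<in> Obj1" "so K = X" "to K = so M"
    "\<epsilon> \<in> Arr1" "Dom1 \<epsilon> = K" "Cod1 \<epsilon> = U X" "sa \<epsilon> = I0 X" "ta \<epsilon> = k"
    "\<eta> \<in> Arr1" "Dom1 \<eta> = U (so M)" "Cod1 \<eta> = K" "sa \<eta> = k" "ta \<eta> = I0 (so M)"
    and \<epsilon>\<eta>: "\<epsilon> \<bullet> \<eta> = Ua k" and zigzag: "runit D K \<bullet> (\<eta> \<star> \<epsilon>) = lunit D K"
    by (rule conjoint_exists[OF fib k])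
  let ?p = "(I1 M \<star> \<eta>) \<bullet> runit' M"
  have retract: "runit D (M \<odot> K) \<bullet> (?p \<star> \<epsilon>) = I1 (M \<odot> K)"
  proof -
    have "runit D (M \<odot> K) \<bullet> ((I1 M \<star> \<eta>) \<star> \<epsilon>)
        = (I1 M \<star> runit D K) \<bullet> hassoc D M K (U X) \<bullet> ((I1 M \<star> \<eta>) \<star> \<epsilon>)"
      using runit_hcomp[of M K, symmetric] by simp
    also have "\<dots> = (I1 M \<star> (runit D K \<bullet> (\<eta> \<star> \<epsilon>))) \<bullet> hassoc D M (U (so M)) K"
      by (subst hassoc_nat) simp_all
    also have "\<dots> = runit D M \<star> I1 K" unfolding zigzag using triangle[of M K] by simp
    finally have "(runit D (M \<odot> K) \<bullet> ((I1 M \<star> \<eta>) \<star> \<epsilon>)) \<bullet> (runit' M \<star> I1 K) = I1 (M \<odot> K)"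
      by (simp add: hcomp_id)
    then show ?thesis by simp
  qed
  have universal: "\<exists>!h. h \<in> hom1 (M \<odot> K) (Cod1 \<theta>) \<and> sa h = I0 X \<and> ta h = ta \<theta> \<and> h \<bullet> ?p = \<theta>"
    if \<theta> [simp]: "\<theta> \<in> Arr1" "Dom1 \<theta> = M" "sa \<theta> = k" for \<theta>
  proof (rule ex_ex1I)
    have soB [simp]: "so (Cod1 \<theta>) = X" using src_simps(4)[of \<theta>] by simp
    let ?h = "runit D (Cod1 \<theta>) \<bullet> (\<theta> \<star> \<epsilon>)"
    have "?h \<bullet> ?p = (runit D (Cod1 \<theta>) \<bullet> (\<theta> \<star> Ua k)) \<bullet> runit' M" by (simp add: \<epsilon>\<eta>)
    also have "\<dots> = \<theta>" using runit_nat[of \<theta> "Cod1 \<theta>" k] by simp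
    finally have "?h \<bullet> ?p = \<theta>" .
    moreover have "?h \<in> hom1 (M \<odot> K) (Cod1 \<theta>) \<and> sa ?h = I0 X \<and> ta ?h = ta \<theta>" by simp
    ultimately show "\<exists>h. h \<in> hom1 (M \<odot> K) (Cod1 \<theta>) \<and> sa h = I0 X \<and> ta h = ta \<theta> \<and> h \<bullet> ?p = \<theta>"
      by blast
    have det: "h = runit D (Cod1 \<theta>) \<bullet> (\<theta> \<star> \<epsilon>)"
      if h: "h \<in> hom1 (M \<odot> K) (Cod1 \<theta>)" "sa h = I0 X" "h \<bullet> ?p = \<theta>" for h
    proof -
      have [simp]: "h \<in> Arr1" "Dom1 h = M \<odot> K" "Cod1 h = Cod1 \<theta>" "sa h = I0 X"
        using h by simp_all
      have "runit D (Cod1 \<theta>) \<bullet> ((h \<bullet> ?p) \<star> \<epsilon>) = (runit D (Cod1 \<theta>) \<bullet> (h \<star> I1 (U X))) \<bullet> (?p \<star> \<epsilon>)"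
        by simp
      also have "\<dots> = h \<bullet> (runit D (M \<odot> K) \<bullet> (?p \<star> \<epsilon>))"
        using runit_nat[of h "Cod1 \<theta>" "I0 X"] by simp
      also have "\<dots> = h" unfolding retract by simp
      finally show ?thesis unfolding h(3) by simp
    qed
    fix h h'
    assume h: "h \<in> hom1 (M \<odot> K) (Cod1 \<theta>) \<and> sa h = I0 X \<and> ta h = ta \<theta> \<and> h \<bullet> ?p = \<theta>"
      and h': "h' \<in> hom1 (M \<odot> K) (Cod1 \<theta>) \<and> sa h' = I0 X \<and> ta h' = ta \<theta> \<and> h' \<bullet> ?p = \<theta>"
    show "h = h'" using det[of h] det[of h'] h h' by argo
  qed
  show ?thesis by (rule that[of "M \<odot> K" ?p, OF _ _ _ _ _ _ _ _ universal]) simp_all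
qed

lemma local_cat_simps [simp]:
  "M \<in> Obj (local_cat D X Y) \<longleftrightarrow> M \<in> Obj1 \<and> so M = X \<and> to M = Y"
  "\<alpha> \<in> Arr (local_cat D X Y) \<longleftrightarrow> \<alpha> \<in> Arr1 \<and> sa \<alpha> = I0 X \<and> ta \<alpha> = I0 Y"
  "Dom (local_cat D X Y) = Dom1" "Cod (local_cat D X Y) = Cod1"
  "Ident (local_cat D X Y) = I1" "Comp (local_cat D X Y) = Comp (D1 D)"
  by (simp_all add: local_cat_def)

text \<open>
  Pushing forward in the target and then in the source variable represents 2-cells over \<open>(k, k)\<close>.
\<close>

lemma pushforward_exists:
  assumes fib: "fibrant D" and M [simp]: "M \<in> Obj1" "to M = so M"
    and k: "k \<in> hom (D0 D) (so M) X"
  shows "\<exists>N p. N \<in> Obj (local_cat D X X) \<and> p \<in> hom1 M N \<and> sa p = k \<and> ta p = k \<and>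
    (\<forall>\<theta> B. \<theta> \<in> hom1 M B \<and> sa \<theta> = k \<and> ta \<theta> = k \<longrightarrow>
      (\<exists>!h. h \<in> hom (local_cat D X X) N B \<and> h \<bullet> p = \<theta>))"
proof -
  have k' [simp]: "k \<in> Arr (D0 D)" "Dom (D0 D) k = so M" "Cod (D0 D) k = X" using k by simp_all
  have X [simp]: "X \<in> Obj0" using V0.Cod_in[of k] k' by simp
  have kt: "k \<in> hom (D0 D) (to M) X" by simp
  obtain L p where L [simp]: "L \<in> Obj1" "so L = so M" "to L = X"
    "p \<in> Arr1" "Dom1 p = M" "Cod1 p = L" "sa p = I0 (so M)" "ta p = k"
    and p: "\<And>\<theta>. \<theta> \<in> Arr1 \<Longrightarrow> Dom1 \<theta> = M \<Longrightarrow> ta \<theta> = k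
      \<Longrightarrow> \<exists>!h. h \<in> hom1 L (Cod1 \<theta>) \<and> sa h = sa \<theta> \<and> ta h = I0 X \<and> h \<bullet> p = \<theta>"
    by (rule target_pushforward[OF fib M(1) kt]) blast
  have ks: "k \<in> hom (D0 D) (so L) X" by simp
  obtain N q where N [simp]: "N \<in> Obj1" "so N = X" "to N = to L"
    "q \<in> Arr1" "Dom1 q = L" "Cod1 q = N" "sa q = k" "ta q = I0 (to L)"
    and q: "\<And>\<theta>. \<theta> \<in> Arr1 \<Longrightarrow> Dom1 \<theta> = L \<Longrightarrow> sa \<theta> = k
      \<Longrightarrow> \<exists>!h. h \<in> hom1 N (Cod1 \<theta>) \<and> sa h = I0 X \<and> ta h = ta \<theta> \<and> h \<bullet> q = \<theta>"
    by (rule source_pushforward[OF fib L(1) ks]) blast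
  have "\<exists>!h. h \<in> hom (local_cat D X X) N B \<and> h \<bullet> q \<bullet> p = \<theta>"
    if \<theta>: "\<theta> \<in> hom1 M B" "sa \<theta> = k" "ta \<theta> = k" for \<theta> B
  proof (rule ex_ex1I)
    obtain h1 where h1: "h1 \<in> hom1 L B" "sa h1 = k" "ta h1 = I0 X" "h1 \<bullet> p = \<theta>"
      using p[of \<theta>] \<theta> by auto
    obtain h2 where h2: "h2 \<in> hom1 N B" "sa h2 = I0 X" "ta h2 = I0 X" "h2 \<bullet> q = h1"
      using q[of h1] h1 by auto
    have "h2 \<bullet> q \<bullet> p = (h2 \<bullet> q) \<bullet> p" using h2(1) by simp
    then show "\<exists>h. h \<in> hom (local_cat D X X) N B \<and> h \<bullet> q \<bullet> p = \<theta>"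
      using h1 h2 by auto
    fix h h'
    assume h: "h \<in> hom (local_cat D X X) N B \<and> h \<bullet> q \<bullet> p = \<theta>"
      and h': "h' \<in> hom (local_cat D X X) N B \<and> h' \<bullet> q \<bullet> p = \<theta>"
    have x: "x \<bullet> q \<in> hom1 L (Cod1 \<theta>) \<and> sa (x \<bullet> q) = sa \<theta> \<and> ta (x \<bullet> q) = I0 X \<and> (x \<bullet> q) \<bullet> p = \<theta>"
      if "x \<in> hom (local_cat D X X) N B \<and> x \<bullet> q \<bullet> p = \<theta>" for x
      using that \<theta> by simp
    have "h \<bullet> q = h' \<bullet> q" using p[of \<theta>] \<theta> x[OF h] x[OF h'] by auto
    moreover have "\<exists>!y. y \<in> hom1 N (Cod1 (h \<bullet> q)) \<and> sa y = I0 X \<and> ta y = ta (h \<bullet> q) \<and> y \<bullet> q = h \<bullet> q"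
      by (rule q) (use h in simp_all)
    ultimately show "h = h'" using h h' by auto
  qed
  moreover have "q \<bullet> p \<in> hom1 M N \<and> sa (q \<bullet> p) = k \<and> ta (q \<bullet> p) = k" by simp
  ultimately show ?thesis using N L by (intro exI[of _ N] exI[of _ "q \<bullet> p"]) simp
qed

section \<open>Monads on a fixed 0-cell\<close>

lemma globular_endpoints:
  "\<alpha> \<in> Arr1 \<Longrightarrow> sa \<alpha> = I0 X \<Longrightarrow> X \<in> Obj0 \<Longrightarrow> so (Dom1 \<alpha>) = X"
  "\<alpha> \<in> Arr1 \<Longrightarrow> sa \<alpha> = I0 X \<Longrightarrow> X \<in> Obj0 \<Longrightarrow> so (Cod1 \<alpha>) = X"
  "\<alpha> \<in> Arr1 \<Longrightarrow> ta \<alpha> = I0 X \<Longrightarrow> X \<in> Obj0 \<Longrightarrow> to (Dom1 \<alpha>) = X"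
  "\<alpha> \<in> Arr1 \<Longrightarrow> ta \<alpha> = I0 X \<Longrightarrow> X \<in> Obj0 \<Longrightarrow> to (Cod1 \<alpha>) = X"
  using src_simps(3,4)[of \<alpha>] tgt_simps(3,4)[of \<alpha>] by simp_all

lemma category_local: "X \<in> Obj0 \<Longrightarrow> Y \<in> Obj0 \<Longrightarrow> category (local_cat D X Y)"
  by unfold_locales (auto simp: globular_endpoints)

text \<open>
  Monad morphisms lying over the identity of \<open>X\<close>, the monoid morphisms of \<open>\<D>[X, X]\<close>.
\<close>

definition monad_mor_on :: "'o \<Rightarrow> ('h, 'c) monad \<Rightarrow> ('h, 'c) monad \<Rightarrow> 'c \<Rightarrow> bool" where
  "monad_mor_on X \<A> \<B> h \<longleftrightarrow> is_monad_mor D \<A> \<B> h \<and> sa h = I0 X"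

lemma functor_post_comp:
  assumes [simp]: "X \<in> Obj0" "Y \<in> Obj0" "Z \<in> Obj0" and M: "M \<in> Obj (local_cat D X Y)"
  shows "is_functor (local_cat D Z X) (local_cat D Z Y) (post_comp D M)"
  using category_local M
  by (intro is_functor.intro) (auto simp: post_comp_def globular_endpoints hcomp_id)

lemma functor_pre_comp:
  assumes [simp]: "X \<in> Obj0" "Y \<in> Obj0" "Z \<in> Obj0" and M: "M \<in> Obj (local_cat D X Y)"
  shows "is_functor (local_cat D Y Z) (local_cat D X Z) (pre_comp D M)"
  using category_local M
  by (intro is_functor.intro) (auto simp: pre_comp_def globular_endpoints hcomp_id)

lemma monoidal_local:
  assumes X [simp]: "X \<in> Obj0"
  shows "monoidal (local_cat D X X) (hcomp_obj D) (hcomp_arr D) (U X) (hassoc D) hassoc'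
    (lunit D) lunit' (runit D) runit'"
proof -
  let ?L = "local_cat D X X"
  interpret L: category "?L" by (rule category_local[OF X X])
  show ?thesis
  proof
    fix \<alpha> assume \<alpha>: "\<alpha> \<in> Arr ?L"
    show "\<And>M. Cod ?L \<alpha> = M \<Longrightarrow> lunit D M \<cdot>\<^bsub>?L\<^esub> (Ident ?L (U X) \<star> \<alpha>)
        = \<alpha> \<cdot>\<^bsub>?L\<^esub> lunit D (Dom ?L \<alpha>)"
      using lunit_nat[of \<alpha> _ "I0 X"] \<alpha> by simp
    show "\<And>M. Cod ?L \<alpha> = M \<Longrightarrow> runit D M \<cdot>\<^bsub>?L\<^esub> (\<alpha> \<star> Ident ?L (U X))
        = \<alpha> \<cdot>\<^bsub>?L\<^esub> runit D (Dom ?L \<alpha>)"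
      using runit_nat[of \<alpha> _ "I0 X"] \<alpha> by simp
  next
    fix M N P Q
    assume "M \<in> Obj ?L" "N \<in> Obj ?L" "P \<in> Obj ?L"
      "Q \<in> Obj ?L"
    then show "hassoc D M N (P \<odot> Q) \<cdot>\<^bsub>?L\<^esub> hassoc D (M \<odot> N) P Q
        = (Ident ?L M \<star> hassoc D N P Q) \<cdot>\<^bsub>?L\<^esub> hassoc D M (N \<odot> P) Q
          \<cdot>\<^bsub>?L\<^esub> (hassoc D M N P \<star> Ident ?L Q)"
      using pentagon[of M N P Q] by simp
  next
    fix M N
    assume MN: "M \<in> Obj ?L" "N \<in> Obj ?L"
    show "(Ident ?L M \<star> lunit D N) \<cdot>\<^bsub>?L\<^esub> hassoc D M (U X) N
        = runit D M \<star> Ident ?L N"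
      using triangle[of M N] MN by simp
    show "lunit D (M \<odot> N) \<cdot>\<^bsub>?L\<^esub> hassoc D (U X) M N = lunit D M \<star> Ident ?L N"
      using lunit_hcomp[of M N] MN by simp
    show "(Ident ?L M \<star> runit D N) \<cdot>\<^bsub>?L\<^esub> hassoc D M N (U X) = runit D (M \<odot> N)"
      using runit_hcomp[of M N] MN by simp
  qed (auto simp: hcomp_id hassoc_nat lunit_eq_runit globular_endpoints)
qed

lemma stable_monoidal_local:
  assumes inf: "infinite (UNIV :: 'i set)" and st: "stable_local_colimits TYPE('i) D"
    and X [simp]: "X \<in> Obj0"
  shows "stable_monoidal (local_cat D X X) (hcomp_obj D) (hcomp_arr D) (U X) (hassoc D) hassoc'
    (lunit D) lunit' (runit D) runit'"
proof -
  let ?L = "local_cat D X X"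
  obtain e :: "nat \<Rightarrow> 'i" where e: "inj e" using infinite_countable_subset[OF inf] by blast
  have colim: "has_colimits I ?L" if "category I" for I :: "'i small_cat"
    using st that unfolding stable_local_colimits_def stable_local_colimits_of_def by simp
  have post: "preserves_colimits I ?L ?L (post_comp D N)" and pre: "preserves_colimits I ?L ?L (pre_comp D N)"
    if "category I" "N \<in> Obj ?L" for I :: "'i small_cat" and N
    using st that X unfolding stable_local_colimits_def stable_local_colimits_of_def by blast+
  have L: "category ?L" by (rule category_local[OF X X])
  show ?thesis
  proof (rule stable_monoidal.intro[OF monoidal_local[OF X]], unfold_locales)
    show "\<exists>T \<iota>. is_coproduct ?L UNIV H T \<iota>" if "\<And>n. H n \<in> Obj ?L" for H :: "nat \<Rightarrow> 'h"
      by (rule coproduct_if_colimits[OF L colim e that])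
    show "is_coproduct ?L UNIV (\<lambda>n. N \<odot> H n) (N \<odot> T) (\<lambda>n. Ident ?L N \<star> \<iota> n)"
      if cp: "is_coproduct ?L UNIV H T \<iota>" and N: "N \<in> Obj ?L" for H :: "nat \<Rightarrow> 'h" and T \<iota> N
      using preserves_coproduct[OF functor_post_comp[OF X X X N] post[OF _ N] e cp]
      by (simp add: post_comp_def)
    show "is_coproduct ?L UNIV (\<lambda>n. H n \<odot> N) (T \<odot> N) (\<lambda>n. \<iota> n \<star> Ident ?L N)"
      if cp: "is_coproduct ?L UNIV H T \<iota>" and N: "N \<in> Obj ?L" for H :: "nat \<Rightarrow> 'h" and T \<iota> N
      using preserves_coproduct[OF functor_pre_comp[OF X X X N] pre[OF _ N] e cp]
      by (simp add: pre_comp_def)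
    show "\<exists>Q q. is_coequalizer ?L u v Q q" if "u \<in> Arr ?L" "v \<in> hom ?L (Dom ?L u) (Cod ?L u)" for u v
      by (rule coequalizer_if_colimits[OF inf L colim that])
    show "is_coequalizer ?L (Ident ?L N \<star> u) (Ident ?L N \<star> v) (N \<odot> Q) (Ident ?L N \<star> q)"
      if ce: "is_coequalizer ?L u v Q q" "u \<in> Arr ?L" "v \<in> hom ?L (Dom ?L u) (Cod ?L u)"
        and N: "N \<in> Obj ?L" for u v Q q N
      using preserves_coequalizer[OF inf functor_post_comp[OF X X X N] post[OF _ N] ce]
      by (simp add: post_comp_def)
    show "is_coequalizer ?L (u \<star> Ident ?L N) (v \<star> Ident ?L N) (Q \<odot> N) (q \<star> Ident ?L N)"
      if ce: "is_coequalizer ?L u v Q q" "u \<in> Arr ?L" "v \<in> hom ?L (Dom ?L u) (Cod ?L u)"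
        and N: "N \<in> Obj ?L" for u v Q q N
      using preserves_coequalizer[OF inf functor_pre_comp[OF X X X N] pre[OF _ N] ce]
      by (simp add: pre_comp_def)
  qed
qed

lemma is_monoid_iff_is_monad:
  assumes X [simp]: "X \<in> Obj0"
  shows "monoidal.is_monoid (local_cat D X X) (hcomp_obj D) (hcomp_arr D) (U X) (hassoc D) (lunit D) (runit D) A m n
    \<longleftrightarrow> is_monad D \<lparr>mcell = A, mmult = m, munit = n\<rparr> \<and> so A = X"
proof -
  interpret L: monoidal "local_cat D X X" "hcomp_obj D" "hcomp_arr D" "U X" "hassoc D" hassoc'
    "lunit D" lunit' "runit D" runit' by (rule monoidal_local[OF X])
  show ?thesis by (auto simp: L.is_monoid_def is_monad_def Let_def)
qed

lemma is_monoid_mor_iff_monad_mor_on: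
  assumes X [simp]: "X \<in> Obj0" and n': "n' \<in> hom1 (U X) B"
  shows "monoidal.is_monoid_mor (local_cat D X X) (hcomp_arr D) A m n B m' n' h
    \<longleftrightarrow> monad_mor_on X \<lparr>mcell = A, mmult = m, munit = n\<rparr> \<lparr>mcell = B, mmult = m', munit = n'\<rparr> h"
proof -
  interpret L: monoidal "local_cat D X X" "hcomp_obj D" "hcomp_arr D" "U X" "hassoc D" hassoc'
    "lunit D" lunit' "runit D" runit' by (rule monoidal_local[OF X])
  have "n' \<bullet> Ua (I0 X) = n'" using n' by simp
  then show ?thesis by (auto simp: L.is_monoid_mor_def is_monad_mor_def monad_mor_on_def cong: conj_cong)
qed

lemma is_monadD:
  assumes "is_monad D \<A>" "X = so (mcell \<A>)"
  shows "mcell \<A> \<in> Obj1" "so (mcell \<A>) = X" "to (mcell \<A>) = X" "X \<in> Obj0"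
    "mmult \<A> \<in> Arr1" "Dom1 (mmult \<A>) = mcell \<A> \<odot> mcell \<A>" "Cod1 (mmult \<A>) = mcell \<A>"
    "sa (mmult \<A>) = I0 X" "ta (mmult \<A>) = I0 X"
    "munit \<A> \<in> Arr1" "Dom1 (munit \<A>) = U X" "Cod1 (munit \<A>) = mcell \<A>"
    "sa (munit \<A>) = I0 X" "ta (munit \<A>) = I0 X"
    "mmult \<A> \<bullet> (mmult \<A> \<star> I1 (mcell \<A>))
      = mmult \<A> \<bullet> (I1 (mcell \<A>) \<star> mmult \<A>) \<bullet> hassoc D (mcell \<A>) (mcell \<A>) (mcell \<A>)"
    "mmult \<A> \<bullet> (munit \<A> \<star> I1 (mcell \<A>)) = lunit D (mcell \<A>)"
    "mmult \<A> \<bullet> (I1 (mcell \<A>) \<star> munit \<A>) = runit D (mcell \<A>)"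
  using assms by (simp_all add: is_monad_def Let_def)

lemma monad_eta [simp]:
  fixes \<A> :: "('h, 'c) monad"
  shows "\<lparr>mcell = mcell \<A>, mmult = mmult \<A>, munit = munit \<A>\<rparr> = \<A>"
  by (cases \<A>) simp

lemma free_monad_exists:
  assumes inf: "infinite (UNIV :: 'i set)" and st: "stable_local_colimits TYPE('i) D"
    and X [simp]: "X \<in> Obj0" and G: "G \<in> Obj (local_cat D X X)"
  shows "\<exists>\<T> \<gamma>. is_monad D \<T> \<and> so (mcell \<T>) = X \<and> \<gamma> \<in> hom (local_cat D X X) G (mcell \<T>) \<and>
    (\<forall>\<B> f. is_monad D \<B> \<and> so (mcell \<B>) = X \<and> f \<in> hom (local_cat D X X) G (mcell \<B>) \<longrightarrow>
      (\<exists>!h. monad_mor_on X \<T> \<B> h \<and> h \<bullet> \<gamma> = f))"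
proof -
  interpret L: stable_monoidal "local_cat D X X" "hcomp_obj D" "hcomp_arr D" "U X" "hassoc D" hassoc'
    "lunit D" lunit' "runit D" runit' by (rule stable_monoidal_local[OF inf st X])
  obtain T m n \<gamma> where T: "L.is_free_monoid G T m n \<gamma>" using L.free_monoid_exists[OF G] by blast
  let ?T = "\<lparr>mcell = T, mmult = m, munit = n\<rparr>"
  have "is_monad D ?T \<and> so T = X" "\<gamma> \<in> hom (local_cat D X X) G T"
    using T unfolding L.is_free_monoid_def is_monoid_iff_is_monad[OF X] by blast+
  moreover have "\<exists>!h. monad_mor_on X ?T \<B> h \<and> h \<bullet> \<gamma> = f"
    if B: "is_monad D \<B>" "so (mcell \<B>) = X" "f \<in> hom (local_cat D X X) G (mcell \<B>)" for \<B> f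
  proof -
    have "L.is_monoid (mcell \<B>) (mmult \<B>) (munit \<B>)"
      unfolding is_monoid_iff_is_monad[OF X] using B by simp
    moreover have "munit \<B> \<in> hom1 (U X) (mcell \<B>)" using is_monadD[OF B(1) B(2)[symmetric]] by simp
    moreover from this have "L.is_monoid_mor T m n (mcell \<B>) (mmult \<B>) (munit \<B>) h \<longleftrightarrow> monad_mor_on X ?T \<B> h" for h
      by (subst is_monoid_mor_iff_monad_mor_on[OF X]) simp_all
    ultimately show ?thesis
      using T B(3) unfolding L.is_free_monoid_def local_cat_simps by blast
  qed
  ultimately show ?thesis by (intro exI[of _ ?T] exI[of _ \<gamma>]) simp
qed

lemma quotient_monad_exists:
  assumes inf: "infinite (UNIV :: 'i set)" and st: "stable_local_colimits TYPE('i) D"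
    and X [simp]: "X \<in> Obj0" and T: "is_monad D \<T>" "so (mcell \<T>) = X"
    and u: "u \<in> hom (local_cat D X X) R (mcell \<T>)" and v: "v \<in> hom (local_cat D X X) R (mcell \<T>)"
  shows "\<exists>\<Q> q. is_monad D \<Q> \<and> so (mcell \<Q>) = X \<and> monad_mor_on X \<T> \<Q> q \<and> q \<bullet> u = q \<bullet> v \<and>
    (\<forall>\<B> f. is_monad D \<B> \<and> so (mcell \<B>) = X \<and> monad_mor_on X \<T> \<B> f \<and> f \<bullet> u = f \<bullet> v \<longrightarrow>
      (\<exists>!h. monad_mor_on X \<Q> \<B> h \<and> h \<bullet> q = f))"
proof -
  interpret L: stable_monoidal "local_cat D X X" "hcomp_obj D" "hcomp_arr D" "U X" "hassoc D" hassoc'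
    "lunit D" lunit' "runit D" runit' by (rule stable_monoidal_local[OF inf st X])
  have monad_iff: "L.is_monoid (mcell \<B>) (mmult \<B>) (munit \<B>) \<longleftrightarrow> is_monad D \<B> \<and> so (mcell \<B>) = X" for \<B>
    unfolding is_monoid_iff_is_monad[OF X] by simp
  have mor_iff: "L.is_monoid_mor (mcell \<A>) (mmult \<A>) (munit \<A>) (mcell \<B>) (mmult \<B>) (munit \<B>) f \<longleftrightarrow> monad_mor_on X \<A> \<B> f"
    if "is_monad D \<B>" "so (mcell \<B>) = X" for \<A> \<B> f
    using is_monadD[OF that(1) that(2)[symmetric]] by (subst is_monoid_mor_iff_monad_mor_on[OF X]) simp_all
  obtain Q mQ nQ q where *: "L.is_monoid Q mQ nQ"
      "L.is_monoid_mor (mcell \<T>) (mmult \<T>) (munit \<T>) Q mQ nQ q" "q \<bullet> u = q \<bullet> v"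
      "\<And>B m' n' f. L.is_monoid B m' n' \<Longrightarrow> L.is_monoid_mor (mcell \<T>) (mmult \<T>) (munit \<T>) B m' n' f \<Longrightarrow>
        f \<bullet> u = f \<bullet> v \<Longrightarrow> \<exists>!h. L.is_monoid_mor Q mQ nQ B m' n' h \<and> h \<bullet> q = f"
    using L.quotient_monoid_exists[of "mcell \<T>" "mmult \<T>" "munit \<T>" u R v] T u v
    unfolding monad_iff local_cat_simps by blast
  define \<Q> where "\<Q> = \<lparr>mcell = Q, mmult = mQ, munit = nQ\<rparr>"
  have Q: "Q = mcell \<Q>" "mQ = mmult \<Q>" "nQ = munit \<Q>" by (simp_all add: \<Q>_def)
  have QM: "is_monad D \<Q>" "so (mcell \<Q>) = X" using *(1) unfolding Q monad_iff by blast+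
  moreover have "monad_mor_on X \<T> \<Q> q" using *(2) unfolding Q mor_iff[OF QM] .
  moreover have "\<exists>!h. monad_mor_on X \<Q> \<B> h \<and> h \<bullet> q = f"
    if B: "is_monad D \<B>" "so (mcell \<B>) = X" and f: "monad_mor_on X \<T> \<B> f" "f \<bullet> u = f \<bullet> v" for \<B> f
    using *(4)[of "mcell \<B>" "mmult \<B>" "munit \<B>" f] B f unfolding Q monad_iff mor_iff[OF B] by blast
  ultimately show ?thesis using *(3) by blast
qed

text \<open>
  A family of 2-cells \<open>M j \<Rightarrow> B\<close> over vertical 1-cells \<open>k j\<close> into \<open>X\<close> is represented by one object
  of \<open>\<D>[X, X]\<close>, the coproduct of the pushforwards. Both the generators and the relations of
  the colimit monad are families of this kind.
\<close>

lemma pushforward_coproduct_exists: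
  fixes e :: "'j \<Rightarrow> 'i"
  assumes st: "stable_local_colimits TYPE('i) D" and fib: "fibrant D"
    and X [simp]: "X \<in> Obj0" and e: "inj_on e J"
    and M: "\<And>j. j \<in> J \<Longrightarrow> M j \<in> Obj1" "\<And>j. j \<in> J \<Longrightarrow> to (M j) = so (M j)"
    and k: "\<And>j. j \<in> J \<Longrightarrow> k j \<in> hom (D0 D) (so (M j)) X"
  obtains G \<gamma> where "G \<in> Obj (local_cat D X X)"
    "\<And>j. j \<in> J \<Longrightarrow> \<gamma> j \<in> hom1 (M j) G \<and> sa (\<gamma> j) = k j \<and> ta (\<gamma> j) = k j"
    "\<And>B \<theta>. B \<in> Obj (local_cat D X X) \<Longrightarrow>
        (\<And>j. j \<in> J \<Longrightarrow> \<theta> j \<in> hom1 (M j) B \<and> sa (\<theta> j) = k j \<and> ta (\<theta> j) = k j) \<Longrightarrow>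
        \<exists>!h. h \<in> hom (local_cat D X X) G B \<and> (\<forall>j \<in> J. h \<bullet> \<gamma> j = \<theta> j)"
proof -
  let ?L = "local_cat D X X"
  interpret L: category ?L by (rule category_local[OF X X])
  have "\<forall>j \<in> J. \<exists>N p. N \<in> Obj ?L \<and> p \<in> hom1 (M j) N \<and> sa p = k j \<and> ta p = k j \<and>
    (\<forall>\<theta> B. \<theta> \<in> hom1 (M j) B \<and> sa \<theta> = k j \<and> ta \<theta> = k j \<longrightarrow>
      (\<exists>!h. h \<in> hom ?L N B \<and> h \<bullet> p = \<theta>))"
    using pushforward_exists[OF fib M k] by blast
  then obtain N p where N: "\<And>j. j \<in> J \<Longrightarrow> N j \<in> Obj ?L"
    and p: "\<And>j. j \<in> J \<Longrightarrow> p j \<in> hom1 (M j) (N j) \<and> sa (p j) = k j \<and> ta (p j) = k j"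
    and univ: "\<And>j \<theta> B. j \<in> J \<Longrightarrow> \<theta> \<in> hom1 (M j) B \<and> sa \<theta> = k j \<and> ta \<theta> = k j \<Longrightarrow>
      \<exists>!h. h \<in> hom ?L (N j) B \<and> h \<bullet> p j = \<theta>"
    by metis
  have colim: "has_colimits I ?L" if "category I" for I :: "'i small_cat"
    using st that unfolding stable_local_colimits_def stable_local_colimits_of_def by simp
  obtain G \<iota> where cp: "is_coproduct ?L J N G \<iota>"
    using coproduct_if_colimits[OF L.category_axioms colim e, of N] N by blast
  then have G: "G \<in> Obj ?L" and \<iota>: "\<And>j. j \<in> J \<Longrightarrow> \<iota> j \<in> hom ?L (N j) G"
    by (simp_all add: is_coproduct_def)
  show ?thesis
  proof (rule that[of G "\<lambda>j. \<iota> j \<bullet> p j", OF G])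
    show "\<iota> j \<bullet> p j \<in> hom1 (M j) G \<and> sa (\<iota> j \<bullet> p j) = k j \<and> ta (\<iota> j \<bullet> p j) = k j" if "j \<in> J" for j
      using \<iota>[OF that] p[OF that] k[OF that] by simp
    fix B \<theta>
    assume B: "B \<in> Obj ?L"
      and \<theta>: "\<And>j. j \<in> J \<Longrightarrow> \<theta> j \<in> hom1 (M j) B \<and> sa (\<theta> j) = k j \<and> ta (\<theta> j) = k j"
    have "\<forall>j \<in> J. \<exists>h. h \<in> hom ?L (N j) B \<and> h \<bullet> p j = \<theta> j" using univ \<theta> by blast
    then obtain g where g: "\<And>j. j \<in> J \<Longrightarrow> g j \<in> hom ?L (N j) B" "\<And>j. j \<in> J \<Longrightarrow> g j \<bullet> p j = \<theta> j"
      by metis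
    have key: "h \<bullet> \<iota> j = g j \<longleftrightarrow> h \<bullet> \<iota> j \<bullet> p j = \<theta> j" if h: "h \<in> hom ?L G B" and j: "j \<in> J" for h j
    proof -
      have as: "h \<bullet> \<iota> j \<bullet> p j = (h \<bullet> \<iota> j) \<bullet> p j" using h \<iota>[OF j] p[OF j] by simp
      have hom: "h \<bullet> \<iota> j \<in> hom ?L (N j) B" using h \<iota>[OF j] by simp
      show ?thesis unfolding as
      proof
        assume "h \<bullet> \<iota> j = g j"
        then show "(h \<bullet> \<iota> j) \<bullet> p j = \<theta> j" using g(2)[OF j] by simp
      next
        assume "(h \<bullet> \<iota> j) \<bullet> p j = \<theta> j"
        then show "h \<bullet> \<iota> j = g j"
          using ex1_unique[OF univ[OF j \<theta>[OF j]] conjI[OF hom] conjI[OF g(1)[OF j] g(2)[OF j]]] by simp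
      qed
    qed
    have "\<exists>!h. h \<in> hom ?L G B \<and> (\<forall>j \<in> J. h \<cdot>\<^bsub>?L\<^esub> \<iota> j = g j)"
      by (rule is_coproduct_ex1[OF cp B g(1)])
    moreover have "h \<in> hom ?L G B \<and> (\<forall>j \<in> J. h \<cdot>\<^bsub>?L\<^esub> \<iota> j = g j)
        \<longleftrightarrow> h \<in> hom ?L G B \<and> (\<forall>j \<in> J. h \<bullet> \<iota> j \<bullet> p j = \<theta> j)" for h
      using key unfolding local_cat_simps by blast
    ultimately show "\<exists>!h. h \<in> hom ?L G B \<and> (\<forall>j \<in> J. h \<bullet> \<iota> j \<bullet> p j = \<theta> j)"
      by (simp only:)
  qed
qed

section \<open>The category of monads and restriction along vertical 1-cells\<close>

lemma is_monad_morD: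
  assumes "is_monad_mor D \<A> \<B> \<alpha>"
  shows "\<alpha> \<in> Arr1" "Dom1 \<alpha> = mcell \<A>" "Cod1 \<alpha> = mcell \<B>" "ta \<alpha> = sa \<alpha>"
    "mmult \<B> \<bullet> (\<alpha> \<star> \<alpha>) = \<alpha> \<bullet> mmult \<A>" "\<alpha> \<bullet> munit \<A> = munit \<B> \<bullet> Ua (sa \<alpha>)"
  using assms unfolding is_monad_mor_def by auto

lemma is_monad_mor_id:
  assumes "is_monad D \<A>"
  shows "is_monad_mor D \<A> \<A> (I1 (mcell \<A>))"
  using is_monadD[OF assms refl] by (simp add: is_monad_mor_def hcomp_id)

lemma is_monad_mor_comp:
  assumes A: "is_monad D \<A>" and B: "is_monad D \<B>" and C: "is_monad D \<C>"
    and \<alpha>: "is_monad_mor D \<A> \<B> \<alpha>" and \<beta>: "is_monad_mor D \<B> \<C> \<beta>"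
  shows "is_monad_mor D \<A> \<C> (\<beta> \<bullet> \<alpha>)"
proof -
  note [simp] = is_monadD(1,3-14)[OF A refl] is_monadD(1,3-14)[OF B refl] is_monadD(1,3-14)[OF C refl]
  note [simp] = is_monad_morD(1-4)[OF \<alpha>] is_monad_morD(1-4)[OF \<beta>]
  have "mmult \<C> \<bullet> ((\<beta> \<bullet> \<alpha>) \<star> (\<beta> \<bullet> \<alpha>)) = (mmult \<C> \<bullet> (\<beta> \<star> \<beta>)) \<bullet> (\<alpha> \<star> \<alpha>)" by simp
  also have "\<dots> = \<beta> \<bullet> (mmult \<B> \<bullet> (\<alpha> \<star> \<alpha>))" unfolding is_monad_morD(5)[OF \<beta>] by simp
  also have "\<dots> = (\<beta> \<bullet> \<alpha>) \<bullet> mmult \<A>" unfolding is_monad_morD(5)[OF \<alpha>] by simp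
  finally have mult: "mmult \<C> \<bullet> ((\<beta> \<bullet> \<alpha>) \<star> (\<beta> \<bullet> \<alpha>)) = (\<beta> \<bullet> \<alpha>) \<bullet> mmult \<A>" .
  have "(\<beta> \<bullet> \<alpha>) \<bullet> munit \<A> = \<beta> \<bullet> (\<alpha> \<bullet> munit \<A>)" by simp
  also have "\<dots> = (\<beta> \<bullet> munit \<B>) \<bullet> Ua (sa \<alpha>)" unfolding is_monad_morD(6)[OF \<alpha>] by simp
  also have "\<dots> = munit \<C> \<bullet> Ua (sa (\<beta> \<bullet> \<alpha>))" unfolding is_monad_morD(6)[OF \<beta>] by (simp add: Ua_Comp)
  finally have "(\<beta> \<bullet> \<alpha>) \<bullet> munit \<A> = munit \<C> \<bullet> Ua (sa (\<beta> \<bullet> \<alpha>))" .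
  with mult show ?thesis unfolding is_monad_mor_def by simp
qed

lemma Mnd_simps [simp]:
  "\<A> \<in> Obj (Mnd D) \<longleftrightarrow> is_monad D \<A>"
  "(\<A>, \<alpha>, \<B>) \<in> Arr (Mnd D) \<longleftrightarrow> is_monad D \<A> \<and> is_monad D \<B> \<and> is_monad_mor D \<A> \<B> \<alpha>"
  "Dom (Mnd D) (\<A>, \<alpha>, \<B>) = \<A>" "Cod (Mnd D) (\<A>, \<alpha>, \<B>) = \<B>"
  "Ident (Mnd D) \<A> = (\<A>, I1 (mcell \<A>), \<A>)"
  "(\<B>', \<beta>, \<C>) \<cdot>\<^bsub>Mnd D\<^esub> (\<A>, \<alpha>, \<B>) = (\<A>, \<beta> \<bullet> \<alpha>, \<C>)"
  by (simp_all add: Mnd_def)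

lemma category_Mnd: "category (Mnd D)"
proof
  fix f g h
  show "f \<in> Arr (Mnd D) \<Longrightarrow> Dom (Mnd D) f \<in> Obj (Mnd D)" by (cases f) simp
  show "f \<in> Arr (Mnd D) \<Longrightarrow> Cod (Mnd D) f \<in> Obj (Mnd D)" by (cases f) simp
  show "x \<in> Obj (Mnd D) \<Longrightarrow> Ident (Mnd D) x \<in> hom (Mnd D) x x" for x
    by (simp add: is_monad_mor_id)
  show "\<lbrakk>f \<in> Arr (Mnd D); g \<in> Arr (Mnd D); Dom (Mnd D) g = Cod (Mnd D) f\<rbrakk>
      \<Longrightarrow> g \<cdot>\<^bsub>Mnd D\<^esub> f \<in> hom (Mnd D) (Dom (Mnd D) f) (Cod (Mnd D) g)"
    by (cases f; cases g) (auto intro: is_monad_mor_comp)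
  show "f \<in> Arr (Mnd D) \<Longrightarrow> f \<cdot>\<^bsub>Mnd D\<^esub> Ident (Mnd D) (Dom (Mnd D) f) = f"
    by (cases f) (auto simp: is_monad_mor_def)
  show "f \<in> Arr (Mnd D) \<Longrightarrow> Ident (Mnd D) (Cod (Mnd D) f) \<cdot>\<^bsub>Mnd D\<^esub> f = f"
    by (cases f) (auto simp: is_monad_mor_def)
  show "\<lbrakk>f \<in> Arr (Mnd D); g \<in> Arr (Mnd D); h \<in> Arr (Mnd D); Dom (Mnd D) g = Cod (Mnd D) f;
        Dom (Mnd D) h = Cod (Mnd D) g\<rbrakk>
      \<Longrightarrow> (h \<cdot>\<^bsub>Mnd D\<^esub> g) \<cdot>\<^bsub>Mnd D\<^esub> f = h \<cdot>\<^bsub>Mnd D\<^esub> (g \<cdot>\<^bsub>Mnd D\<^esub> f)"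
    by (cases f; cases g; cases h) (auto simp: is_monad_mor_def)
qed

text \<open>
  Multiplication and unit of \<open>\<B>\<close>, precomposed with the cartesian 2-cell \<open>\<phi>\<close>, factor through \<open>\<phi>\<close>. The
  monad laws for the factorizations are equations between 2-cells into the domain of \<open>\<phi>\<close>, and after
  composing with \<open>\<phi>\<close> they become those of \<open>\<B>\<close>.
\<close>

lemma restricted_monad_exists:
  assumes fib: "fibrant D" and B: "is_monad D \<B>" and f: "f \<in> hom (D0 D) X (so (mcell \<B>))"
  obtains \<B>' \<phi> where "is_monad D \<B>'" "so (mcell \<B>') = X" "cart \<phi>" "is_monad_mor D \<B>' \<B> \<phi>" "sa \<phi> = f"
proof -
  define Y where "Y = so (mcell \<B>)"
  note BD = is_monadD[OF B Y_def]
  note [simp] = BD(1-14)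
  have f' [simp]: "f \<in> Arr (D0 D)" "Dom (D0 D) f = X" "Cod (D0 D) f = Y" using f by simp_all
  have X [simp]: "X \<in> Obj0" using V0.Dom_in[of f] by simp
  obtain \<phi> where c: "cart \<phi>" and \<phi> [simp]: "\<phi> \<in> Arr1" "Cod1 \<phi> = mcell \<B>" "sa \<phi> = f" "ta \<phi> = f"
    and s: "so (Dom1 \<phi>) = X" "to (Dom1 \<phi>) = X"
    using fibrant_cart[OF fib, of "mcell \<B>" f f] by auto
  define B' where "B' = Dom1 \<phi>"
  have B' [simp]: "Dom1 \<phi> = B'" "B' \<in> Obj1" "so B' = X" "to B' = X"
    using s by (simp_all add: B'_def)
  obtain m where m [simp]: "m \<in> Arr1" "Dom1 m = B' \<odot> B'" "Cod1 m = B'"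
      "sa m = I0 X" "ta m = I0 X" and \<phi>m: "\<phi> \<bullet> m = mmult \<B> \<bullet> (\<phi> \<star> \<phi>)"
    using cart_ex[OF c, of "mmult \<B> \<bullet> (\<phi> \<star> \<phi>)" "I0 X" "I0 X"] by auto
  obtain n where n [simp]: "n \<in> Arr1" "Dom1 n = U X" "Cod1 n = B'"
      "sa n = I0 X" "ta n = I0 X" and \<phi>n: "\<phi> \<bullet> n = munit \<B> \<bullet> Ua f"
    using cart_ex[OF c, of "munit \<B> \<bullet> Ua f" "I0 X" "I0 X"] by auto
  have assoc: "m \<bullet> (m \<star> I1 B') = m \<bullet> (I1 B' \<star> m) \<bullet> hassoc D B' B' B'"
  proof (rule cart_unique[OF c])
    have "\<phi> \<bullet> m \<bullet> (m \<star> I1 B') = (\<phi> \<bullet> m) \<bullet> (m \<star> I1 B')" by simp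
    also have "\<dots> = (mmult \<B> \<bullet> (\<phi> \<star> \<phi>)) \<bullet> (m \<star> I1 B')" unfolding \<phi>m ..
    also have "\<dots> = mmult \<B> \<bullet> ((\<phi> \<bullet> m) \<star> \<phi>)" by simp
    also have "\<dots> = (mmult \<B> \<bullet> (mmult \<B> \<star> I1 (mcell \<B>))) \<bullet> ((\<phi> \<star> \<phi>) \<star> \<phi>)" unfolding \<phi>m by simp
    also have "\<dots> = mmult \<B> \<bullet> (I1 (mcell \<B>) \<star> mmult \<B>)
        \<bullet> (hassoc D (mcell \<B>) (mcell \<B>) (mcell \<B>) \<bullet> ((\<phi> \<star> \<phi>) \<star> \<phi>))"
      unfolding BD(15) by simp
    also have "\<dots> = mmult \<B> \<bullet> (\<phi> \<star> (mmult \<B> \<bullet> (\<phi> \<star> \<phi>))) \<bullet> hassoc D B' B' B'"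
      by (subst hassoc_nat) simp_all
    also have "\<dots> = mmult \<B> \<bullet> (\<phi> \<star> (\<phi> \<bullet> m)) \<bullet> hassoc D B' B' B'" unfolding \<phi>m ..
    also have "\<dots> = (mmult \<B> \<bullet> (\<phi> \<star> \<phi>)) \<bullet> (I1 B' \<star> m) \<bullet> hassoc D B' B' B'" by simp
    also have "\<dots> = (\<phi> \<bullet> m) \<bullet> (I1 B' \<star> m) \<bullet> hassoc D B' B' B'" unfolding \<phi>m ..
    also have "\<dots> = \<phi> \<bullet> m \<bullet> (I1 B' \<star> m) \<bullet> hassoc D B' B' B'" by simp
    finally show "\<phi> \<bullet> m \<bullet> (m \<star> I1 B') = \<phi> \<bullet> m \<bullet> (I1 B' \<star> m) \<bullet> hassoc D B' B' B'" .
  qed simp_all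
  have left: "m \<bullet> (n \<star> I1 B') = lunit D B'"
  proof (rule cart_unique[OF c])
    have "\<phi> \<bullet> m \<bullet> (n \<star> I1 B') = (\<phi> \<bullet> m) \<bullet> (n \<star> I1 B')" by simp
    also have "\<dots> = mmult \<B> \<bullet> ((\<phi> \<bullet> n) \<star> \<phi>)" unfolding \<phi>m by simp
    also have "\<dots> = (mmult \<B> \<bullet> (munit \<B> \<star> I1 (mcell \<B>))) \<bullet> (Ua f \<star> \<phi>)" unfolding \<phi>n by simp
    also have "\<dots> = \<phi> \<bullet> lunit D B'" unfolding BD(16) using lunit_nat[of \<phi> "mcell \<B>" f] by simp
    finally show "\<phi> \<bullet> m \<bullet> (n \<star> I1 B') = \<phi> \<bullet> lunit D B'" .
  qed simp_all
  have right: "m \<bullet> (I1 B' \<star> n) = runit D B'"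
  proof (rule cart_unique[OF c])
    have "\<phi> \<bullet> m \<bullet> (I1 B' \<star> n) = (\<phi> \<bullet> m) \<bullet> (I1 B' \<star> n)" by simp
    also have "\<dots> = mmult \<B> \<bullet> (\<phi> \<star> (\<phi> \<bullet> n))" unfolding \<phi>m by simp
    also have "\<dots> = (mmult \<B> \<bullet> (I1 (mcell \<B>) \<star> munit \<B>)) \<bullet> (\<phi> \<star> Ua f)" unfolding \<phi>n by simp
    also have "\<dots> = \<phi> \<bullet> runit D B'" unfolding BD(17) using runit_nat[of \<phi> "mcell \<B>" f] by simp
    finally show "\<phi> \<bullet> m \<bullet> (I1 B' \<star> n) = \<phi> \<bullet> runit D B'" .
  qed simp_all
  let ?B = "\<lparr>mcell = B', mmult = m, munit = n\<rparr>"
  have "is_monad D ?B" using assoc left right by (simp add: is_monad_def Let_def)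
  moreover have "is_monad_mor D ?B \<B> \<phi>" using \<phi>m \<phi>n by (simp add: is_monad_mor_def)
  ultimately show ?thesis using that[of ?B \<phi>] c by simp
qed

text \<open>
  The factorization of a monad morphism through a cartesian monad morphism is a monad morphism,
  since the two equations can be tested after composing with \<open>\<phi>\<close>.
\<close>

lemma monad_mor_lift:
  assumes c: "cart \<phi>" and A: "is_monad D \<A>" and B: "is_monad D \<B>" and B': "is_monad D \<B>'"
    and \<phi>: "is_monad_mor D \<B>' \<B> \<phi>" and \<theta>: "is_monad_mor D \<A> \<B> \<theta>"
    and v: "v \<in> hom (D0 D) (so (mcell \<A>)) (so (mcell \<B>'))" "sa \<theta> = sa \<phi> \<circ>\<^sub>0 v"
  obtains \<theta>' where "is_monad_mor D \<A> \<B>' \<theta>'" "sa \<theta>' = v" "\<phi> \<bullet> \<theta>' = \<theta>"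
proof -
  note [simp] = is_monadD(1,3-14)[OF A refl] is_monadD(1,3-14)[OF B refl] is_monadD(1,3-14)[OF B' refl]
  note [simp] = is_monad_morD(1-4)[OF \<phi>] is_monad_morD(1-4)[OF \<theta>]
  obtain \<theta>' where \<theta>' [simp]: "\<theta>' \<in> Arr1" "Dom1 \<theta>' = mcell \<A>" "Cod1 \<theta>' = mcell \<B>'"
      "sa \<theta>' = v" "ta \<theta>' = v" and eq: "\<phi> \<bullet> \<theta>' = \<theta>"
    using cart_ex[OF c, of \<theta> v v] v by auto
  have [simp]: "v \<in> Arr (D0 D)" "Dom (D0 D) v = so (mcell \<A>)" "Cod (D0 D) v = so (mcell \<B>')"
    using v by simp_all
  have "mmult \<B>' \<bullet> (\<theta>' \<star> \<theta>') = \<theta>' \<bullet> mmult \<A>"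
  proof (rule cart_unique[OF c])
    have "\<phi> \<bullet> mmult \<B>' \<bullet> (\<theta>' \<star> \<theta>') = (\<phi> \<bullet> mmult \<B>') \<bullet> (\<theta>' \<star> \<theta>')" by simp
    also have "\<dots> = mmult \<B> \<bullet> ((\<phi> \<bullet> \<theta>') \<star> (\<phi> \<bullet> \<theta>'))" unfolding is_monad_morD(5)[OF \<phi>, symmetric] by simp
    also have "\<dots> = (\<phi> \<bullet> \<theta>') \<bullet> mmult \<A>" unfolding eq is_monad_morD(5)[OF \<theta>] ..
    also have "\<dots> = \<phi> \<bullet> \<theta>' \<bullet> mmult \<A>" by simp
    finally show "\<phi> \<bullet> mmult \<B>' \<bullet> (\<theta>' \<star> \<theta>') = \<phi> \<bullet> \<theta>' \<bullet> mmult \<A>" .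
  qed simp_all
  moreover have "\<theta>' \<bullet> munit \<A> = munit \<B>' \<bullet> Ua v"
  proof (rule cart_unique[OF c])
    have "\<phi> \<bullet> \<theta>' \<bullet> munit \<A> = (\<phi> \<bullet> \<theta>') \<bullet> munit \<A>" by simp
    also have "\<dots> = munit \<B> \<bullet> Ua (sa \<phi> \<circ>\<^sub>0 v)" unfolding eq is_monad_morD(6)[OF \<theta>] v(2) ..
    also have "\<dots> = (munit \<B> \<bullet> Ua (sa \<phi>)) \<bullet> Ua v" by (simp add: Ua_Comp)
    also have "\<dots> = \<phi> \<bullet> munit \<B>' \<bullet> Ua v" unfolding is_monad_morD(6)[OF \<phi>, symmetric] by simp
    finally show "\<phi> \<bullet> \<theta>' \<bullet> munit \<A> = \<phi> \<bullet> munit \<B>' \<bullet> Ua v" .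
  qed simp_all
  ultimately have "is_monad_mor D \<A> \<B>' \<theta>'" by (simp add: is_monad_mor_def)
  then show ?thesis using that eq by simp
qed

section \<open>Colimits of monads\<close>

text \<open>
  The relations of a colimit monad are indexed by two copies of the objects and one copy of the
  arrows of the diagram shape; infinity of \<open>'i\<close> keeps this index set small.
\<close>

lemma triple_sum_embeds:
  assumes inf: "infinite (UNIV :: 'i set)"
  shows "\<exists>e :: 'i + 'i + 'i \<Rightarrow> 'i. inj e"
proof -
  have "(card_of ((UNIV :: 'i set) <+> (UNIV :: 'i set)), card_of (UNIV :: 'i set)) \<in> ordIso"
    by (rule card_of_Plus_infinite1[OF inf card_of_refl[THEN ordIso_imp_ordLeq]])
  then obtain f :: "'i + 'i \<Rightarrow> 'i" where "bij_betw f UNIV UNIV"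
    using card_of_ordIso by (metis UNIV_Plus_UNIV)
  then have f: "inj f" by (rule bij_betw_imp_inj_on)
  have "inj (f \<circ> map_sum id f)" by (intro inj_compose f sum.inj_map) simp_all
  then show ?thesis by blast
qed

text \<open>
  The colimit monad by generators and relations, over an arbitrary cocone \<open>k\<close> of vertical 1-cells.
  \<open>\<T>\<close> is free on the \<open>\<A> i\<close>, with insertions \<open>t i\<close>; the families \<open>lhs\<close> and \<open>rhs\<close> list the two sides
  of all relations, represented by the parallel pair \<open>u, v : R \<rightarrow> \<T>\<close>; and \<open>\<Q>\<close> is the quotient.
  The point is \<open>coequalizes_iff\<close>: a monad morphism \<open>f\<close> out of \<open>\<T>\<close> coequalizes \<open>u\<close> and \<open>v\<close> exactly if the
  2-cells \<open>f \<bullet> t i\<close> form a cocone of monad morphisms.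
\<close>

lemma cocone_monad_exists:
  fixes I :: "'i small_cat"
  assumes inf: "infinite (UNIV :: 'i set)" and st: "stable_local_colimits TYPE('i) D" and fib: "fibrant D"
    and I: "category I" and X [simp]: "X \<in> Obj0"
    and A: "\<And>i. i \<in> Obj I \<Longrightarrow> is_monad D (\<A> i)"
    and \<alpha>: "\<And>j. j \<in> Arr I \<Longrightarrow> is_monad_mor D (\<A> (Dom I j)) (\<A> (Cod I j)) (\<alpha> j)"
    and k: "\<And>i. i \<in> Obj I \<Longrightarrow> k i \<in> hom (D0 D) (so (mcell (\<A> i))) X"
    and k\<alpha>: "\<And>j. j \<in> Arr I \<Longrightarrow> k (Cod I j) \<circ>\<^sub>0 sa (\<alpha> j) = k (Dom I j)"
  obtains \<Q> \<kappa> where "is_monad D \<Q>" "so (mcell \<Q>) = X"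
    "\<And>i. i \<in> Obj I \<Longrightarrow> is_monad_mor D (\<A> i) \<Q> (\<kappa> i) \<and> sa (\<kappa> i) = k i"
    "\<And>j. j \<in> Arr I \<Longrightarrow> \<kappa> (Cod I j) \<bullet> \<alpha> j = \<kappa> (Dom I j)"
    "\<And>\<B> \<theta>. is_monad D \<B> \<Longrightarrow> so (mcell \<B>) = X \<Longrightarrow>
      (\<And>i. i \<in> Obj I \<Longrightarrow> is_monad_mor D (\<A> i) \<B> (\<theta> i) \<and> sa (\<theta> i) = k i) \<Longrightarrow>
      (\<And>j. j \<in> Arr I \<Longrightarrow> \<theta> (Cod I j) \<bullet> \<alpha> j = \<theta> (Dom I j)) \<Longrightarrow>
      \<exists>!h. monad_mor_on X \<Q> \<B> h \<and> (\<forall>i \<in> Obj I. h \<bullet> \<kappa> i = \<theta> i)"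
proof -
  interpret I: category I by (rule I)
  let ?L = "local_cat D X X"
  note AD [simp] = is_monadD(1,3-14)[OF A refl]
  note \<alpha>D [simp] = is_monad_morD(1-4)[OF \<alpha>]
  have kD [simp]: "k i \<in> Arr (D0 D)" "Dom (D0 D) (k i) = so (mcell (\<A> i))" "Cod (D0 D) (k i) = X"
    if "i \<in> Obj I" for i using k[OF that] by simp_all
  obtain G \<gamma> where G: "G \<in> Obj ?L"
    and \<gamma>: "\<And>i. i \<in> Obj I \<Longrightarrow> \<gamma> i \<in> hom1 (mcell (\<A> i)) G \<and> sa (\<gamma> i) = k i \<and> ta (\<gamma> i) = k i"
    and G_univ: "\<And>B \<theta>. B \<in> Obj ?L \<Longrightarrow>
        (\<And>i. i \<in> Obj I \<Longrightarrow> \<theta> i \<in> hom1 (mcell (\<A> i)) B \<and> sa (\<theta> i) = k i \<and> ta (\<theta> i) = k i) \<Longrightarrow>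
        \<exists>!h. h \<in> hom ?L G B \<and> (\<forall>i \<in> Obj I. h \<bullet> \<gamma> i = \<theta> i)"
    by (rule pushforward_coproduct_exists[OF st fib X inj_on_id[of "Obj I"], of "\<lambda>i. mcell (\<A> i)" k])
      (use k in auto)
  obtain \<T> g where T: "is_monad D \<T>" "so (mcell \<T>) = X" and g: "g \<in> hom ?L G (mcell \<T>)"
    and T_univ: "\<And>\<B> f. is_monad D \<B> \<Longrightarrow> so (mcell \<B>) = X \<Longrightarrow> f \<in> hom ?L G (mcell \<B>) \<Longrightarrow>
      \<exists>!h. monad_mor_on X \<T> \<B> h \<and> h \<bullet> g = f"
    using free_monad_exists[OF inf st X G] by blast
  note TD [simp] = is_monadD(1-14)[OF T(1) T(2)[symmetric]]
  define t where "t i = g \<bullet> \<gamma> i" for i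
  have t [simp]: "t i \<in> Arr1" "Dom1 (t i) = mcell (\<A> i)" "Cod1 (t i) = mcell \<T>"
      "sa (t i) = k i" "ta (t i) = k i" if "i \<in> Obj I" for i
    using \<gamma>[OF that] g that by (simp_all add: t_def)
  \<comment> \<open>Every object contributes one relation for multiplication and one for the unit, every arrow one
    for compatibility with the diagram.\<close>
  define J where "J = Obj I <+> (Obj I <+> Arr I)"
  define M where "M = case_sum (\<lambda>i. mcell (\<A> i) \<odot> mcell (\<A> i))
    (case_sum (\<lambda>i. U (so (mcell (\<A> i)))) (\<lambda>j. mcell (\<A> (Dom I j))))"
  define K where "K = case_sum k (case_sum k (\<lambda>j. k (Dom I j)))"
  define lhs where "lhs = case_sum (\<lambda>i. t i \<bullet> mmult (\<A> i))
    (case_sum (\<lambda>i. t i \<bullet> munit (\<A> i)) (\<lambda>j. t (Dom I j)))"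
  define rhs where "rhs = case_sum (\<lambda>i. mmult \<T> \<bullet> (t i \<star> t i))
    (case_sum (\<lambda>i. munit \<T> \<bullet> Ua (k i)) (\<lambda>j. t (Cod I j) \<bullet> \<alpha> j))"
  have M: "M r \<in> Obj1" "to (M r) = so (M r)" "K r \<in> hom (D0 D) (so (M r)) X"
    and lhs: "lhs r \<in> hom1 (M r) (mcell \<T>) \<and> sa (lhs r) = K r \<and> ta (lhs r) = K r"
    and rhs: "rhs r \<in> hom1 (M r) (mcell \<T>) \<and> sa (rhs r) = K r \<and> ta (rhs r) = K r"
    if "r \<in> J" for r
    using that by (auto simp: J_def M_def K_def lhs_def rhs_def k\<alpha>)
  obtain e :: "'i + 'i + 'i \<Rightarrow> 'i" where "inj e" using triple_sum_embeds[OF inf] by blast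
  then have e: "inj_on e J" by (rule inj_on_subset) simp
  obtain R \<rho> where R: "R \<in> Obj ?L"
    and \<rho>: "\<And>r. r \<in> J \<Longrightarrow> \<rho> r \<in> hom1 (M r) R \<and> sa (\<rho> r) = K r \<and> ta (\<rho> r) = K r"
    and R_univ: "\<And>B \<theta>. B \<in> Obj ?L \<Longrightarrow>
        (\<And>r. r \<in> J \<Longrightarrow> \<theta> r \<in> hom1 (M r) B \<and> sa (\<theta> r) = K r \<and> ta (\<theta> r) = K r) \<Longrightarrow>
        \<exists>!h. h \<in> hom ?L R B \<and> (\<forall>r \<in> J. h \<bullet> \<rho> r = \<theta> r)"
    by (rule pushforward_coproduct_exists[OF st fib X e, of M K]) (use M in auto)
  have TL: "mcell \<T> \<in> Obj ?L" by simp
  obtain u where u: "u \<in> hom ?L R (mcell \<T>)" "\<And>r. r \<in> J \<Longrightarrow> u \<bullet> \<rho> r = lhs r"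
    using R_univ[OF TL lhs] by blast
  obtain v where v: "v \<in> hom ?L R (mcell \<T>)" "\<And>r. r \<in> J \<Longrightarrow> v \<bullet> \<rho> r = rhs r"
    using R_univ[OF TL rhs] by blast
  have coequalizes_iff: "f \<bullet> u = f \<bullet> v \<longleftrightarrow>
      (\<forall>i \<in> Obj I. is_monad_mor D (\<A> i) \<B> (f \<bullet> t i)) \<and>
      (\<forall>j \<in> Arr I. (f \<bullet> t (Cod I j)) \<bullet> \<alpha> j = f \<bullet> t (Dom I j))"
    if B: "is_monad D \<B>" "so (mcell \<B>) = X" and f: "monad_mor_on X \<T> \<B> f" for \<B> f
  proof -
    note [simp] = is_monadD(1-14)[OF B(1) B(2)[symmetric]]
    have fm: "is_monad_mor D \<T> \<B> f" and fX [simp]: "sa f = I0 X" using f by (simp_all add: monad_mor_on_def)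
    note fD [simp] = is_monad_morD(1-4)[OF fm]
    have "f \<bullet> u = f \<bullet> v \<longleftrightarrow> (\<forall>r \<in> J. f \<bullet> lhs r = f \<bullet> rhs r)"
    proof
      assume eq: "f \<bullet> u = f \<bullet> v"
      show "\<forall>r \<in> J. f \<bullet> lhs r = f \<bullet> rhs r"
      proof
        fix r assume r: "r \<in> J"
        have "(f \<bullet> u) \<bullet> \<rho> r = (f \<bullet> v) \<bullet> \<rho> r" unfolding eq ..
        then show "f \<bullet> lhs r = f \<bullet> rhs r"
          using u v \<rho>[OF r] by (simp add: u(2)[OF r] v(2)[OF r])
      qed
    next
      assume eq: "\<forall>r \<in> J. f \<bullet> lhs r = f \<bullet> rhs r"
      have "\<exists>!h. h \<in> hom ?L R (mcell \<B>) \<and> (\<forall>r \<in> J. h \<bullet> \<rho> r = f \<bullet> lhs r)"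
        by (rule R_univ) (use lhs M in auto)
      moreover have "f \<bullet> u \<in> hom ?L R (mcell \<B>) \<and> (\<forall>r \<in> J. (f \<bullet> u) \<bullet> \<rho> r = f \<bullet> lhs r)"
        using u \<rho> by simp
      moreover have "f \<bullet> v \<in> hom ?L R (mcell \<B>) \<and> (\<forall>r \<in> J. (f \<bullet> v) \<bullet> \<rho> r = f \<bullet> lhs r)"
        using v \<rho> eq by simp
      ultimately show "f \<bullet> u = f \<bullet> v" by (rule ex1_unique)
    qed
    moreover have "f \<bullet> lhs (Inl i) = f \<bullet> rhs (Inl i) \<and> f \<bullet> lhs (Inr (Inl i)) = f \<bullet> rhs (Inr (Inl i))
        \<longleftrightarrow> is_monad_mor D (\<A> i) \<B> (f \<bullet> t i)" if i: "i \<in> Obj I" for i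
    proof -
      note [simp] = t[OF i] AD[OF i] kD[OF i]
      have "f \<bullet> rhs (Inl i) = (f \<bullet> mmult \<T>) \<bullet> (t i \<star> t i)" by (simp add: rhs_def)
      also have "\<dots> = mmult \<B> \<bullet> ((f \<bullet> t i) \<star> (f \<bullet> t i))"
        unfolding is_monad_morD(5)[OF fm, symmetric] by simp
      finally have 1: "f \<bullet> rhs (Inl i) = mmult \<B> \<bullet> ((f \<bullet> t i) \<star> (f \<bullet> t i))" .
      have "f \<bullet> rhs (Inr (Inl i)) = (f \<bullet> munit \<T>) \<bullet> Ua (k i)" by (simp add: rhs_def)
      also have "\<dots> = munit \<B> \<bullet> Ua (sa (f \<bullet> t i))"
        unfolding is_monad_morD(6)[OF fm] by simp
      finally have 2: "f \<bullet> rhs (Inr (Inl i)) = munit \<B> \<bullet> Ua (sa (f \<bullet> t i))" .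
      have "f \<bullet> lhs (Inl i) = (f \<bullet> t i) \<bullet> mmult (\<A> i)" "f \<bullet> lhs (Inr (Inl i)) = (f \<bullet> t i) \<bullet> munit (\<A> i)"
        by (simp_all add: lhs_def)
      with 1 2 show ?thesis unfolding is_monad_mor_def by auto
    qed
    moreover have "f \<bullet> lhs (Inr (Inr j)) = f \<bullet> rhs (Inr (Inr j))
        \<longleftrightarrow> (f \<bullet> t (Cod I j)) \<bullet> \<alpha> j = f \<bullet> t (Dom I j)" if j: "j \<in> Arr I" for j
      using j by (auto simp: lhs_def rhs_def)
    ultimately show ?thesis unfolding J_def by auto
  qed
  obtain \<Q> q where Q: "is_monad D \<Q>" "so (mcell \<Q>) = X" and q: "monad_mor_on X \<T> \<Q> q" and quv: "q \<bullet> u = q \<bullet> v"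
    and Q_univ: "\<And>\<B> f. is_monad D \<B> \<Longrightarrow> so (mcell \<B>) = X \<Longrightarrow> monad_mor_on X \<T> \<B> f \<Longrightarrow> f \<bullet> u = f \<bullet> v \<Longrightarrow>
      \<exists>!h. monad_mor_on X \<Q> \<B> h \<and> h \<bullet> q = f"
    using quotient_monad_exists[OF inf st X T u(1) v(1)] by blast
  note QD [simp] = is_monadD(1-14)[OF Q(1) Q(2)[symmetric]]
  have qm: "is_monad_mor D \<T> \<Q> q" and qX [simp]: "sa q = I0 X" using q by (simp_all add: monad_mor_on_def)
  note qD [simp] = is_monad_morD(1-4)[OF qm]
  show ?thesis
  proof (rule that[of \<Q> "\<lambda>i. q \<bullet> t i", OF Q])
    show "is_monad_mor D (\<A> i) \<Q> (q \<bullet> t i) \<and> sa (q \<bullet> t i) = k i" if "i \<in> Obj I" for i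
      using coequalizes_iff[OF Q q] quv that by simp
    show "(q \<bullet> t (Cod I j)) \<bullet> \<alpha> j = q \<bullet> t (Dom I j)" if "j \<in> Arr I" for j
      using coequalizes_iff[OF Q q] quv that by blast
    fix \<B> \<theta>
    assume B: "is_monad D \<B>" "so (mcell \<B>) = X"
      and \<theta>: "\<And>i. i \<in> Obj I \<Longrightarrow> is_monad_mor D (\<A> i) \<B> (\<theta> i) \<and> sa (\<theta> i) = k i"
      and \<theta>\<alpha>: "\<And>j. j \<in> Arr I \<Longrightarrow> \<theta> (Cod I j) \<bullet> \<alpha> j = \<theta> (Dom I j)"
    note [simp] = is_monadD(1-14)[OF B(1) B(2)[symmetric]]
    have BL: "mcell \<B> \<in> Obj ?L" by simp
    have \<theta>_hom: "\<theta> i \<in> hom1 (mcell (\<A> i)) (mcell \<B>) \<and> sa (\<theta> i) = k i \<and> ta (\<theta> i) = k i"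
      if "i \<in> Obj I" for i using \<theta>[OF that] is_monad_morD(1-4)[of "\<A> i" \<B> "\<theta> i"] by simp
    note G_univ_\<theta> = G_univ[OF BL \<theta>_hom]
    obtain h0 where h0: "h0 \<in> hom ?L G (mcell \<B>)" "\<And>i. i \<in> Obj I \<Longrightarrow> h0 \<bullet> \<gamma> i = \<theta> i"
      using G_univ_\<theta> by blast
    have T_univ_h0: "\<exists>!f. monad_mor_on X \<T> \<B> f \<and> f \<bullet> g = h0" by (rule T_univ[OF B h0(1)])
    then obtain f where f: "monad_mor_on X \<T> \<B> f" "f \<bullet> g = h0" by blast
    have monad_mor_on_typing: "x \<in> Arr1 \<and> Dom1 x = mcell \<C> \<and> Cod1 x = mcell \<B> \<and> sa x = I0 X \<and> ta x = I0 X"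
      if "monad_mor_on X \<C> \<B> x" for x \<C> using that is_monad_morD[of \<C> \<B> x] by (simp add: monad_mor_on_def)
    have assoc_t: "x \<bullet> t i = (x \<bullet> g) \<bullet> \<gamma> i" if "monad_mor_on X \<T> \<B> x" "i \<in> Obj I" for x i
      using monad_mor_on_typing[OF that(1)] \<gamma>[OF that(2)] g by (simp add: t_def)
    have ft: "f \<bullet> t i = \<theta> i" if "i \<in> Obj I" for i
      using assoc_t[OF f(1) that] f(2) h0(2)[OF that] by simp
    have fuv: "f \<bullet> u = f \<bullet> v"
      unfolding coequalizes_iff[OF B f(1)] using ft \<theta> \<theta>\<alpha> by simp
    have Q_univ_f: "\<exists>!h. monad_mor_on X \<Q> \<B> h \<and> h \<bullet> q = f" by (rule Q_univ[OF B f(1) fuv])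
    have assoc_q: "h \<bullet> q \<bullet> t i = (h \<bullet> q) \<bullet> t i" if "monad_mor_on X \<Q> \<B> h" "i \<in> Obj I" for h i
      using monad_mor_on_typing[OF that(1)] that(2) by simp
    have "monad_mor_on X \<Q> \<B> h \<and> h \<bullet> q = f \<longleftrightarrow> monad_mor_on X \<Q> \<B> h \<and> (\<forall>i \<in> Obj I. h \<bullet> q \<bullet> t i = \<theta> i)" for h
    proof (intro iffI conjI; elim conjE)
      assume h: "monad_mor_on X \<Q> \<B> h" and "h \<bullet> q = f"
      then show "\<forall>i \<in> Obj I. h \<bullet> q \<bullet> t i = \<theta> i" using assoc_q[OF h] ft by simp
    next
      assume h: "monad_mor_on X \<Q> \<B> h" and eq: "\<forall>i \<in> Obj I. h \<bullet> q \<bullet> t i = \<theta> i"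
      have hq: "monad_mor_on X \<T> \<B> (h \<bullet> q)"
        using h monad_mor_on_typing[OF h] is_monad_mor_comp[OF T(1) Q(1) B(1) qm] by (simp add: monad_mor_on_def)
      have "\<forall>i \<in> Obj I. ((h \<bullet> q) \<bullet> g) \<bullet> \<gamma> i = \<theta> i" using assoc_t[OF hq] assoc_q[OF h] eq by simp
      moreover have "(h \<bullet> q) \<bullet> g \<in> hom ?L G (mcell \<B>)" using monad_mor_on_typing[OF hq] g by simp
      ultimately have "(h \<bullet> q) \<bullet> g = h0"
        using ex1_unique[OF G_univ_\<theta>, of "(h \<bullet> q) \<bullet> g" h0] h0 by blast
      with hq show "h \<bullet> q = f" using ex1_unique[OF T_univ_h0, of "h \<bullet> q" f] f by blast
    qed blast+
    with Q_univ_f show "\<exists>!h. monad_mor_on X \<Q> \<B> h \<and> (\<forall>i \<in> Obj I. h \<bullet> q \<bullet> t i = \<theta> i)"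
      by (simp only:)
  qed
qed

lemma Mnd_hom_cases:
  assumes "x \<in> hom (Mnd D) \<A> \<B>"
  obtains \<alpha> where "x = (\<A>, \<alpha>, \<B>)" "is_monad D \<A>" "is_monad D \<B>" "is_monad_mor D \<A> \<B> \<alpha>"
  using assms by (cases x) auto

text \<open>
  The colimit \<open>X\<close> of 0-cells carries the monad \<open>\<Q>\<close> above. A cocone \<open>\<mu>\<close> to a monad \<open>\<B>\<close> on any
  0-cell determines the vertical part \<open>f\<close> of the mediating morphism, and restricting \<open>\<B>\<close> along \<open>f\<close>
  reduces existence and uniqueness of its 2-cell to monads on \<open>X\<close>.
\<close>

theorem has_colimits_Mnd:
  fixes I :: "'i small_cat"
  assumes inf: "infinite (UNIV :: 'i set)" and st: "stable_local_colimits TYPE('i) D" and fib: "fibrant D"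
    and I: "category I"
  shows "has_colimits I (Mnd D)"
  unfolding has_colimits_def
proof (intro allI impI)
  fix F :: "('i, 'i, ('h, 'c) monad, ('h, 'c) monad \<times> 'c \<times> ('h, 'c) monad) ftor"
  assume F: "is_functor I (Mnd D) F"
  interpret I: category I by (rule I)
  note FD = is_functorD[OF F]
  define \<A> where "\<A> = fobj F"
  define \<alpha> where "\<alpha> j = fst (snd (farr F j))" for j
  have A: "is_monad D (\<A> i)" if "i \<in> Obj I" for i using FD(3)[OF that] by (simp add: \<A>_def)
  have F\<alpha>: "farr F j = (\<A> (Dom I j), \<alpha> j, \<A> (Cod I j))"
    and \<alpha>: "is_monad_mor D (\<A> (Dom I j)) (\<A> (Cod I j)) (\<alpha> j)" if "j \<in> Arr I" for j
  proof -
    have "farr F j \<in> hom (Mnd D) (\<A> (Dom I j)) (\<A> (Cod I j))" using FD(4-6)[OF that] by (simp add: \<A>_def)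
    then obtain a where a: "farr F j = (\<A> (Dom I j), a, \<A> (Cod I j))"
      and m: "is_monad_mor D (\<A> (Dom I j)) (\<A> (Cod I j)) a" by (rule Mnd_hom_cases)
    have "\<alpha> j = a" by (simp add: \<alpha>_def a)
    with a m show "farr F j = (\<A> (Dom I j), \<alpha> j, \<A> (Cod I j))"
      "is_monad_mor D (\<A> (Dom I j)) (\<A> (Cod I j)) (\<alpha> j)"
      by simp_all
  qed
  note AD [simp] = is_monadD(1,3-14)[OF A refl]
  note \<alpha>D [simp] = is_monad_morD(1-4)[OF \<alpha>]
  define F0 :: "('i, 'i, 'o, 'v) ftor" where "F0 = \<lparr>fobj = \<lambda>i. so (mcell (\<A> i)), farr = \<lambda>j. sa (\<alpha> j)\<rparr>"
  have F0 [simp]: "fobj F0 i = so (mcell (\<A> i))" "farr F0 j = sa (\<alpha> j)" for i j by (simp_all add: F0_def)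
  have "is_functor I (D0 D) F0"
  proof (rule is_functor.intro[OF I category_D0])
    fix i assume i: "i \<in> Obj I"
    have "\<alpha> (Ident I i) = I1 (mcell (\<A> i))" using FD(7)[OF i] by (simp add: \<alpha>_def \<A>_def)
    then show "farr F0 (Ident I i) = I0 (fobj F0 i)" using i by simp
  next
    fix j j' assume j: "j \<in> Arr I" "j' \<in> Arr I" "Dom I j' = Cod I j"
    have "farr F (j' \<cdot>\<^bsub>I\<^esub> j) = (\<A> (Dom I j'), \<alpha> j', \<A> (Cod I j')) \<cdot>\<^bsub>Mnd D\<^esub> (\<A> (Dom I j), \<alpha> j, \<A> (Cod I j))"
      unfolding FD(8)[OF j] F\<alpha>[OF j(1)] F\<alpha>[OF j(2)] ..
    then have "\<alpha> (j' \<cdot>\<^bsub>I\<^esub> j) = \<alpha> j' \<bullet> \<alpha> j"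
      unfolding \<alpha>_def[of "j' \<cdot>\<^bsub>I\<^esub> j"] by simp
    then show "farr F0 (j' \<cdot>\<^bsub>I\<^esub> j) = farr F0 j' \<circ>\<^sub>0 farr F0 j" using j by simp
  qed simp_all
  then obtain X k where Xk: "is_colimit I (D0 D) F0 X k"
    using st I unfolding stable_local_colimits_def stable_local_colimits_of_def has_colimits_def by blast
  then have X [simp]: "X \<in> Obj0"
    and k: "\<And>i. i \<in> Obj I \<Longrightarrow> k i \<in> hom (D0 D) (so (mcell (\<A> i))) X"
    and k\<alpha>: "\<And>j. j \<in> Arr I \<Longrightarrow> k (Cod I j) \<circ>\<^sub>0 sa (\<alpha> j) = k (Dom I j)"
    unfolding is_colimit_def is_cocone_def by simp_all
  have kD [simp]: "k i \<in> Arr (D0 D)" "Dom (D0 D) (k i) = so (mcell (\<A> i))" "Cod (D0 D) (k i) = X"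
    if "i \<in> Obj I" for i using k[OF that] by simp_all
  obtain \<Q> \<kappa> where Q: "is_monad D \<Q>" "so (mcell \<Q>) = X"
    and \<kappa>: "\<And>i. i \<in> Obj I \<Longrightarrow> is_monad_mor D (\<A> i) \<Q> (\<kappa> i) \<and> sa (\<kappa> i) = k i"
    and \<kappa>\<alpha>: "\<And>j. j \<in> Arr I \<Longrightarrow> \<kappa> (Cod I j) \<bullet> \<alpha> j = \<kappa> (Dom I j)"
    and Q_univ: "\<And>\<B> \<theta>. is_monad D \<B> \<Longrightarrow> so (mcell \<B>) = X \<Longrightarrow>
      (\<And>i. i \<in> Obj I \<Longrightarrow> is_monad_mor D (\<A> i) \<B> (\<theta> i) \<and> sa (\<theta> i) = k i) \<Longrightarrow>
      (\<And>j. j \<in> Arr I \<Longrightarrow> \<theta> (Cod I j) \<bullet> \<alpha> j = \<theta> (Dom I j)) \<Longrightarrow>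
      \<exists>!h. monad_mor_on X \<Q> \<B> h \<and> (\<forall>i \<in> Obj I. h \<bullet> \<kappa> i = \<theta> i)"
    by (rule cocone_monad_exists[OF inf st fib I X, of \<A> \<alpha> k]) (use A \<alpha> k k\<alpha> in blast)+
  have \<kappa>m: "is_monad_mor D (\<A> i) \<Q> (\<kappa> i)" if "i \<in> Obj I" for i using \<kappa>[OF that] by blast
  note QD [simp] = is_monadD(1-14)[OF Q(1) Q(2)[symmetric]]
  have \<kappa>D [simp]: "\<kappa> i \<in> Arr1" "Dom1 (\<kappa> i) = mcell (\<A> i)" "Cod1 (\<kappa> i) = mcell \<Q>"
    "sa (\<kappa> i) = k i" "ta (\<kappa> i) = k i" if "i \<in> Obj I" for i
    using is_monad_morD(1-4)[OF \<kappa>m[OF that]] \<kappa>[OF that] by simp_all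
  have "is_colimit I (Mnd D) F \<Q> (\<lambda>i. (\<A> i, \<kappa> i, \<Q>))"
    unfolding is_colimit_def
  proof (intro conjI allI impI)
    show "is_cocone I (Mnd D) F \<Q> (\<lambda>i. (\<A> i, \<kappa> i, \<Q>))"
      using A Q \<kappa>m \<kappa>\<alpha> by (simp add: is_cocone_def F\<alpha> \<A>_def[symmetric])
    fix \<B> \<mu> assume cocone: "is_cocone I (Mnd D) F \<B> \<mu>"
    define \<nu> where "\<nu> i = fst (snd (\<mu> i))" for i
    have B: "is_monad D \<B>" using cocone by (simp add: is_cocone_def)
    have \<mu>\<nu>: "\<mu> i = (\<A> i, \<nu> i, \<B>)" and \<nu>: "is_monad_mor D (\<A> i) \<B> (\<nu> i)" if "i \<in> Obj I" for i
    proof -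
      have "\<mu> i \<in> hom (Mnd D) (\<A> i) \<B>" using cocone that unfolding is_cocone_def \<A>_def by blast
      then obtain a where a: "\<mu> i = (\<A> i, a, \<B>)" and m: "is_monad_mor D (\<A> i) \<B> a"
        by (rule Mnd_hom_cases)
      have "\<nu> i = a" by (simp add: \<nu>_def a)
      with a m show "\<mu> i = (\<A> i, \<nu> i, \<B>)" "is_monad_mor D (\<A> i) \<B> (\<nu> i)"
        by simp_all
    qed
    have \<nu>\<alpha>: "\<nu> (Cod I j) \<bullet> \<alpha> j = \<nu> (Dom I j)" if j: "j \<in> Arr I" for j
    proof -
      have "\<mu> (Cod I j) \<cdot>\<^bsub>Mnd D\<^esub> farr F j = \<mu> (Dom I j)" using cocone j unfolding is_cocone_def by blast
      then show ?thesis using j by (simp add: \<mu>\<nu> F\<alpha>)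
    qed
    note BD [simp] = is_monadD(1,3-14)[OF B refl]
    note \<nu>D [simp] = is_monad_morD(1-4)[OF \<nu>]
    have "is_cocone I (D0 D) F0 (so (mcell \<B>)) (\<lambda>i. sa (\<nu> i))"
      unfolding is_cocone_def
    proof (intro conjI ballI)
      fix j assume j: "j \<in> Arr I"
      then show "sa (\<nu> (Cod I j)) \<circ>\<^sub>0 farr F0 j = sa (\<nu> (Dom I j))"
        using arg_cong[OF \<nu>\<alpha>[OF j], of sa] by simp
    qed simp_all
    note f_ex1 = is_colimit_ex1[OF Xk this]
    then obtain f where f: "f \<in> hom (D0 D) X (so (mcell \<B>))"
      and fk: "\<And>i. i \<in> Obj I \<Longrightarrow> f \<circ>\<^sub>0 k i = sa (\<nu> i)" by blast
    obtain \<B>' \<phi> where B': "is_monad D \<B>'" "so (mcell \<B>') = X" and c: "cart \<phi>"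
      and \<phi>m: "is_monad_mor D \<B>' \<B> \<phi>" and \<phi>f [simp]: "sa \<phi> = f"
      by (rule restricted_monad_exists[OF fib B f])
    note B'D [simp] = is_monadD(1-14)[OF B'(1) B'(2)[symmetric]]
    note \<phi>D [simp] = is_monad_morD(1-4)[OF \<phi>m]
    have fD [simp]: "f \<in> Arr (D0 D)" "Dom (D0 D) f = X" "Cod (D0 D) f = so (mcell \<B>)" using f by simp_all
    have "\<forall>i \<in> Obj I. \<exists>\<theta>. is_monad_mor D (\<A> i) \<B>' \<theta> \<and> sa \<theta> = k i \<and> \<phi> \<bullet> \<theta> = \<nu> i"
    proof
      fix i assume i: "i \<in> Obj I"
      show "\<exists>\<theta>. is_monad_mor D (\<A> i) \<B>' \<theta> \<and> sa \<theta> = k i \<and> \<phi> \<bullet> \<theta> = \<nu> i"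
        by (rule monad_mor_lift[OF c A[OF i] B B'(1) \<phi>m \<nu>[OF i], of "k i"]) (use i fk in auto)
    qed
    then obtain \<theta> where \<theta>: "\<And>i. i \<in> Obj I \<Longrightarrow> is_monad_mor D (\<A> i) \<B>' (\<theta> i) \<and> sa (\<theta> i) = k i"
      and \<phi>\<theta>: "\<And>i. i \<in> Obj I \<Longrightarrow> \<phi> \<bullet> \<theta> i = \<nu> i" by metis
    have \<theta>D [simp]: "\<theta> i \<in> Arr1" "Dom1 (\<theta> i) = mcell (\<A> i)" "Cod1 (\<theta> i) = mcell \<B>'"
      "sa (\<theta> i) = k i" "ta (\<theta> i) = k i" if "i \<in> Obj I" for i
      using is_monad_morD(1-4)[OF conjunct1[OF \<theta>[OF that]]] \<theta>[OF that] by simp_all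
    have \<theta>\<alpha>: "\<theta> (Cod I j) \<bullet> \<alpha> j = \<theta> (Dom I j)" if j: "j \<in> Arr I" for j
    proof (rule cart_unique[OF c])
      have "\<phi> \<bullet> \<theta> (Cod I j) \<bullet> \<alpha> j = (\<phi> \<bullet> \<theta> (Cod I j)) \<bullet> \<alpha> j" using j by simp
      also have "\<dots> = \<phi> \<bullet> \<theta> (Dom I j)" using j by (simp add: \<phi>\<theta> \<nu>\<alpha>)
      finally show "\<phi> \<bullet> \<theta> (Cod I j) \<bullet> \<alpha> j = \<phi> \<bullet> \<theta> (Dom I j)" .
    qed (use j k\<alpha> in simp_all)
    have h_ex1: "\<exists>!h. monad_mor_on X \<Q> \<B>' h \<and> (\<forall>i \<in> Obj I. h \<bullet> \<kappa> i = \<theta> i)"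
      by (rule Q_univ[OF B' \<theta> \<theta>\<alpha>])
    then obtain h where h: "monad_mor_on X \<Q> \<B>' h" and h\<kappa>: "\<And>i. i \<in> Obj I \<Longrightarrow> h \<bullet> \<kappa> i = \<theta> i" by blast
    have hm: "is_monad_mor D \<Q> \<B>' h" and hX [simp]: "sa h = I0 X" using h by (simp_all add: monad_mor_on_def)
    note hD [simp] = is_monad_morD(1-4)[OF hm]
    have \<phi>h: "is_monad_mor D \<Q> \<B> (\<phi> \<bullet> h)" by (rule is_monad_mor_comp[OF Q(1) B'(1) B hm \<phi>m])
    show "\<exists>!g. g \<in> hom (Mnd D) \<Q> \<B> \<and> (\<forall>i \<in> Obj I. g \<cdot>\<^bsub>Mnd D\<^esub> (\<A> i, \<kappa> i, \<Q>) = \<mu> i)"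
    proof (rule ex1I[of _ "(\<Q>, \<phi> \<bullet> h, \<B>)"])
      have "(\<phi> \<bullet> h) \<bullet> \<kappa> i = \<nu> i" if "i \<in> Obj I" for i using that by (simp add: h\<kappa> \<phi>\<theta>)
      then show "(\<Q>, \<phi> \<bullet> h, \<B>) \<in> hom (Mnd D) \<Q> \<B> \<and>
          (\<forall>i \<in> Obj I. (\<Q>, \<phi> \<bullet> h, \<B>) \<cdot>\<^bsub>Mnd D\<^esub> (\<A> i, \<kappa> i, \<Q>) = \<mu> i)"
        using Q B \<phi>h by (simp add: \<mu>\<nu>)
    next
      fix g assume g: "g \<in> hom (Mnd D) \<Q> \<B> \<and> (\<forall>i \<in> Obj I. g \<cdot>\<^bsub>Mnd D\<^esub> (\<A> i, \<kappa> i, \<Q>) = \<mu> i)"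
      then obtain x where gx: "g = (\<Q>, x, \<B>)" and x: "is_monad_mor D \<Q> \<B> x" by (blast elim: Mnd_hom_cases)
      note xD [simp] = is_monad_morD(1-4)[OF x]
      have x\<kappa>: "x \<bullet> \<kappa> i = \<nu> i" if i: "i \<in> Obj I" for i
      proof -
        have "g \<cdot>\<^bsub>Mnd D\<^esub> (\<A> i, \<kappa> i, \<Q>) = \<mu> i" using g i by blast
        then show ?thesis unfolding gx \<mu>\<nu>[OF i] by simp
      qed
      have "sa x \<circ>\<^sub>0 k i = sa (\<nu> i)" if "i \<in> Obj I" for i
        using arg_cong[OF x\<kappa>[OF that], of sa] that by simp
      then have "sa x \<in> hom (D0 D) X (so (mcell \<B>)) \<and> (\<forall>i \<in> Obj I. sa x \<circ>\<^sub>0 k i = sa (\<nu> i))" by simp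
      moreover have "f \<in> hom (D0 D) X (so (mcell \<B>)) \<and> (\<forall>i \<in> Obj I. f \<circ>\<^sub>0 k i = sa (\<nu> i))"
        using f fk by blast
      ultimately have xf: "sa x = f" by (rule ex1_unique[OF f_ex1])
      obtain y where y: "is_monad_mor D \<Q> \<B>' y" and yX [simp]: "sa y = I0 X" and \<phi>y: "\<phi> \<bullet> y = x"
        by (rule monad_mor_lift[OF c Q(1) B B'(1) \<phi>m x, of "I0 X"]) (use xf in auto)
      note yD [simp] = is_monad_morD(1-4)[OF y]
      have "y \<bullet> \<kappa> i = \<theta> i" if i: "i \<in> Obj I" for i
      proof (rule cart_unique[OF c])
        have "\<phi> \<bullet> y \<bullet> \<kappa> i = (\<phi> \<bullet> y) \<bullet> \<kappa> i" using i by simp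
        then show "\<phi> \<bullet> y \<bullet> \<kappa> i = \<phi> \<bullet> \<theta> i" unfolding \<phi>y x\<kappa>[OF i] \<phi>\<theta>[OF i] .
      qed (use i in simp_all)
      then have "monad_mor_on X \<Q> \<B>' y \<and> (\<forall>i \<in> Obj I. y \<bullet> \<kappa> i = \<theta> i)" using y by (simp add: monad_mor_on_def)
      moreover have "monad_mor_on X \<Q> \<B>' h \<and> (\<forall>i \<in> Obj I. h \<bullet> \<kappa> i = \<theta> i)" using h h\<kappa> by blast
      ultimately have "y = h" by (rule ex1_unique[OF h_ex1])
      then show "g = (\<Q>, \<phi> \<bullet> h, \<B>)" using gx \<phi>y by simp
    qed
  qed
  then show "\<exists>c \<kappa>. is_colimit I (Mnd D) F c \<kappa>" by blast
qed

end

theorem corollary3p11: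
  fixes D :: "('o, 'v, 'h, 'c) double_cat"
  assumes "infinite (UNIV :: 'i set)"
    and "double_category D"
    and "fibrant D"
    and "stable_local_colimits TYPE('i) D"
  shows "cocomplete TYPE('i) (Mnd D)"
proof -
  interpret double_category D by (rule assms(2))
  show ?thesis
    unfolding cocomplete_def using category_Mnd has_colimits_Mnd[OF assms(1,4,3)] by blast
qed

end
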